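(* Let $k > 0$ and $X_k = \{A\subseteq\{0,1\}^* \mid \Sigma_k^{\mathrm{P},A} = \Pi_k^{\mathrm{P},A}\}$. If $X_k$ has $\mathrm{p}_2$-betting-game measure zero, then $\Sigma_k^{\mathrm{P}} \neq \mathrm{EXP}$.
   Context: $\Sigma_k^{\mathrm{P},A},\Pi_k^{\mathrm{P},A}$ denote the $k$-th levels of the polynomial-time hierarchy relative to oracle $A$; $\mathrm{EXP}=\mathrm{DTIME}(2^{n^{O(1)}})$. A betting game $G$ is an oracle Turing machine with a capital tape and a bet tape that works in rounds $i=1,2,\dots$: at the start of round $i$ the capital tape holds a nonnegative rational $C_{i-1}$ (with $C_0>0$ rational); $G$ computes a string $x_i$ not among the previously chosen $x_1,\dots,x_{i-1}$, a bet amount $0\le B_i\le C_{i-1}$ and a sign $b_i\in\{-1,+1\}$; then for the oracle language $A$, the new capital is $C_i=C_{i-1}+B_i$ if ($x_i\in A$ and $b_i=+1$) or ($x_i\notin A$ and $b_i=-1$), and $C_i=C_{i-1}-B_i$ otherwise (the machine is charged for writing the new capital). $G$ succeeds on $A$ if $\sup_i C_i=\infty$ when playing against $A$. $G$ runs in time $t(2^n)$ if for every language $A$, every string of length $n$ chosen by $G$ is chosen within the first $t(2^n)$ steps of the computation. A $\mathrm{p}_2$-betting game is one running in time $t(N)=2^{(\log N)^{O(1)}}$. A class $X$ of languages has $\mathrm{p}_2$-betting-game measure 0 if some $\mathrm{p}_2$-betting game succeeds on every language in $X$. *)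

theory Defs
  imports Complex_Main
begin

type_synonym language = "bool list set"

section \<open>Multi-tape oracle Turing machines\<close>

datatype symbol = Blank | Bit bool | Sep | Sym nat

datatype state = Start | Accept | Reject | Query | Yes | No | Work nat

datatype direction = Lft | Stay | Rgt

text \<open>Tapes are infinite in both directions; a tape is its contents with the head position.\<close>

type_synonym tape = "(int \<Rightarrow> symbol) \<times> int"

type_synonym action = "state \<times> (symbol \<times> direction) list"

record machine =
  tape_count :: nat
  states :: "state set"
  alphabet :: "symbol set"
  delta :: "state \<Rightarrow> symbol list \<Rightarrow> action set"

record config =
  state :: state
  tapes :: "tape list"

text \<open>Tape 1 is the query tape of every machine. The values of \<^term>\<open>delta M\<close> outside
  the finite domain \<^term>\<open>states M\<close>, \<^term>\<open>alphabet M\<close> never matter for a well-formed machine.\<close>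

definition wf_machine :: "'a machine_scheme \<Rightarrow> bool" where
  "wf_machine M \<longleftrightarrow>
     finite (states M) \<and> {Start, Accept, Reject, Query, Yes, No} \<subseteq> states M \<and>
     finite (alphabet M) \<and> {Blank, Bit False, Bit True, Sep} \<subseteq> alphabet M \<and>
     2 \<le> tape_count M \<and>
     (\<forall>q\<in>states M. \<forall>ss. length ss = tape_count M \<and> set ss \<subseteq> alphabet M \<longrightarrow>
        (\<forall>(q', ws)\<in>delta M q ss.
           q' \<in> states M \<and> length ws = tape_count M \<and> fst ` set ws \<subseteq> alphabet M))"

definition deterministic :: "'a machine_scheme \<Rightarrow> bool" where
  "deterministic M \<longleftrightarrow>
     (\<forall>q\<in>states M. \<forall>ss. length ss = tape_count M \<and> set ss \<subseteq> alphabet M \<longrightarrow>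
        (\<forall>a\<in>delta M q ss. \<forall>a'\<in>delta M q ss. a = a'))"

definition oracle_free :: "'a machine_scheme \<Rightarrow> bool" where
  "oracle_free M \<longleftrightarrow>
     (\<forall>q\<in>states M. \<forall>ss. length ss = tape_count M \<and> set ss \<subseteq> alphabet M \<longrightarrow>
        (\<forall>(q', ws)\<in>delta M q ss. q' \<noteq> Query))"

fun shift :: "direction \<Rightarrow> int \<Rightarrow> int" where
  "shift Lft i = i - 1"
| "shift Stay i = i"
| "shift Rgt i = i + 1"

definition scanned :: "tape \<Rightarrow> symbol" where
  "scanned t = fst t (snd t)"

definition update_tape :: "symbol \<times> direction \<Rightarrow> tape \<Rightarrow> tape" where
  "update_tape w t = ((fst t)(snd t := fst w), shift (snd w) (snd t))"

definition perform :: "action \<Rightarrow> 'c config_scheme \<Rightarrow> 'c config_scheme" where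
  "perform a c = c\<lparr>state := fst a, tapes := map2 update_tape (snd a) (tapes c)\<rparr>"

definition moves :: "'a machine_scheme \<Rightarrow> 'c config_scheme \<Rightarrow> 'c config_scheme set" where
  "moves M c = (if state c \<in> {Query, Accept, Reject} then {}
     else (\<lambda>a. perform a c) ` delta M (state c) (map scanned (tapes c)))"

definition tape_of :: "symbol list \<Rightarrow> tape" where
  "tape_of ss = ((\<lambda>i. if 0 \<le> i \<and> i < int (length ss) then ss ! nat i else Blank), 0)"

abbreviation blank_tape :: tape where
  "blank_tape \<equiv> tape_of []"

text \<open>The longest block of symbols satisfying \<open>P\<close> that starts in cell 0. Every tape occurring in a
  computation has only finitely many nonblank cells, so the minimum exists.\<close>

definition block :: "(symbol \<Rightarrow> bool) \<Rightarrow> tape \<Rightarrow> symbol list" where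
  "block P t = map (\<lambda>i. fst t (int i)) [0..<(LEAST n. \<not> P (fst t (int n)))]"

definition tape_contents :: "tape \<Rightarrow> symbol list" where
  "tape_contents t = block (\<lambda>s. s \<noteq> Blank) t"

definition tape_word :: "tape \<Rightarrow> bool list" where
  "tape_word t = map (\<lambda>s. s = Bit True) (block (\<lambda>s. s \<in> range Bit) t)"

definition query_word :: "'c config_scheme \<Rightarrow> bool list" where
  "query_word c = tape_word (tapes c ! 1)"

definition answer :: "language \<Rightarrow> 'c config_scheme \<Rightarrow> 'c config_scheme" where
  "answer A c = c\<lparr>state := (if query_word c \<in> A then Yes else No),
                  tapes := (tapes c)[1 := blank_tape]\<rparr>"

definition oracle_step :: "language \<Rightarrow> machine \<Rightarrow> config \<Rightarrow> config \<Rightarrow> bool" where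
  "oracle_step A M c c' \<longleftrightarrow> (if state c = Query then c' = answer A c else c' \<in> moves M c)"

definition input_config :: "machine \<Rightarrow> bool list \<Rightarrow> config" where
  "input_config M x = \<lparr>state = Start,
     tapes = tape_of (map Bit x) # replicate (tape_count M - 1) blank_tape\<rparr>"

text \<open>Every computation path on inputs of length \<open>n\<close> has at most \<open>T n\<close> steps, and an input is
  accepted iff some path reaches the accepting state.\<close>

definition decides_in_time ::
    "language \<Rightarrow> machine \<Rightarrow> language \<Rightarrow> (nat \<Rightarrow> nat) \<Rightarrow> bool" where
  "decides_in_time A M L T \<longleftrightarrow>
     (\<forall>x. (\<forall>m c. (oracle_step A M ^^ m) (input_config M x) c \<longrightarrow> m \<le> T (length x)) \<and>
          (x \<in> L \<longleftrightarrow> (\<exists>c. (oracle_step A M)\<^sup>*\<^sup>* (input_config M x) c \<and> state c = Accept)))"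


section \<open>Complexity classes\<close>

definition P_class :: "language \<Rightarrow> language set" where
  "P_class A = {L. \<exists>M c. wf_machine M \<and> deterministic M \<and>
                         decides_in_time A M L (\<lambda>n. n ^ c + c)}"

definition NP_class :: "language \<Rightarrow> language set" where
  "NP_class A = {L. \<exists>M c. wf_machine M \<and> decides_in_time A M L (\<lambda>n. n ^ c + c)}"

definition EXP :: "language set" where
  "EXP = {L. \<exists>M c. wf_machine M \<and> deterministic M \<and> oracle_free M \<and>
                   decides_in_time {} M L (\<lambda>n. 2 ^ (n ^ c + c))}"

text \<open>The unrelativized levels are those relative to the empty oracle.\<close>

fun Sigma_P :: "nat \<Rightarrow> language \<Rightarrow> language set" where
  "Sigma_P 0 A = P_class A"
| "Sigma_P (Suc k) A = (\<Union>B\<in>Sigma_P k A. NP_class B)"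

definition Pi_P :: "nat \<Rightarrow> language \<Rightarrow> language set" where
  "Pi_P k A = {- L | L. L \<in> Sigma_P k A}"


section \<open>Betting games\<close>

text \<open>Tape 0 is the capital tape and tape 2 the bet tape. A rational is written as numerator,
  separator, denominator in binary, least significant bit first; the capital is in lowest terms.
  The bet tape holds a sign bit (\<^const>\<open>True\<close> for +1) followed by the amount.\<close>

record betting_game = machine +
  initial_capital :: rat

record game_config = config +
  capital :: rat
  elapsed :: nat

fun binary :: "nat \<Rightarrow> bool list" where
  "binary n = (if n = 0 then [] else odd n # binary (n div 2))"

declare binary.simps [simp del]

definition rat_symbols :: "rat \<Rightarrow> symbol list" where
  "rat_symbols r = (case quotient_of r of (p, q) \<Rightarrow>
     map Bit (binary (nat p)) @ Sep # map Bit (binary (nat q)))"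

definition nat_of_symbols :: "symbol list \<Rightarrow> nat" where
  "nat_of_symbols ss = horner_sum (\<lambda>s. of_bool (s = Bit True)) 2 ss"

definition rat_of_symbols :: "symbol list \<Rightarrow> rat" where
  "rat_of_symbols ss =
     of_nat (nat_of_symbols (takeWhile (\<lambda>s. s \<noteq> Sep) ss)) /
     of_nat (nat_of_symbols (tl (dropWhile (\<lambda>s. s \<noteq> Sep) ss)))"

definition bet_well_formed :: "game_config \<Rightarrow> bool" where
  "bet_well_formed c \<longleftrightarrow>
     (\<exists>b ns ds. tape_contents (tapes c ! 2) = Bit b # map Bit ns @ Sep # map Bit ds \<and>
                nat_of_symbols (map Bit ds) > 0)"

definition bet_sign :: "game_config \<Rightarrow> bool" where
  "bet_sign c \<longleftrightarrow> hd (tape_contents (tapes c ! 2)) = Bit True"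

definition bet_amount :: "game_config \<Rightarrow> rat" where
  "bet_amount c = rat_of_symbols (tl (tape_contents (tapes c ! 2)))"

definition new_capital :: "language \<Rightarrow> game_config \<Rightarrow> rat" where
  "new_capital A c =
     (if query_word c \<in> A \<and> bet_sign c \<or> query_word c \<notin> A \<and> \<not> bet_sign c
      then capital c + bet_amount c else capital c - bet_amount c)"

text \<open>Entering the query state ends a round. The machine learns the answer, the new capital is
  written on the capital tape and its length charged, and the query and bet tapes are blanked.
  The actual capital is the field \<^const>\<open>capital\<close>, so overwriting the capital tape has no
  effect on it.\<close>

definition settle :: "language \<Rightarrow> game_config \<Rightarrow> game_config" where
  "settle A c = (let C = new_capital A c in
     (answer A c)\<lparr>tapes := (tapes c)[0 := tape_of (rat_symbols C), 1 := blank_tape, 2 := blank_tape],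
                  capital := C,
                  elapsed := elapsed c + 1 + length (rat_symbols C)\<rparr>)"

text \<open>A game that halts stays in its last configuration and makes no further bets.\<close>

definition game_step :: "language \<Rightarrow> betting_game \<Rightarrow> game_config \<Rightarrow> game_config" where
  "game_step A G c =
     (if state c = Query then settle A c
      else if moves G c = {} then c
      else (the_elem (moves G c))\<lparr>elapsed := elapsed c + 1\<rparr>)"

definition game_start :: "betting_game \<Rightarrow> game_config" where
  "game_start G = \<lparr>state = Start,
     tapes = tape_of (rat_symbols (initial_capital G)) # replicate (tape_count G - 1) blank_tape,
     capital = initial_capital G, elapsed = 0\<rparr>"

definition play :: "language \<Rightarrow> betting_game \<Rightarrow> nat \<Rightarrow> game_config" where
  "play A G m = (game_step A G ^^ m) (game_start G)"

definition is_betting_game :: "betting_game \<Rightarrow> bool" where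
  "is_betting_game G \<longleftrightarrow>
     wf_machine G \<and> deterministic G \<and> 3 \<le> tape_count G \<and> initial_capital G > 0 \<and>
     (\<forall>A m. state (play A G m) = Query \<longrightarrow>
        bet_well_formed (play A G m) \<and>
        0 \<le> bet_amount (play A G m) \<and> bet_amount (play A G m) \<le> capital (play A G m) \<and>
        (\<forall>m'<m. state (play A G m') = Query \<longrightarrow>
                query_word (play A G m') \<noteq> query_word (play A G m)))"

definition succeeds_on :: "betting_game \<Rightarrow> language \<Rightarrow> bool" where
  "succeeds_on G A \<longleftrightarrow> \<not> bdd_above (range (\<lambda>m. capital (play A G m)))"

text \<open>Time \<open>t(2\<^sup>n)\<close>.\<close>

definition runs_in_time :: "betting_game \<Rightarrow> (nat \<Rightarrow> nat) \<Rightarrow> bool" where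
  "runs_in_time G t \<longleftrightarrow>
     (\<forall>A m. state (play A G m) = Query \<longrightarrow>
        elapsed (play A G m) \<le> t (2 ^ length (query_word (play A G m))))"

definition p2_bounded :: "(nat \<Rightarrow> nat) \<Rightarrow> bool" where
  "p2_bounded t \<longleftrightarrow>
     (\<exists>c::nat. \<forall>N\<ge>1. real (t N) \<le> 2 powr (log 2 (real N) ^ c + real c))"

definition p2_betting_game :: "betting_game \<Rightarrow> bool" where
  "p2_betting_game G \<longleftrightarrow> is_betting_game G \<and> (\<exists>t. p2_bounded t \<and> runs_in_time G t)"

definition p2_betting_game_measure_zero :: "language set \<Rightarrow> bool" where
  "p2_betting_game_measure_zero X \<longleftrightarrow> (\<exists>G. p2_betting_game G \<and> (\<forall>A\<in>X. succeeds_on G A))"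

end

theory Submission
  imports Defs
begin

text \<open>Suppose \<open>Sigma_P k {} = EXP\<close>. For a language \<open>A\<close> in EXP, \<open>Sigma_P k A\<close> lies between
  \<open>Sigma_P k {}\<close> and EXP, by exhaustive simulation, so it equals EXP and is closed under complement. Hence a
  betting game that succeeds on all \<open>A\<close> with \<open>Sigma_P k A = Pi_P k A\<close> succeeds on all of EXP. But the language that
  answers each query of the game so that the bet is lost is itself in EXP: a string of length \<open>n\<close> is queried
  within the first \<open>t (2 ^ n)\<close> steps or not at all, so it suffices to simulate the game for that long.

  Membership in EXP is reduced to polynomial time on inputs padded in unary. Polynomial-time functions
  operate on binary trees, kept in prefix notation on a stack, and are closed under
  iteration as long as the intermediate results stay polynomially bounded.\<close>

section \<open>Structured programs for multi-tape machines\<close>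

text \<open>A betting game promises legal bets and fresh queries only in plays against a genuine
  language, whereas the adversary makes up its answers during the play. That these answers form a
  language at all is proved by induction: as long as no word has been queried twice, the answers
  given so far extend to a language, and the promise for that language covers the next query. The
  replay needs exact arithmetic, since the game reads its capital in lowest terms; hence binary
  multiplication, division and gcd, together with bounds on the number of digits. Both inclusions
  around EXP rest on explicit machines. The lower one is not immediate, because a machine for the
  empty oracle may ask queries and would be misled by positive answers of \<open>A\<close>. In the
  upper one the padding is handed on unchanged to the decision procedure of the oracle, where it
  exceeds what short queries require; this is why \<open>pad_decidable\<close> speaks of all
  sufficiently large paddings.\<close>

datatype com =
    Act "symbol list \<Rightarrow> (symbol \<times> direction) list"
  | Seq com com (infixr \<open>;;\<close> 60)
  | Cond "symbol list \<Rightarrow> bool" com com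
  | Loop "symbol list \<Rightarrow> bool" com

definition stay :: "symbol list \<Rightarrow> (symbol \<times> direction) list" where
  "stay ss = map (\<lambda>s. (s, Stay)) ss"

text \<open>Control is a stack of commands still to be executed. Compound commands only unfold this
  stack; \<open>Act\<close> alone touches the tapes. The empty stack idles, so \<open>run\<close> is
  total.\<close>

fun successor :: "com list \<Rightarrow> symbol list \<Rightarrow> com list \<times> (symbol \<times> direction) list" where
  "successor [] ss = ([], stay ss)"
| "successor (Act f # k) ss = (k, f ss)"
| "successor ((a ;; b) # k) ss = (a # b # k, stay ss)"
| "successor (Cond P a b # k) ss = ((if P ss then a else b) # k, stay ss)"
| "successor (Loop P a # k) ss = (if P ss then a # Loop P a # k else k, stay ss)"

definition run :: "com list \<times> tape list \<Rightarrow> com list \<times> tape list" where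
  "run kt = (let (k', ws) = successor (fst kt) (map scanned (snd kt))
             in (k', map2 update_tape ws (snd kt)))"

text \<open>A stack occupies the cells to the right of the head; what is to the left of the head is
  irrelevant, so popping need not erase anything.\<close>

definition holds_stack :: "tape \<Rightarrow> symbol list \<Rightarrow> bool" where
  "holds_stack t xs \<longleftrightarrow> Blank \<notin> set xs \<and>
     (\<forall>i. fst t (snd t + int i) = (if i < length xs then xs ! i else Blank))"

definition tops :: "symbol list list \<Rightarrow> symbol list" where
  "tops s = map (\<lambda>xs. case xs of [] \<Rightarrow> Blank | x # _ \<Rightarrow> x) s"

definition exec :: "com \<Rightarrow> symbol list list \<Rightarrow> symbol list list \<Rightarrow> nat \<Rightarrow> bool" where
  "exec c s s' n \<longleftrightarrow> (\<forall>ts k. list_all2 holds_stack ts s \<longrightarrow>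
     (\<exists>ts' m. m \<le> n \<and> list_all2 holds_stack ts' s' \<and> (run ^^ m) (c # k, ts) = (k, ts')))"

lemma map2_stay [simp]: "map2 update_tape (stay (map scanned ts)) ts = ts"
  by (rule nth_equalityI)
     (auto simp: stay_def update_tape_def scanned_def prod_eq_iff)

lemma map2_stay_update:
  "i < length ts \<Longrightarrow>
   map2 update_tape ((stay (map scanned ts))[i := w]) ts = ts[i := update_tape w (ts ! i)]"
  by (rule nth_equalityI)
     (auto simp: stay_def update_tape_def scanned_def prod_eq_iff nth_list_update)

lemma scanned_stack: "holds_stack t xs \<Longrightarrow> scanned t = (case xs of [] \<Rightarrow> Blank | x # _ \<Rightarrow> x)"
  unfolding holds_stack_def scanned_def by (auto dest!: spec[of _ 0] split: list.splits)

lemma scanned_stacks: "list_all2 holds_stack ts s \<Longrightarrow> map scanned ts = tops s"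
  unfolding tops_def by (induction rule: list_all2_induct) (auto simp: scanned_stack)

lemma exec_mono: "exec c s s' m \<Longrightarrow> m \<le> n \<Longrightarrow> exec c s s' n"
  unfolding exec_def by (meson le_trans)

lemma exec_seq:
  assumes "exec a s s1 m1" "exec b s1 s2 m2" "m1 + m2 + 1 \<le> n"
  shows "exec (a ;; b) s s2 n"
  unfolding exec_def
proof (intro allI impI)
  fix ts k assume ts: "list_all2 holds_stack ts s"
  obtain ts1 n1 where 1: "n1 \<le> m1" "list_all2 holds_stack ts1 s1"
      "(run ^^ n1) (a # b # k, ts) = (b # k, ts1)"
    using assms(1) ts unfolding exec_def by blast
  obtain ts2 n2 where 2: "n2 \<le> m2" "list_all2 holds_stack ts2 s2"
      "(run ^^ n2) (b # k, ts1) = (k, ts2)"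
    using assms(2) 1 unfolding exec_def by blast
  have "(run ^^ (n2 + n1 + 1)) ((a ;; b) # k, ts) = (k, ts2)"
    unfolding funpow_add using 1 2 by (simp add: run_def)
  moreover have "n2 + n1 + 1 \<le> n" using 1 2 assms(3) by simp
  ultimately show "\<exists>ts' m. m \<le> n \<and> list_all2 holds_stack ts' s2 \<and> (run ^^ m) ((a ;; b) # k, ts) = (k, ts')"
    using 2 by blast
qed

lemma exec_cond:
  assumes "P (tops s) \<Longrightarrow> exec a s s' m" "\<not> P (tops s) \<Longrightarrow> exec b s s' m" "m + 1 \<le> n"
  shows "exec (Cond P a b) s s' n"
  unfolding exec_def
proof (intro allI impI)
  fix ts k assume ts: "list_all2 holds_stack ts s"
  let ?c = "if P (tops s) then a else b"
  have "exec ?c s s' m" using assms by auto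
  then obtain ts1 n1 where 1: "n1 \<le> m" "list_all2 holds_stack ts1 s'"
      "(run ^^ n1) (?c # k, ts) = (k, ts1)"
    using ts unfolding exec_def by blast
  have "(run ^^ (n1 + 1)) (Cond P a b # k, ts) = (k, ts1)"
    unfolding funpow_add using 1 by (simp add: run_def scanned_stacks[OF ts, symmetric])
  then show "\<exists>ts' m. m \<le> n \<and> list_all2 holds_stack ts' s' \<and> (run ^^ m) (Cond P a b # k, ts) = (k, ts')"
    using 1 assms(3) by (meson add_le_mono1 le_trans)
qed

lemma exec_loop_stop:
  assumes "\<not> P (tops s)"
  shows "exec (Loop P a) s s 1"
  unfolding exec_def
proof (intro allI impI)
  fix ts k assume ts: "list_all2 holds_stack ts s"
  have "(run ^^ 1) (Loop P a # k, ts) = (k, ts)"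
    using assms by (simp add: run_def scanned_stacks[OF ts, symmetric])
  then show "\<exists>ts' m. m \<le> 1 \<and> list_all2 holds_stack ts' s \<and> (run ^^ m) (Loop P a # k, ts) = (k, ts')"
    using ts by blast
qed

lemma exec_loop_step:
  assumes "P (tops s)" "exec a s s1 m1" "exec (Loop P a) s1 s2 m2" "m1 + m2 + 1 \<le> n"
  shows "exec (Loop P a) s s2 n"
  unfolding exec_def
proof (intro allI impI)
  fix ts k assume ts: "list_all2 holds_stack ts s"
  obtain ts1 n1 where 1: "n1 \<le> m1" "list_all2 holds_stack ts1 s1"
      "(run ^^ n1) (a # Loop P a # k, ts) = (Loop P a # k, ts1)"
    using assms(2) ts unfolding exec_def by blast
  obtain ts2 n2 where 2: "n2 \<le> m2" "list_all2 holds_stack ts2 s2"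
      "(run ^^ n2) (Loop P a # k, ts1) = (k, ts2)"
    using assms(3) 1 unfolding exec_def by blast
  have "(run ^^ (n2 + n1 + 1)) (Loop P a # k, ts) = (k, ts2)"
    unfolding funpow_add using 1 2 assms(1) by (simp add: run_def scanned_stacks[OF ts, symmetric])
  moreover have "n2 + n1 + 1 \<le> n" using 1 2 assms(4) by simp
  ultimately show "\<exists>ts' m. m \<le> n \<and> list_all2 holds_stack ts' s2 \<and> (run ^^ m) (Loop P a # k, ts) = (k, ts')"
    using 2 by blast
qed

section \<open>Elementary stack operations\<close>

definition skip :: com where
  "skip = Act stay"

definition pop :: "nat \<Rightarrow> com" where
  "pop i = Act (\<lambda>ss. (stay ss)[i := (ss ! i, Rgt)])"

text \<open>An action writes before it moves, so pushing takes two actions: step left over the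
  unchanged cell, then write there.\<close>

definition copy :: "nat \<Rightarrow> nat \<Rightarrow> com" where
  "copy i j = Act (\<lambda>ss. (stay ss)[j := (ss ! j, Lft)]) ;; Act (\<lambda>ss. (stay ss)[j := (ss ! i, Stay)])"

definition push :: "nat \<Rightarrow> symbol \<Rightarrow> com" where
  "push i x = Act (\<lambda>ss. (stay ss)[i := (ss ! i, Lft)]) ;; Act (\<lambda>ss. (stay ss)[i := (x, Stay)])"

definition move :: "nat \<Rightarrow> nat \<Rightarrow> com" where
  "move i j = copy i j ;; pop i"

lemma exec_skip: "exec skip s s 1"
  unfolding exec_def skip_def
proof (intro allI impI)
  fix ts k assume ts: "list_all2 holds_stack ts s"
  have "(run ^^ 1) (Act stay # k, ts) = (k, ts)" by (simp add: run_def)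
  with ts show "\<exists>ts' m. m \<le> 1 \<and> list_all2 holds_stack ts' s \<and> (run ^^ m) (Act stay # k, ts) = (k, ts')"
    by blast
qed

lemma holds_stack_pop:
  assumes "holds_stack t xs"
  shows "holds_stack (update_tape (scanned t, Rgt) t) (tl xs)"
proof -
  have "fst t (snd t + 1 + int i) = (if i < length (tl xs) then tl xs ! i else Blank)" for i
    using assms[unfolded holds_stack_def, THEN conjunct2, rule_format, of "Suc i"]
    by (cases xs) (auto simp: algebra_simps)
  moreover have "Blank \<notin> set (tl xs)"
    using assms unfolding holds_stack_def by (cases xs) auto
  ultimately show ?thesis
    by (simp add: holds_stack_def update_tape_def scanned_def)
qed

lemma holds_stack_push:
  assumes "holds_stack t xs" "x \<noteq> Blank"
  shows "holds_stack (update_tape (x, Stay) (update_tape (scanned t, Lft) t)) (x # xs)"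
proof -
  have *: "fst t (snd t + int i) = (if i < length xs then xs ! i else Blank)" for i
    using assms(1) unfolding holds_stack_def by blast
  have "((fst t)(snd t - 1 := x)) (snd t - 1 + int i) = (if i < length (x # xs) then (x # xs) ! i else Blank)" for i
  proof (cases i)
    case (Suc j)
    then show ?thesis using *[of j] by simp
  qed simp
  moreover have "Blank \<notin> set (x # xs)"
    using assms unfolding holds_stack_def by auto
  ultimately show ?thesis
    by (simp add: holds_stack_def update_tape_def scanned_def)
qed

lemma exec_pop:
  assumes "i < length s"
  shows "exec (pop i) s (s[i := tl (s ! i)]) 1"
  unfolding exec_def pop_def
proof (intro allI impI)
  fix ts k assume ts: "list_all2 holds_stack ts s"
  let ?f = "\<lambda>ss. (stay ss)[i := (ss ! i, Rgt)]"
  have i: "i < length ts" using assms ts by (simp add: list_all2_lengthD)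
  have "(run ^^ 1) (Act ?f # k, ts) = (k, ts[i := update_tape (scanned (ts ! i), Rgt) (ts ! i)])"
    using i by (simp add: run_def map2_stay_update)
  moreover have "list_all2 holds_stack (ts[i := update_tape (scanned (ts ! i), Rgt) (ts ! i)]) (s[i := tl (s ! i)])"
    by (intro list_all2_update_cong ts holds_stack_pop list_all2_nthD[OF ts i])
  ultimately show "\<exists>ts' m. m \<le> 1 \<and> list_all2 holds_stack ts' (s[i := tl (s ! i)]) \<and>
      (run ^^ m) (Act ?f # k, ts) = (k, ts')"
    by blast
qed

text \<open>Between the two actions tape \<open>i\<close> scans whatever junk lies left of its
  stack. The symbol pushed may therefore depend on the other tapes only, which is what the second
  premise expresses; it serves both \<open>push\<close> and \<open>copy\<close>.\<close>

lemma exec_push_gen: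
  assumes i: "i < length s" and x: "\<And>ts ts'. list_all2 holds_stack ts s \<Longrightarrow> length ts' = length ts \<Longrightarrow>
      (\<And>j. j < length s \<Longrightarrow> j \<noteq> i \<Longrightarrow> ts' ! j = ts ! j) \<Longrightarrow> g (map scanned ts') = x"
    and nb: "x \<noteq> Blank"
  shows "exec (Act (\<lambda>ss. (stay ss)[i := (ss ! i, Lft)]) ;; Act (\<lambda>ss. (stay ss)[i := (g ss, Stay)]))
           s (s[i := x # s ! i]) 3"
  unfolding exec_def
proof (intro allI impI)
  fix ts k assume ts: "list_all2 holds_stack ts s"
  let ?a = "Act (\<lambda>ss. (stay ss)[i := (ss ! i, Lft)])" and ?b = "Act (\<lambda>ss. (stay ss)[i := (g ss, Stay)])"
  have i': "i < length ts" using i ts by (simp add: list_all2_lengthD)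
  let ?t1 = "update_tape (scanned (ts ! i), Lft) (ts ! i)"
  have g: "g (map scanned (ts[i := ?t1])) = x"
    by (rule x[OF ts]) simp_all
  have "(run ^^ 1) ((?a ;; ?b) # k, ts) = (?a # ?b # k, ts)" by (simp add: run_def)
  moreover have "(run ^^ 1) (?a # ?b # k, ts) = (?b # k, ts[i := ?t1])"
    using i' by (simp add: run_def map2_stay_update)
  moreover have "(run ^^ 1) (?b # k, ts[i := ?t1]) = (k, ts[i := update_tape (x, Stay) ?t1])"
    using i' g map2_stay_update[of i "ts[i := ?t1]" "(x, Stay)"] by (simp add: run_def)
  ultimately have "(run ^^ (1 + 1 + 1)) ((?a ;; ?b) # k, ts) = (k, ts[i := update_tape (x, Stay) ?t1])"
    unfolding funpow_add by simp
  moreover have "list_all2 holds_stack (ts[i := update_tape (x, Stay) ?t1]) (s[i := x # s ! i])"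
    by (intro list_all2_update_cong ts holds_stack_push list_all2_nthD[OF ts i'] nb)
  moreover have "1 + 1 + 1 \<le> (3::nat)" by simp
  ultimately show "\<exists>ts' m. m \<le> 3 \<and> list_all2 holds_stack ts' (s[i := x # s ! i]) \<and>
      (run ^^ m) ((?a ;; ?b) # k, ts) = (k, ts')"
    by blast
qed

lemma exec_push:
  assumes "i < length s" "x \<noteq> Blank"
  shows "exec (push i x) s (s[i := x # s ! i]) 3"
  unfolding push_def by (rule exec_push_gen) (use assms in auto)

lemma exec_copy:
  assumes "i < length s" "j < length s" "i \<noteq> j" "s ! i = x # xs" "x \<noteq> Blank"
  shows "exec (copy i j) s (s[j := x # s ! j]) 3"
  unfolding copy_def
proof (rule exec_push_gen)
  fix ts ts' assume ts: "list_all2 holds_stack ts s" "length ts' = length ts"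
    "\<And>k. k < length s \<Longrightarrow> k \<noteq> j \<Longrightarrow> ts' ! k = ts ! k"
  have "scanned (ts ! i) = x"
    using list_all2_nthD2[OF ts(1) assms(1)] assms(4) by (simp add: scanned_stack)
  then show "map scanned ts' ! i = x"
    using ts assms by (simp add: list_all2_lengthD)
qed (use assms in auto)

lemma exec_move:
  assumes "i < length s" "j < length s" "i \<noteq> j" "s ! i = x # xs" "x \<noteq> Blank"
  shows "exec (move i j) s (s[j := x # s ! j, i := xs]) 5"
proof -
  have "exec (pop i) (s[j := x # s ! j]) ((s[j := x # s ! j])[i := tl (s[j := x # s ! j] ! i)]) 1"
    using assms by (intro exec_pop) simp
  then have "exec (pop i) (s[j := x # s ! j]) (s[j := x # s ! j, i := xs]) 1"
    using assms by simp
  then show ?thesis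
    unfolding move_def by (rule exec_seq[OF exec_copy[OF assms]]) simp
qed

subsection \<open>Compilation to Turing machines\<close>

definition stack_alphabet :: "symbol set" where
  "stack_alphabet = {Blank, Bit False, Bit True, Sep}"

fun wf_com :: "com \<Rightarrow> bool" where
  "wf_com (Act f) \<longleftrightarrow> (\<forall>ss. length ss = 4 \<and> set ss \<subseteq> stack_alphabet \<longrightarrow>
     length (f ss) = 4 \<and> fst ` set (f ss) \<subseteq> stack_alphabet)"
| "wf_com (a ;; b) \<longleftrightarrow> wf_com a \<and> wf_com b"
| "wf_com (Cond P a b) \<longleftrightarrow> wf_com a \<and> wf_com b"
| "wf_com (Loop P a) \<longleftrightarrow> wf_com a"

text \<open>The control stacks that can arise while \<open>c\<close> is executed on top of
  \<open>k\<close>, up to the moment when \<open>k\<close> itself is left. They are finitely many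
  because a loop body runs on top of the very stack that started it; they become the states of the
  compiled machine.\<close>

fun conts :: "com \<Rightarrow> com list \<Rightarrow> com list set" where
  "conts (Act f) k = {Act f # k}"
| "conts (a ;; b) k = {(a ;; b) # k} \<union> conts a (b # k) \<union> conts b k"
| "conts (Cond P a b) k = {Cond P a b # k} \<union> conts a k \<union> conts b k"
| "conts (Loop P a) k = {Loop P a # k} \<union> conts a (Loop P a # k)"

lemma finite_conts: "finite (conts c k)"
  by (induction c k rule: conts.induct) auto

lemma conts_self: "c # k \<in> conts c k"
  by (cases c) auto

lemma conts_next: "k' \<in> conts c k \<Longrightarrow> fst (successor k' ss) \<in> insert k (conts c k)"
proof (induction c k arbitrary: k' rule: conts.induct)
  case (1 f k)
  then show ?case by auto
next
  case (2 a b k)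
  then consider "k' = (a ;; b) # k" | "k' \<in> conts a (b # k)" | "k' \<in> conts b k" by auto
  then show ?case
  proof cases
    case 1 then show ?thesis using conts_self[of a "b # k"] by simp
  next
    case c2: 2 then show ?thesis using 2(1)[of k'] conts_self[of b k] by auto
  next
    case 3 then show ?thesis using 2(2)[of k'] by auto
  qed
next
  case (3 P a b k)
  then consider "k' = Cond P a b # k" | "k' \<in> conts a k" | "k' \<in> conts b k" by auto
  then show ?case
  proof cases
    case 1 then show ?thesis using conts_self[of a k] conts_self[of b k] by simp
  next
    case 2 then show ?thesis using 3(1)[of k'] by auto
  next
    case c3: 3 then show ?thesis using 3(2)[of k'] by auto
  qed
next
  case (4 P a k)
  then consider "k' = Loop P a # k" | "k' \<in> conts a (Loop P a # k)" by auto
  then show ?case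
  proof cases
    case 1 then show ?thesis using conts_self[of a "Loop P a # k"] by auto
  next
    case 2 then show ?thesis using 4(1)[of k'] by auto
  qed
qed

lemma wf_conts:
  "wf_com c \<Longrightarrow> list_all wf_com k \<Longrightarrow> k' \<in> conts c k \<Longrightarrow> list_all wf_com k'"
  by (induction c k arbitrary: k' rule: conts.induct) auto

lemma wf_next:
  assumes "list_all wf_com k" "length ss = 4" "set ss \<subseteq> stack_alphabet"
  shows "length (snd (successor k ss)) = 4 \<and> fst ` set (snd (successor k ss)) \<subseteq> stack_alphabet"
  using assms by (cases "(k, ss)" rule: successor.cases) (auto simp: stay_def image_image)

text \<open>Work states carry only numbers, so \<open>e\<close> numbers the control stacks. The
  empty control stack leads to the verdict, read off the top of stack 0. No transition enters
  \<open>Query\<close>, so tape 1 can be used as an ordinary stack.\<close>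

definition compile :: "(com list \<Rightarrow> nat) \<Rightarrow> com \<Rightarrow> machine" where
  "compile e c = \<lparr>tape_count = 4,
     states = {Start, Accept, Reject, Query, Yes, No} \<union> Work ` e ` insert [] (conts c []),
     alphabet = stack_alphabet,
     delta = (\<lambda>q ss. case q of
         Start \<Rightarrow> {(Work (e [c]), stay ss)}
       | Work n \<Rightarrow> (case inv_into (insert [] (conts c [])) e n of
           [] \<Rightarrow> {(if ss ! 0 = Bit True then Accept else Reject, stay ss)}
         | k \<Rightarrow> {(Work (e (fst (successor k ss))), snd (successor k ss))})
       | _ \<Rightarrow> {})\<rparr>"

lemma delta_compile_single:
  "a \<in> delta (compile e c) q ss \<Longrightarrow> a' \<in> delta (compile e c) q ss \<Longrightarrow> a = a'"
  by (auto simp: compile_def split: state.splits list.splits)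

lemma wf_compile:
  assumes "wf_com c"
  shows "wf_machine (compile e c)"
proof -
  let ?S = "insert [] (conts c [])"
  have *: "q' \<in> states (compile e c) \<and> length ws = 4 \<and> fst ` set ws \<subseteq> stack_alphabet"
    if "q \<in> states (compile e c)" "length ss = 4" "set ss \<subseteq> stack_alphabet"
      "(q', ws) \<in> delta (compile e c) q ss" for q ss q' ws
  proof -
    have st: "length (stay ss) = 4" "fst ` set (stay ss) \<subseteq> stack_alphabet"
      using that by (auto simp: stay_def image_image)
    show ?thesis
    proof (cases q)
      case (Work n)
      then have "n \<in> e ` ?S" using that(1) by (auto simp: compile_def)
      then have kS: "inv_into ?S e n \<in> ?S" by (rule inv_into_into)
      show ?thesis
      proof (cases "inv_into ?S e n")
        case Nil
        then show ?thesis using that Work st by (auto simp: compile_def split: if_splits)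
      next
        case (Cons a k)
        then have k: "a # k \<in> conts c []" using kS by simp
        have "list_all wf_com (a # k)" using wf_conts[OF assms _ k] by simp
        note wf_next[OF this that(2,3)]
        moreover have "fst (successor (a # k) ss) \<in> ?S" using conts_next[OF k] by simp
        ultimately show ?thesis using that Work Cons by (auto simp: compile_def)
      qed
    qed (use that st conts_self[of c "[]"] in \<open>auto simp: compile_def\<close>)
  qed
  have "finite (states (compile e c))" "{Start, Accept, Reject, Query, Yes, No} \<subseteq> states (compile e c)"
    "finite (alphabet (compile e c))" "{Blank, Bit False, Bit True, Sep} \<subseteq> alphabet (compile e c)"
    "tape_count (compile e c) = 4" "alphabet (compile e c) = stack_alphabet"
    by (simp_all add: finite_conts compile_def stack_alphabet_def)
  moreover have "case x of (q', ws) \<Rightarrow> q' \<in> states (compile e c) \<and> length ws = 4 \<and> fst ` set ws \<subseteq> stack_alphabet"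
    if "q \<in> states (compile e c)" "length ss = 4" "set ss \<subseteq> stack_alphabet"
      "x \<in> delta (compile e c) q ss" for q ss x
    using *[of q ss "fst x" "snd x"] that by (cases x) simp
  ultimately show ?thesis
    unfolding wf_machine_def by simp blast
qed

lemma oracle_free_compile: "oracle_free (compile e c)"
  unfolding oracle_free_def by (auto simp: compile_def split: state.splits list.splits if_splits)

section \<open>Runs of functional relations\<close>

lemma functional_relpowp:
  fixes r :: "'a \<Rightarrow> 'a \<Rightarrow> bool"
  assumes "\<And>x y z. r x y \<Longrightarrow> r x z \<Longrightarrow> y = z" "(r ^^ n) a b" "(r ^^ n) a c"
  shows "b = c"
  using assms(2,3)
proof (induction n arbitrary: b c)
  case (Suc n)
  obtain y z where yz: "(r ^^ n) a y" "r y b" "(r ^^ n) a z" "r z c"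
    using Suc.prems by auto
  then have "y = z" using Suc.IH by blast
  then show ?case using yz assms(1) by blast
qed simp

text \<open>A longer run would agree with the halting one up to step \<open>n\<close> and then leave
  a configuration without successors. This turns a single halting run into the bound on all paths
  that \<open>decides_in_time\<close> demands.\<close>

lemma functional_relpowp_halt:
  fixes r :: "'a \<Rightarrow> 'a \<Rightarrow> bool"
  assumes "\<And>x y z. r x y \<Longrightarrow> r x z \<Longrightarrow> y = z" "(r ^^ n) a b" "\<And>c. \<not> r b c" "(r ^^ m) a c"
  shows "m \<le> n"
proof (rule ccontr)
  assume "\<not> m \<le> n"
  then obtain d where d: "m = n + Suc d" by (metis add_Suc_right less_imp_Suc_add not_le)
  then obtain y where y: "(r ^^ n) a y" "(r ^^ Suc d) y c"
    using assms(4) by (auto simp: relpowp_add)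
  have "b = y" by (rule functional_relpowp[OF assms(1,2) y(1)])
  then show False using y(2) assms(3) relpowp_Suc_D2 by metis
qed

text \<open>The two additional steps are the transition out of \<open>Start\<close> and the final
  verdict.\<close>

theorem compile_decides:
  assumes wf: "wf_com c"
    and ex: "\<And>x. \<exists>s. s \<noteq> [] \<and> exec c [map Bit x, [], [], []] s (T (length x)) \<and>
      (tops s ! 0 = Bit True \<longleftrightarrow> x \<in> L)"
  shows "\<exists>M. wf_machine M \<and> deterministic M \<and> oracle_free M \<and> decides_in_time {} M L (\<lambda>n. T n + 2)"
proof -
  let ?S = "insert [] (conts c [])"
  have "finite ?S" by (simp add: finite_conts)
  then obtain e :: "com list \<Rightarrow> nat" where e: "inj_on e ?S"
    using finite_imp_inj_to_nat_seg by blast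
  define M where "M = compile e c"
  let ?r = "oracle_step {} M"
  have fun_r: "y = z" if "?r x y" "?r x z" for x y z
    using that unfolding oracle_step_def M_def moves_def
    by (auto split: if_splits dest: delta_compile_single)
  have step: "?r \<lparr>state = Work (e k), tapes = ts\<rparr>
      \<lparr>state = Work (e (fst (run (k, ts)))), tapes = snd (run (k, ts))\<rparr>"
    if kS: "k \<in> ?S" and ne: "k \<noteq> []" for k ts
  proof -
    obtain a k' where k: "k = a # k'" using ne by (cases k) auto
    have "inv_into ?S e (e k) = a # k'" using inv_into_f_f[OF e kS] k by simp
    then have "delta M (Work (e k)) (map scanned ts) =
        {(Work (e (fst (successor k (map scanned ts)))), snd (successor k (map scanned ts)))}"
      by (simp add: M_def compile_def k)
    then show ?thesis
      by (simp add: oracle_step_def moves_def perform_def run_def Let_def split_beta)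
  qed
  have run_S: "fst (run (k, ts)) \<in> ?S" if "k \<in> ?S" for k ts
    using that conts_next[of k c "[]"] by (auto simp: run_def split_beta)
  have steps: "(?r ^^ n) \<lparr>state = Work (e [c]), tapes = ts\<rparr>
       \<lparr>state = Work (e []), tapes = ts'\<rparr>"
    if "(run ^^ n) ([c], ts) = ([], ts')" "\<And>m. m < n \<Longrightarrow> fst ((run ^^ m) ([c], ts)) \<noteq> []" for n ts ts'
  proof -
    have "m \<le> n \<Longrightarrow> fst ((run ^^ m) ([c], ts)) \<in> ?S \<and> (?r ^^ m) \<lparr>state = Work (e [c]), tapes = ts\<rparr>
       \<lparr>state = Work (e (fst ((run ^^ m) ([c], ts)))), tapes = snd ((run ^^ m) ([c], ts))\<rparr>" for m
    proof (induction m)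
      case 0
      then show ?case using conts_self[of c "[]"] by simp
    next
      case (Suc m)
      let ?k = "(run ^^ m) ([c], ts)"
      have "fst ?k \<in> ?S" using Suc by simp
      moreover have "fst ?k \<noteq> []" using that(2)[of m] Suc by simp
      ultimately have "?r \<lparr>state = Work (e (fst ?k)), tapes = snd ?k\<rparr>
         \<lparr>state = Work (e (fst (run ?k))), tapes = snd (run ?k)\<rparr>"
        using step[of "fst ?k" "snd ?k"] by simp
      then show ?case using Suc run_S[of "fst ?k" "snd ?k"] by auto
    qed
    from this[of n] show ?thesis using that(1) by simp
  qed
  have "\<exists>n b. n \<le> T (length x) + 2 \<and> (?r ^^ n) (input_config M x) b \<and>
      state b = (if x \<in> L then Accept else Reject)" for x
  proof -
    obtain s where "s \<noteq> []" and s: "exec c [map Bit x, [], [], []] s (T (length x))"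
      "tops s ! 0 = Bit True \<longleftrightarrow> x \<in> L"
      using ex by blast
    let ?ts = "tapes (input_config M x)"
    have "list_all2 holds_stack ?ts [map Bit x, [], [], []]"
      by (auto simp: input_config_def M_def compile_def holds_stack_def tape_of_def eval_nat_numeral)
    then obtain ts' m where m: "m \<le> T (length x)" "list_all2 holds_stack ts' s"
      "(run ^^ m) ([c], ?ts) = ([], ts')"
      using s(1) unfolding exec_def by blast
    \<comment> \<open>\<open>run\<close> idles on the empty control stack, whereas the machine moves
      on to its verdict there. The first time at which the control stack is empty is therefore
      needed in place of \<open>m\<close>.\<close>
    define n where "n = (LEAST n. fst ((run ^^ n) ([c], ?ts)) = [])"
    have nle: "n \<le> m" unfolding n_def by (rule Least_le) (simp add: m)
    have n0: "fst ((run ^^ n) ([c], ?ts)) = []" unfolding n_def by (rule LeastI[of _ m]) (simp add: m)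
    have nl: "fst ((run ^^ j) ([c], ?ts)) \<noteq> []" if "j < n" for j
      using not_less_Least that unfolding n_def by blast
    have id: "(run ^^ j) ([], ts) = ([], ts)" for j ts
      by (induction j) (simp_all add: run_def)
    have "(run ^^ m) ([c], ?ts) = (run ^^ (m - n)) ((run ^^ n) ([c], ?ts))"
      using nle by (metis comp_apply funpow_add le_add_diff_inverse2)
    then have n: "(run ^^ n) ([c], ?ts) = ([], ts')"
      using id n0 m(3) by (metis prod.collapse)
    have inp: "input_config M x = \<lparr>state = Start, tapes = ?ts\<rparr>"
      by (simp add: input_config_def)
    have "?r (input_config M x) \<lparr>state = Work (e [c]), tapes = ?ts\<rparr>"
      by (subst inp) (simp add: oracle_step_def moves_def perform_def M_def compile_def)
    then have r1: "(?r ^^ Suc n) (input_config M x) \<lparr>state = Work (e []), tapes = ts'\<rparr>"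
      using steps[OF n nl] by (rule relpowp_Suc_I2)
    have "scanned (ts' ! 0) = tops s ! 0"
      using \<open>s \<noteq> []\<close> scanned_stacks[OF m(2)] m(2) by (metis length_greater_0_conv list_all2_lengthD nth_map)
    moreover have "ts' \<noteq> []" using \<open>s \<noteq> []\<close> m(2) by auto
    ultimately have sc: "map scanned ts' ! 0 = Bit True \<longleftrightarrow> x \<in> L" using s(2) by simp
    have inv: "inv_into ?S e (e []) = []" using inv_into_f_f[OF e] by simp
    have "?r \<lparr>state = Work (e []), tapes = ts'\<rparr>
        \<lparr>state = if x \<in> L then Accept else Reject, tapes = ts'\<rparr>"
      using sc by (simp add: oracle_step_def moves_def perform_def M_def compile_def inv)
    then have "(?r ^^ Suc (Suc n)) (input_config M x) \<lparr>state = if x \<in> L then Accept else Reject, tapes = ts'\<rparr>"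
      using r1 by (rule relpowp_Suc_I[rotated])
    moreover have "Suc (Suc n) \<le> T (length x) + 2" using nle m(1) by simp
    ultimately show ?thesis by (metis config.select_convs(1))
  qed
  note main = this
  have "decides_in_time {} M L (\<lambda>n. T n + 2)"
    unfolding decides_in_time_def
  proof (intro allI conjI impI)
    fix x m c' assume c': "(?r ^^ m) (input_config M x) c'"
    obtain n b where b: "n \<le> T (length x) + 2" "(?r ^^ n) (input_config M x) b"
      "state b = (if x \<in> L then Accept else Reject)" using main by blast
    have "\<not> ?r b d" for d using b(3) by (simp add: oracle_step_def moves_def)
    then have "m \<le> n" using functional_relpowp_halt[of ?r, OF _ b(2) _ c'] fun_r by blast
    then show "m \<le> T (length x) + 2" using b(1) by simp
  next
    fix x
    obtain n b where b: "n \<le> T (length x) + 2" "(?r ^^ n) (input_config M x) b"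
      "state b = (if x \<in> L then Accept else Reject)" using main by blast
    have nb: "\<not> ?r b d" for d using b(3) by (simp add: oracle_step_def moves_def)
    show "x \<in> L \<longleftrightarrow> (\<exists>c. ?r\<^sup>*\<^sup>* (input_config M x) c \<and> state c = Accept)"
    proof
      assume "x \<in> L"
      then show "\<exists>c. ?r\<^sup>*\<^sup>* (input_config M x) c \<and> state c = Accept"
        using b by (metis relpowp_imp_rtranclp)
    next
      assume "\<exists>c. ?r\<^sup>*\<^sup>* (input_config M x) c \<and> state c = Accept"
      then obtain d j where d: "(?r ^^ j) (input_config M x) d" "state d = Accept"
        by (metis rtranclp_imp_relpowp)
      have nd: "\<not> ?r d y" for y using d(2) by (simp add: oracle_step_def moves_def)
      \<comment> \<open>Both runs end in halting states, so each bounds the length of the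
        other.\<close>
      have "j \<le> n" "n \<le> j"
        using functional_relpowp_halt[of ?r, OF _ b(2) nb d(1)]
          functional_relpowp_halt[of ?r, OF _ d(1) nd b(2)] fun_r by blast+
      then have "j = n" by simp
      then have "d = b" using functional_relpowp[of ?r n "input_config M x" d b] fun_r b(2) d(1) by blast
      then show "x \<in> L" using b(3) d(2) by (auto split: if_splits)
    qed
  qed
  moreover have "wf_machine M" "oracle_free M" "deterministic M"
    using wf_compile[OF wf] oracle_free_compile delta_compile_single
    by (auto simp: M_def deterministic_def)
  ultimately show ?thesis by blast
qed

section \<open>Manipulating binary trees on a stack\<close>

datatype tree = Lf | Nd tree tree

text \<open>Prefix notation is self-delimiting, so a stack can hold several trees in succession
  without separators. Only the two bits occur in codes, which leaves \<open>Sep\<close> free as a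
  marker.\<close>

fun code :: "tree \<Rightarrow> symbol list" where
  "code Lf = [Bit False]"
| "code (Nd l r) = Bit True # code l @ code r"

fun tsize :: "tree \<Rightarrow> nat" where
  "tsize Lf = 1"
| "tsize (Nd l r) = Suc (tsize l + tsize r)"

fun nodes :: "tree \<Rightarrow> nat" where
  "nodes Lf = 0"
| "nodes (Nd l r) = Suc (nodes l + nodes r)"

lemma length_code [simp]: "length (code t) = tsize t"
  by (induction t) auto

lemma tsize_pos [simp]: "0 < tsize t"
  by (cases t) auto

lemma tsize_nodes: "tsize t = 2 * nodes t + 1"
  by (induction t) auto

lemma set_code: "set (code t) \<subseteq> range Bit"
  by (induction t) auto

text \<open>Reversal does not change the number of \<open>True\<close> bits, so a tree that has been
  moved to another stack still serves as a counter for \<open>nodes t\<close> rounds of a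
  loop.\<close>

lemma count_code: "length (filter (\<lambda>s. s = Bit True) (code t)) = nodes t"
  by (induction t) auto

lemma tops_simp [simp]: "tops [a, b, u, d] = [case a of [] \<Rightarrow> Blank | x # _ \<Rightarrow> x, case b of [] \<Rightarrow> Blank | x # _ \<Rightarrow> x,
   case u of [] \<Rightarrow> Blank | x # _ \<Rightarrow> x, case d of [] \<Rightarrow> Blank | x # _ \<Rightarrow> x]"
  by (simp add: tops_def)

lemma exec_pushes:
  assumes "x \<noteq> Blank"
  shows "exec (push 0 x) [a, b, u, d] [x # a, b, u, d] 3"
    "exec (push 1 x) [a, b, u, d] [a, x # b, u, d] 3"
    "exec (push 2 x) [a, b, u, d] [a, b, x # u, d] 3"
    "exec (push 3 x) [a, b, u, d] [a, b, u, x # d] 3"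
  using exec_push[of 0 "[a, b, u, d]" x] exec_push[of 1 "[a, b, u, d]" x]
    exec_push[of 2 "[a, b, u, d]" x] exec_push[of 3 "[a, b, u, d]" x] assms
  by (simp_all add: eval_nat_numeral)

lemma exec_pops:
  "exec (pop 0) [x # a, b, u, d] [a, b, u, d] 1"
  "exec (pop 1) [a, x # b, u, d] [a, b, u, d] 1"
  "exec (pop 2) [a, b, x # u, d] [a, b, u, d] 1"
  "exec (pop 3) [a, b, u, x # d] [a, b, u, d] 1"
  using exec_pop[of 0 "[x # a, b, u, d]"] exec_pop[of 1 "[a, x # b, u, d]"]
    exec_pop[of 2 "[a, b, x # u, d]"] exec_pop[of 3 "[a, b, u, x # d]"]
  by (simp_all add: eval_nat_numeral)

lemma exec_moves:
  assumes "x \<noteq> Blank"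
  shows "exec (move 0 1) [x # a, b, u, d] [a, x # b, u, d] 5"
    "exec (move 1 0) [a, x # b, u, d] [x # a, b, u, d] 5"
    "exec (move 2 1) [a, b, x # u, d] [a, x # b, u, d] 5"
    "exec (copy 1 2) [a, x # b, u, d] [a, x # b, x # u, d] 3"
  using exec_move[of 0 "[x # a, b, u, d]" 1 x a] exec_move[of 1 "[a, x # b, u, d]" 0 x b]
    exec_move[of 2 "[a, b, x # u, d]" 1 x u] exec_copy[of 1 "[a, x # b, u, d]" 2 x b] assms
  by (simp_all add: eval_nat_numeral)

lemma wf_stay_update:
  assumes "length ss = 4" "set ss \<subseteq> stack_alphabet" "fst w \<in> stack_alphabet"
  shows "length ((stay ss)[i := w]) = 4 \<and> fst ` set ((stay ss)[i := w]) \<subseteq> stack_alphabet"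
proof -
  have "set ((stay ss)[i := w]) \<subseteq> insert w (set (stay ss))" by (rule set_update_subset_insert)
  moreover have "fst ` set (stay ss) \<subseteq> stack_alphabet" using assms by (auto simp: stay_def)
  ultimately have "fst ` set ((stay ss)[i := w]) \<subseteq> stack_alphabet" using assms(3) by auto
  then show ?thesis using assms(1) by (simp add: stay_def)
qed

lemma wf_skip [simp]: "wf_com skip"
  by (auto simp: skip_def stay_def)

lemma wf_update_act:
  assumes "\<And>ss. length ss = 4 \<Longrightarrow> set ss \<subseteq> stack_alphabet \<Longrightarrow> fst (w ss) \<in> stack_alphabet"
  shows "wf_com (Act (\<lambda>ss. (stay ss)[i := w ss]))"
  unfolding wf_com.simps
proof (intro allI impI)
  fix ss :: "symbol list" assume ss: "length ss = 4 \<and> set ss \<subseteq> stack_alphabet"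
  then have "fst (w ss) \<in> stack_alphabet" using assms by blast
  with ss show "length ((stay ss)[i := w ss]) = 4 \<and> fst ` set ((stay ss)[i := w ss]) \<subseteq> stack_alphabet"
    using wf_stay_update by blast
qed

lemma nth_in_alphabet: "i < 4 \<Longrightarrow> length ss = 4 \<Longrightarrow> set ss \<subseteq> stack_alphabet \<Longrightarrow> ss ! i \<in> stack_alphabet"
  by (metis nth_mem subsetD)

lemma wf_pop [simp]: "i < 4 \<Longrightarrow> wf_com (pop i)"
  unfolding pop_def by (rule wf_update_act) (simp add: nth_in_alphabet)

lemma wf_push [simp]: "i < 4 \<Longrightarrow> x \<in> stack_alphabet \<Longrightarrow> wf_com (push i x)"
  unfolding push_def wf_com.simps(2) by (intro conjI wf_update_act) (simp_all add: nth_in_alphabet)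

lemma wf_copy [simp]: "i < 4 \<Longrightarrow> j < 4 \<Longrightarrow> wf_com (copy i j)"
  unfolding copy_def wf_com.simps(2) by (intro conjI wf_update_act) (simp_all add: nth_in_alphabet)

lemma wf_move [simp]: "i < 4 \<Longrightarrow> j < 4 \<Longrightarrow> wf_com (move i j)"
  unfolding move_def by simp

lemma in_stack_alphabet [simp]: "Bit b \<in> stack_alphabet" "Sep \<in> stack_alphabet"
  by (cases b) (auto simp: stack_alphabet_def)

text \<open>Stack 3 counts the trees that are still to be read, in unary above a separator.\<close>

definition grab_loop :: com where
  "grab_loop = Loop (\<lambda>ss. ss ! 3 = Bit True)
     (Cond (\<lambda>ss. ss ! 0 = Bit True) (push 3 (Bit True)) (pop 3) ;; move 0 1)"

text \<open>The tree arrives reversed on stack 1, above a new separator. Trees saved in this way can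
  be nested, since each retrieval stops at the topmost separator.\<close>

definition grab :: com where
  "grab = push 1 Sep ;; push 3 Sep ;; push 3 (Bit True) ;; grab_loop ;; pop 3"

definition restore :: com where
  "restore = Loop (\<lambda>ss. ss ! 1 \<noteq> Sep) (move 1 0) ;; pop 1"

definition discard :: com where
  "discard = grab ;; Loop (\<lambda>ss. ss ! 1 \<noteq> Sep) (pop 1) ;; pop 1"

text \<open>While the tree returns to stack 0, each symbol is also put on stack 2. This second copy
  has to pass through stack 1 to come out in the right order, and the separator left there by
  \<open>grab\<close> marks its end.\<close>

definition dup :: com where
  "dup = grab ;; push 2 Sep ;; Loop (\<lambda>ss. ss ! 1 \<noteq> Sep) (copy 1 2 ;; move 1 0) ;;
     Loop (\<lambda>ss. ss ! 2 \<noteq> Sep) (move 2 1) ;; pop 2 ;; restore"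

lemma wf_programs [simp]: "wf_com grab_loop" "wf_com grab" "wf_com restore" "wf_com discard" "wf_com dup"
  by (simp_all add: grab_loop_def grab_def restore_def discard_def dup_def)

text \<open>The form "what remains after \<open>t\<close> implies the whole" lets the induction
  treat the two subtrees one after the other within a single run of the loop. Each symbol costs at
  most 12 steps.\<close>

lemma exec_grab_loop:
  "exec grab_loop [a, rev (code t) @ b, u, d] s n \<Longrightarrow>
   exec grab_loop [code t @ a, b, u, Bit True # d] s (n + 12 * tsize t)"
proof (induction t arbitrary: a b d n)
  case Lf
  let ?C = "Cond (\<lambda>ss. ss ! 0 = Bit True) (push 3 (Bit True)) (pop 3)"
  have "exec ?C [Bit False # a, b, u, Bit True # d] [Bit False # a, b, u, d] 4"
    by (rule exec_cond[where m = 3]) (auto intro: exec_mono[OF exec_pops(4)])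
  then have 1: "exec (?C ;; move 0 1) [Bit False # a, b, u, Bit True # d] [a, Bit False # b, u, d] 10"
    by (rule exec_seq[OF _ exec_moves(1)]) simp_all
  have 2: "exec grab_loop [a, Bit False # b, u, d] s n" using Lf by simp
  have "exec grab_loop [Bit False # a, b, u, Bit True # d] s (n + 12)"
    unfolding grab_loop_def by (rule exec_loop_step[OF _ 1 2[unfolded grab_loop_def]]) simp_all
  then show ?case by simp
next
  case (Nd l r)
  let ?C = "Cond (\<lambda>ss. ss ! 0 = Bit True) (push 3 (Bit True)) (pop 3)"
  have "exec ?C [Bit True # code l @ code r @ a, b, u, Bit True # d]
      [Bit True # code l @ code r @ a, b, u, Bit True # Bit True # d] 4"
    by (rule exec_cond[where m = 3]) (auto intro: exec_pushes(4))
  then have 1: "exec (?C ;; move 0 1) [Bit True # code l @ code r @ a, b, u, Bit True # d]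
      [code l @ code r @ a, Bit True # b, u, Bit True # Bit True # d] 10"
    by (rule exec_seq[OF _ exec_moves(1)]) simp_all
  have "exec grab_loop [a, rev (code r) @ rev (code l) @ Bit True # b, u, d] s n"
    using Nd.prems by simp
  from Nd.IH(1)[OF Nd.IH(2)[OF this]]
  have 2: "exec grab_loop [code l @ code r @ a, Bit True # b, u, Bit True # Bit True # d] s
      (n + 12 * tsize r + 12 * tsize l)" .
  have "exec grab_loop [Bit True # code l @ code r @ a, b, u, Bit True # d] s (n + 12 * tsize (Nd l r))"
    unfolding grab_loop_def by (rule exec_loop_step[OF _ 1 2[unfolded grab_loop_def]]) simp_all
  then show ?case by simp
qed

lemma exec_grab: "exec grab [code t @ a, b, u, d] [a, rev (code t) @ Sep # b, u, d] (12 * tsize t + 15)"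
proof -
  have "exec grab_loop [a, rev (code t) @ Sep # b, u, Sep # d] [a, rev (code t) @ Sep # b, u, Sep # d] 1"
    unfolding grab_loop_def by (rule exec_loop_stop) simp
  note l = exec_grab_loop[OF this]
  show ?thesis
    unfolding grab_def
    by (rule exec_seq[OF exec_pushes(2) exec_seq[OF exec_pushes(4) exec_seq[OF exec_pushes(4)
      exec_seq[OF l exec_pops(4) order_refl] order_refl] order_refl]]) simp_all
qed

lemma exec_restore:
  assumes "set xs \<subseteq> range Bit"
  shows "exec restore [a, xs @ Sep # b, u, d] [rev xs @ a, b, u, d] (6 * length xs + 3)"
proof -
  have "exec (Loop (\<lambda>ss. ss ! 1 \<noteq> Sep) (move 1 0)) [a, xs @ Sep # b, u, d] [rev xs @ a, Sep # b, u, d] (6 * length xs + 1)"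
    using assms
  proof (induction xs arbitrary: a)
    case Nil
    show ?case using exec_loop_stop[of "\<lambda>ss. ss ! 1 \<noteq> Sep" "[a, Sep # b, u, d]"] by simp
  next
    case (Cons x xs)
    then have "x \<noteq> Blank" "x \<noteq> Sep" by auto
    then show ?case
      using exec_loop_step[OF _ exec_moves(2) Cons.IH[of "x # a"]] Cons.prems
      by simp
  qed
  from exec_seq[OF this exec_pops(2)] show ?thesis unfolding restore_def by simp
qed

lemma set_rev_code: "set (rev (code t)) \<subseteq> range Bit"
  using set_code by simp

lemma exec_restore_code: "exec restore [a, rev (code t) @ Sep # b, u, d] [code t @ a, b, u, d] (6 * tsize t + 3)"
  using exec_restore[OF set_rev_code[of t]] by simp

lemma exec_discard: "exec discard [code t @ a, b, u, d] [a, b, u, d] (14 * tsize t + 20)"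
proof -
  have "exec (Loop (\<lambda>ss. ss ! 1 \<noteq> Sep) (pop 1)) [a, xs @ Sep # b, u, d] [a, Sep # b, u, d] (2 * length xs + 1)"
    if "set xs \<subseteq> range Bit" for xs
    using that
  proof (induction xs)
    case Nil
    show ?case using exec_loop_stop[of "\<lambda>ss. ss ! 1 \<noteq> Sep" "[a, Sep # b, u, d]"] by simp
  next
    case (Cons x xs)
    then have "x \<noteq> Blank" "x \<noteq> Sep" by auto
    then show ?case
      using exec_loop_step[OF _ exec_pops(2) Cons.IH] Cons.prems
      by simp
  qed
  note l = this[OF set_rev_code[of t], unfolded length_rev length_code]
  show ?thesis
    unfolding discard_def
    by (rule exec_seq[OF exec_grab exec_seq[OF l exec_pops(2) order_refl]]) simp
qed

lemma exec_dup: "exec dup [code t @ a, b, u, d] [code t @ code t @ a, b, u, d] (35 * tsize t + 40)"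
proof -
  have 1: "exec (Loop (\<lambda>ss. ss ! 1 \<noteq> Sep) (copy 1 2 ;; move 1 0)) [a, xs @ Sep # b, u, d]
      [rev xs @ a, Sep # b, rev xs @ u, d] (10 * length xs + 1)"
    if "set xs \<subseteq> range Bit" for xs a u
    using that
  proof (induction xs arbitrary: a u)
    case Nil
    show ?case using exec_loop_stop[of "\<lambda>ss. ss ! 1 \<noteq> Sep" "[a, Sep # b, u, d]"] by simp
  next
    case (Cons x xs)
    then have "x \<noteq> Blank" "x \<noteq> Sep" by auto
    then show ?case
      using exec_loop_step[OF _ exec_seq[OF exec_moves(4) exec_moves(2) order_refl]
          Cons.IH[of "x # a" "x # u"]] Cons.prems
      by simp
  qed
  have 2: "exec (Loop (\<lambda>ss. ss ! 2 \<noteq> Sep) (move 2 1)) [a, b, xs @ Sep # u, d]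
      [a, rev xs @ b, Sep # u, d] (6 * length xs + 1)"
    if "set xs \<subseteq> range Bit" for xs a b
    using that
  proof (induction xs arbitrary: b)
    case Nil
    show ?case using exec_loop_stop[of "\<lambda>ss. ss ! 2 \<noteq> Sep" "[a, b, Sep # u, d]"] by simp
  next
    case (Cons x xs)
    then have "x \<noteq> Blank" "x \<noteq> Sep" by auto
    then show ?case
      using exec_loop_step[OF _ exec_moves(3) Cons.IH[of "x # b"]] Cons.prems
      by simp
  qed
  show ?thesis
    unfolding dup_def
    by (rule exec_seq[OF exec_grab exec_seq[OF exec_pushes(3) exec_seq[OF
      1[OF set_rev_code[of t], of a "Sep # u", unfolded rev_rev_ident length_rev length_code]
      exec_seq[OF 2[OF set_code[of t], of "code t @ a" "Sep # b", unfolded length_code] exec_seq[OF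
      exec_pops(3) exec_restore_code[of "code t @ a" t b u d] order_refl] order_refl] order_refl] order_refl]]) simp_all
qed

section \<open>Combinators for programs on trees\<close>

definition tfst :: "tree \<Rightarrow> tree" where
  "tfst t = (case t of Lf \<Rightarrow> Lf | Nd l r \<Rightarrow> l)"

definition tsnd :: "tree \<Rightarrow> tree" where
  "tsnd t = (case t of Lf \<Rightarrow> Lf | Nd l r \<Rightarrow> r)"

definition fst_com :: com where
  "fst_com = Cond (\<lambda>ss. ss ! 0 = Bit True) (pop 0 ;; grab ;; discard ;; restore) skip"

definition snd_com :: com where
  "snd_com = Cond (\<lambda>ss. ss ! 0 = Bit True) (pop 0 ;; discard) skip"

definition pair_com :: "com \<Rightarrow> com \<Rightarrow> com" where
  "pair_com f g = dup ;; f ;; grab ;; g ;; restore ;; push 0 (Bit True)"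

definition if_com :: "com \<Rightarrow> com \<Rightarrow> com \<Rightarrow> com" where
  "if_com b f g = dup ;; b ;; Cond (\<lambda>ss. ss ! 0 = Bit True) (discard ;; f) (discard ;; g)"

definition const_com :: "tree \<Rightarrow> com" where
  "const_com t = discard ;; foldr (\<lambda>x c. c ;; push 0 x) (code t) skip"

text \<open>Removing the leading bit of a pair exposes its two components. The first is parked on
  stack 1 and consumed bit by bit: a \<open>True\<close> triggers one round of \<open>f\<close>, a
  \<open>False\<close> is merely dropped, so the number of rounds is its number of inner
  nodes.\<close>

definition iterate_com :: "com \<Rightarrow> com" where
  "iterate_com f = pop 0 ;; grab ;;
     Loop (\<lambda>ss. ss ! 1 \<noteq> Sep) (Cond (\<lambda>ss. ss ! 1 = Bit True) (pop 1 ;; f) (pop 1)) ;; pop 1"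

lemma wf_combinators [simp]:
  "wf_com fst_com" "wf_com snd_com"
  "wf_com f \<Longrightarrow> wf_com g \<Longrightarrow> wf_com (pair_com f g)"
  "wf_com b \<Longrightarrow> wf_com f \<Longrightarrow> wf_com g \<Longrightarrow> wf_com (if_com b f g)"
  "wf_com f \<Longrightarrow> wf_com (iterate_com f)"
  by (simp_all add: fst_com_def snd_com_def pair_com_def if_com_def iterate_com_def)

lemma wf_const_com [simp]: "wf_com (const_com t)"
proof -
  have "wf_com (foldr (\<lambda>x c. c ;; push 0 x) xs skip)" if "set xs \<subseteq> range Bit" for xs
    using that by (induction xs) auto
  then show ?thesis using set_code by (simp add: const_com_def)
qed

lemma exec_fst_com: "exec fst_com [code t @ a, b, u, d] [code (tfst t) @ a, b, u, d] (32 * tsize t + 45)"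
proof (cases t)
  case Lf
  then show ?thesis unfolding fst_com_def
    by (intro exec_cond[where m = 1]) (auto simp: tfst_def exec_skip[simplified])
next
  case (Nd l r)
  have "exec (pop 0 ;; grab ;; discard ;; restore) [Bit True # code l @ code r @ a, b, u, d]
     [code l @ a, b, u, d] (18 * tsize l + 14 * tsize r + 44)"
    by (rule exec_seq[OF exec_pops(1) exec_seq[OF exec_grab exec_seq[OF exec_discard exec_restore_code
      order_refl] order_refl]]) simp
  then show ?thesis unfolding fst_com_def using Nd
    by (intro exec_cond[where m = "18 * tsize l + 14 * tsize r + 44"]) (auto simp: tfst_def)
qed

lemma exec_snd_com: "exec snd_com [code t @ a, b, u, d] [code (tsnd t) @ a, b, u, d] (32 * tsize t + 45)"
proof (cases t)
  case Lf
  then show ?thesis unfolding snd_com_def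
    by (intro exec_cond[where m = 1]) (auto simp: tsnd_def exec_skip[simplified])
next
  case (Nd l r)
  have "exec (pop 0 ;; discard) [Bit True # code l @ code r @ a, b, u, d]
     [code r @ a, b, u, d] (14 * tsize l + 44)"
    by (rule exec_seq[OF exec_pops(1) exec_discard]) simp
  then show ?thesis unfolding snd_com_def using Nd
    by (intro exec_cond[where m = "14 * tsize l + 44"]) (auto simp: tsnd_def)
qed

text \<open>The premises must hold above arbitrary stack contents: \<open>f\<close> runs above the
  second copy of the argument, and \<open>g\<close> runs while the value of \<open>f\<close> is
  parked on stack 1.\<close>

lemma exec_pair_com:
  assumes "\<And>a b u d. exec f [code x @ a, b, u, d] [code y @ a, b, u, d] m"
    "\<And>a b u d. exec g [code x @ a, b, u, d] [code z @ a, b, u, d] n"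
  shows "exec (pair_com f g) [code x @ a, b, u, d] [code (Nd y z) @ a, b, u, d]
    (m + n + 35 * tsize x + 18 * tsize y + 100)"
  unfolding pair_com_def
  using exec_seq[OF exec_dup[of x a b u d] exec_seq[OF assms(1) exec_seq[OF exec_grab exec_seq[OF assms(2)
    exec_seq[OF exec_restore_code exec_pushes(1) order_refl] order_refl] order_refl] order_refl]]
  by simp

lemma exec_const_com:
  "exec (const_com t) [code x @ a, b, u, d] [code t @ a, b, u, d] (14 * tsize x + 4 * tsize t + 30)"
proof -
  have "exec (foldr (\<lambda>x c. c ;; push 0 x) xs skip) [a, b, u, d] [xs @ a, b, u, d] (4 * length xs + 1)"
    if "set xs \<subseteq> range Bit" for xs
    using that
  proof (induction xs)
    case Nil
    show ?case by (simp add: exec_skip[simplified])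
  next
    case (Cons x xs)
    then show ?case by (auto intro!: exec_seq[OF _ exec_pushes(1)])
  qed
  from exec_seq[OF exec_discard this[OF set_code]] show ?thesis
    unfolding const_com_def by simp
qed

lemma exec_if_com:
  assumes "\<And>a b u d. exec c [code x @ a, b, u, d] [code y @ a, b, u, d] l"
    "\<And>a b u d. y \<noteq> Lf \<Longrightarrow> exec f [code x @ a, b, u, d] [code z @ a, b, u, d] m"
    "\<And>a b u d. y = Lf \<Longrightarrow> exec g [code x @ a, b, u, d] [code z @ a, b, u, d] m"
  shows "exec (if_com c f g) [code x @ a, b, u, d] [code z @ a, b, u, d]
    (l + m + 35 * tsize x + 14 * tsize y + 80)"
proof -
  have "exec (Cond (\<lambda>ss. ss ! 0 = Bit True) (discard ;; f) (discard ;; g))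
     [code y @ code x @ a, b, u, d] [code z @ a, b, u, d] (m + 14 * tsize y + 22)"
  proof (rule exec_cond)
    assume "tops [code y @ code x @ a, b, u, d] ! 0 = Bit True"
    then have "y \<noteq> Lf" by auto
    then show "exec (discard ;; f) [code y @ code x @ a, b, u, d] [code z @ a, b, u, d] (m + 14 * tsize y + 21)"
      by (intro exec_seq[OF exec_discard assms(2)]) simp_all
  next
    assume "tops [code y @ code x @ a, b, u, d] ! 0 \<noteq> Bit True"
    then have "y = Lf" by (cases y) auto
    then show "exec (discard ;; g) [code y @ code x @ a, b, u, d] [code z @ a, b, u, d] (m + 14 * tsize y + 21)"
      by (intro exec_seq[OF exec_discard assms(3)]) simp_all
  qed simp
  from exec_seq[OF exec_dup[of x] exec_seq[OF assms(1) this order_refl]]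
  show ?thesis unfolding if_com_def by simp
qed

lemma exec_iterate_com:
  assumes "\<And>i a b u d. i < nodes n \<Longrightarrow> exec f [code (h i) @ a, b, u, d] [code (h (Suc i)) @ a, b, u, d] m"
  shows "exec (iterate_com f) [code (Nd n (h 0)) @ a, b, u, d] [code (h (nodes n)) @ a, b, u, d]
    (tsize n * (m + 16) + 30)"
proof -
  let ?cnt = "\<lambda>xs. length (filter (\<lambda>s. s = Bit True) xs)"
  let ?P = "\<lambda>ss. ss ! 1 \<noteq> Sep" and ?C = "Cond (\<lambda>ss. ss ! 1 = Bit True) (pop 1 ;; f) (pop 1)"
  \<comment> \<open>The invariant: the \<open>i\<close> rounds done and the \<open>True\<close> bits
    left on stack 1 together make up \<open>nodes n\<close>.\<close>
  have *: "exec (Loop ?P ?C) [code (h i) @ a, xs @ Sep # b, u, d]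
      [code (h (nodes n)) @ a, Sep # b, u, d] (length xs * (m + 4) + 1)"
    if "set xs \<subseteq> range Bit" "i + ?cnt xs = nodes n" for xs i
    using that
  proof (induction xs arbitrary: i)
    case Nil
    then show ?case using exec_loop_stop[of ?P "[code (h i) @ a, Sep # b, u, d]"] by simp
  next
    case (Cons x xs)
    let ?i = "if x = Bit True then Suc i else i"
    have b: "exec ?C [code (h i) @ a, (x # xs) @ Sep # b, u, d] [code (h ?i) @ a, xs @ Sep # b, u, d] (m + 3)"
    proof (rule exec_cond)
      assume "tops [code (h i) @ a, (x # xs) @ Sep # b, u, d] ! 1 = Bit True"
      then have x: "x = Bit True" by simp
      then have "i < nodes n" using Cons.prems by simp
      then show "exec (pop 1 ;; f) [code (h i) @ a, (x # xs) @ Sep # b, u, d]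
          [code (h ?i) @ a, xs @ Sep # b, u, d] (m + 2)"
        using exec_seq[OF exec_pops(2) assms] x by simp
    next
      assume "tops [code (h i) @ a, (x # xs) @ Sep # b, u, d] ! 1 \<noteq> Bit True"
      then show "exec (pop 1) [code (h i) @ a, (x # xs) @ Sep # b, u, d]
          [code (h ?i) @ a, xs @ Sep # b, u, d] (m + 2)"
        using exec_mono[OF exec_pops(2)] by simp
    qed simp
    have "x \<noteq> Sep" using Cons.prems by auto
    then show ?case
      by (intro exec_loop_step[OF _ b Cons.IH]) (use Cons.prems in \<open>auto split: if_splits\<close>)
  qed
  have "i + ?cnt (rev (code n)) = nodes n" if "i = 0" for i
    using that count_code[of n] by (simp add: rev_filter[symmetric])
  note l = *[OF set_rev_code this[OF refl], unfolded length_rev length_code]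
  have "exec (pop 0 ;; grab ;; Loop ?P ?C ;; pop 1) [Bit True # code n @ code (h 0) @ a, b, u, d]
     [code (h (nodes n)) @ a, b, u, d] (tsize n * (m + 16) + 30)"
    by (rule exec_seq[OF exec_pops(1) exec_seq[OF exec_grab exec_seq[OF l exec_pops(2) order_refl] order_refl]])
       (simp add: algebra_simps)
  then show ?thesis unfolding iterate_com_def by simp
qed

section \<open>Polynomial-time functions\<close>

text \<open>The base \<open>n + 2\<close> is at least 2 for every \<open>n\<close>, so a single
  exponent absorbs constants and sums as well as products.\<close>

definition poly_bounded :: "(nat \<Rightarrow> nat) \<Rightarrow> bool" where
  "poly_bounded p \<longleftrightarrow> (\<exists>k. \<forall>n. p n \<le> (n + 2) ^ k)"

named_theorems poly_bounded_intros

lemma power_two_le: "(2::nat) ^ k \<le> (n + 2) ^ k"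
  by (simp add: power_mono)

lemma poly_bounded_const [poly_bounded_intros]: "poly_bounded (\<lambda>n. c)"
proof -
  have "c \<le> (n + 2) ^ c" for n :: nat
    using power_two_le[of c n] less_exp[of c] by linarith
  then show ?thesis unfolding poly_bounded_def by blast
qed

lemma poly_bounded_id [poly_bounded_intros]: "poly_bounded (\<lambda>n. n)"
  unfolding poly_bounded_def by (rule exI[of _ 1]) simp

lemma poly_bounded_mult [poly_bounded_intros]:
  assumes "poly_bounded p" "poly_bounded q"
  shows "poly_bounded (\<lambda>n. p n * q n)"
proof -
  obtain k l where "\<And>n. p n \<le> (n + 2) ^ k" "\<And>n. q n \<le> (n + 2) ^ l"
    using assms unfolding poly_bounded_def by blast
  then have "p n * q n \<le> (n + 2) ^ (k + l)" for n
    by (simp add: mult_mono power_add)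
  then show ?thesis unfolding poly_bounded_def by blast
qed

lemma poly_bounded_add [poly_bounded_intros]:
  assumes "poly_bounded p" "poly_bounded q"
  shows "poly_bounded (\<lambda>n. p n + q n)"
proof -
  obtain k l where *: "\<And>n. p n \<le> (n + 2) ^ k" "\<And>n. q n \<le> (n + 2) ^ l"
    using assms unfolding poly_bounded_def by blast
  have "p n + q n \<le> (n + 2) ^ (k + l + 1)" for n
  proof -
    have "p n \<le> (n + 2) ^ (k + l)" "q n \<le> (n + 2) ^ (k + l)"
      using *(1)[of n] *(2)[of n]
        power_increasing[of k "k + l" "n + 2"] power_increasing[of l "k + l" "n + 2"] by linarith+
    then have "p n + q n \<le> 2 * (n + 2) ^ (k + l)" by simp
    also have "\<dots> \<le> (n + 2) * (n + 2) ^ (k + l)" by (rule mult_right_mono) simp_all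
    finally show ?thesis by simp
  qed
  then show ?thesis unfolding poly_bounded_def by blast
qed

lemma poly_bounded_Suc [poly_bounded_intros]: "poly_bounded p \<Longrightarrow> poly_bounded (\<lambda>n. Suc (p n))"
  using poly_bounded_add[of p "\<lambda>_. 1"] poly_bounded_const by simp

lemma poly_bounded_power [poly_bounded_intros]: "poly_bounded p \<Longrightarrow> poly_bounded (\<lambda>n. p n ^ k)"
  by (induction k) (auto intro!: poly_bounded_intros)

lemma poly_boundedE:
  assumes "poly_bounded p"
  obtains k where "\<And>n. p n \<le> (n + 2) ^ k" "\<And>m n. m \<le> n \<Longrightarrow> p m \<le> (n + 2) ^ k"
proof -
  obtain k where k: "\<And>n. p n \<le> (n + 2) ^ k" using assms unfolding poly_bounded_def by blast
  moreover have "p m \<le> (n + 2) ^ k" if "m \<le> n" for m n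
    using k[of m] power_mono[of "m + 2" "n + 2" k] that by simp
  ultimately show ?thesis using that by blast
qed

class enc =
  fixes enc :: "'a \<Rightarrow> tree"
  assumes enc_inject: "enc x = enc y \<Longrightarrow> x = y"
begin

definition sz :: "'a \<Rightarrow> nat" where
  "sz x = tsize (enc x)"

lemma sz_pos [simp]: "0 < sz x"
  by (simp add: sz_def)

end

text \<open>The domain \<open>D\<close> is needed for branches whose function makes sense on part of
  the type only, such as the head of a nonempty list. One exponent bounds both the time and the size
  of the value, so that composition can feed the size of one stage into the time of the
  next.\<close>

definition polytime_on :: "'a::enc set \<Rightarrow> ('a \<Rightarrow> 'b::enc) \<Rightarrow> bool" where
  "polytime_on D f \<longleftrightarrow> (\<exists>c k. wf_com c \<and> (\<forall>x\<in>D. sz (f x) \<le> (sz x + 2) ^ k \<and>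
     (\<forall>a b u d. exec c [code (enc x) @ a, b, u, d] [code (enc (f x)) @ a, b, u, d] ((sz x + 2) ^ k))))"

abbreviation polytime :: "('a::enc \<Rightarrow> 'b::enc) \<Rightarrow> bool" where
  "polytime \<equiv> polytime_on UNIV"

named_theorems polytime_intros

lemma polytime_onI:
  assumes "wf_com c" "poly_bounded p" "poly_bounded q"
    and "\<And>x a b u d. x \<in> D \<Longrightarrow> exec c [code (enc x) @ a, b, u, d] [code (enc (f x)) @ a, b, u, d] (p (sz x))"
    and "\<And>x. x \<in> D \<Longrightarrow> sz (f x) \<le> q (sz x)"
  shows "polytime_on D f"
proof -
  obtain k where k: "\<And>n. p n + q n \<le> (n + 2) ^ k"
    using poly_bounded_add[OF assms(2,3)] unfolding poly_bounded_def by blast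
  have "sz (f x) \<le> (sz x + 2) ^ k \<and>
     (\<forall>a b u d. exec c [code (enc x) @ a, b, u, d] [code (enc (f x)) @ a, b, u, d] ((sz x + 2) ^ k))"
    if "x \<in> D" for x
    using exec_mono[OF assms(4)[OF that]] assms(5)[OF that] k[of "sz x"] by (meson add_leE le_trans)
  then show ?thesis unfolding polytime_on_def using assms(1) by blast
qed

lemma polytime_onE:
  assumes "polytime_on D f"
  obtains c k where "wf_com c" "\<And>x. x \<in> D \<Longrightarrow> sz (f x) \<le> (sz x + 2) ^ k"
    "\<And>x a b u d. x \<in> D \<Longrightarrow>
       exec c [code (enc x) @ a, b, u, d] [code (enc (f x)) @ a, b, u, d] ((sz x + 2) ^ k)"
  using assms unfolding polytime_on_def by blast

lemma polytime_on_subset: "polytime_on E f \<Longrightarrow> D \<subseteq> E \<Longrightarrow> polytime_on D f"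
  unfolding polytime_on_def by blast

lemma polytime_on_sz:
  assumes "polytime_on D f"
  obtains k where "\<And>x n. x \<in> D \<Longrightarrow> sz x \<le> n \<Longrightarrow> sz (f x) \<le> (n + 2) ^ k"
proof -
  obtain c k where "\<And>x. x \<in> D \<Longrightarrow> sz (f x) \<le> (sz x + 2) ^ k" using assms by (rule polytime_onE) blast
  then have "sz (f x) \<le> (n + 2) ^ k" if "x \<in> D" "sz x \<le> n" for x n
    using power_mono[of "sz x + 2" "n + 2" k] that by (meson add_le_mono1 le0 le_trans)
  then show ?thesis using that by blast
qed

text \<open>Programs see only encodings. Functions into different types share a program if their
  values are encoded by the same trees, which transfers constructors and selectors from pairs to
  lists, numbers and trees.\<close>

lemma polytime_on_recode:
  assumes "polytime_on D f" "\<And>x. x \<in> D \<Longrightarrow> enc (g x) = enc (f x)"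
  shows "polytime_on D g"
  using assms(1) unfolding polytime_on_def by (auto simp: sz_def assms(2))

lemma polytime_on_cong: "polytime_on D f \<Longrightarrow> (\<And>x. x \<in> D \<Longrightarrow> g x = f x) \<Longrightarrow> polytime_on D g"
  by (rule polytime_on_recode) auto

lemma polytime_id [polytime_intros]: "polytime_on D (\<lambda>x. x)"
  by (rule polytime_onI[of skip "\<lambda>_. 1" "\<lambda>n. n"]) (auto intro: exec_skip[simplified] poly_bounded_intros)

lemma polytime_const [polytime_intros]: "polytime_on D (\<lambda>x. c)"
  by (rule polytime_onI[of "const_com (enc c)" "\<lambda>n. 14 * n + (4 * sz c + 30)" "\<lambda>n. sz c"])
     (auto intro!: poly_bounded_intros exec_mono[OF exec_const_com] simp: sz_def)

lemma polytime_on_comp: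
  assumes "polytime_on E f" "polytime_on D g" "\<And>x. x \<in> D \<Longrightarrow> g x \<in> E"
  shows "polytime_on D (\<lambda>x. f (g x))"
proof -
  obtain c k where c: "wf_com c" "\<And>x. x \<in> E \<Longrightarrow> sz (f x) \<le> (sz x + 2) ^ k"
    "\<And>x a b u d. x \<in> E \<Longrightarrow>
       exec c [code (enc x) @ a, b, u, d] [code (enc (f x)) @ a, b, u, d] ((sz x + 2) ^ k)"
    using assms(1) by (rule polytime_onE) blast
  obtain c' k' where c': "wf_com c'" "\<And>x. x \<in> D \<Longrightarrow> sz (g x) \<le> (sz x + 2) ^ k'"
    "\<And>x a b u d. x \<in> D \<Longrightarrow>
       exec c' [code (enc x) @ a, b, u, d] [code (enc (g x)) @ a, b, u, d] ((sz x + 2) ^ k')"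
    using assms(2) by (rule polytime_onE) blast
  have *: "(sz (g x) + 2) ^ k \<le> ((sz x + 2) ^ k' + 2) ^ k" if "x \<in> D" for x
    using c'(2)[OF that] by (simp add: power_mono)
  show ?thesis
  proof (rule polytime_onI)
    show "wf_com (c' ;; c)" using c c' by simp
    show "poly_bounded (\<lambda>n. (n + 2) ^ k' + ((n + 2) ^ k' + 2) ^ k + 1)"
      by (intro poly_bounded_intros)
    show "poly_bounded (\<lambda>n. ((n + 2) ^ k' + 2) ^ k)"
      by (intro poly_bounded_intros)
    fix x a b u d assume x: "x \<in> D"
    show "exec (c' ;; c) [code (enc x) @ a, b, u, d] [code (enc (f (g x))) @ a, b, u, d]
        ((sz x + 2) ^ k' + ((sz x + 2) ^ k' + 2) ^ k + 1)"
      by (rule exec_seq[OF c'(3)[OF x] c(3)[OF assms(3)[OF x]]]) (use *[OF x] in simp)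
  next
    fix x assume "x \<in> D"
    then show "sz (f (g x)) \<le> ((sz x + 2) ^ k' + 2) ^ k"
      using c(2)[OF assms(3)] * le_trans by blast
  qed
qed

lemma polytime_comp: "polytime f \<Longrightarrow> polytime_on D g \<Longrightarrow> polytime_on D (\<lambda>x. f (g x))"
  by (rule polytime_on_comp) auto

lemma polytime_on_if_Lf:
  assumes "polytime_on D t" "polytime_on {x \<in> D. enc (t x) \<noteq> Lf} f" "polytime_on {x \<in> D. enc (t x) = Lf} g"
  shows "polytime_on D (\<lambda>x. if enc (t x) \<noteq> Lf then f x else g x)"
proof -
  obtain c k where c: "wf_com c" "\<And>x. x \<in> D \<Longrightarrow> sz (t x) \<le> (sz x + 2) ^ k"
    "\<And>x a b u d. x \<in> D \<Longrightarrow>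
       exec c [code (enc x) @ a, b, u, d] [code (enc (t x)) @ a, b, u, d] ((sz x + 2) ^ k)"
    using assms(1) by (rule polytime_onE) blast
  obtain cf kf where f: "wf_com cf" "\<And>x. x \<in> D \<Longrightarrow> enc (t x) \<noteq> Lf \<Longrightarrow> sz (f x) \<le> (sz x + 2) ^ kf"
    "\<And>x a b u d. x \<in> D \<Longrightarrow> enc (t x) \<noteq> Lf \<Longrightarrow>
       exec cf [code (enc x) @ a, b, u, d] [code (enc (f x)) @ a, b, u, d] ((sz x + 2) ^ kf)"
    using assms(2) by (rule polytime_onE) blast
  obtain cg kg where g: "wf_com cg" "\<And>x. x \<in> D \<Longrightarrow> enc (t x) = Lf \<Longrightarrow> sz (g x) \<le> (sz x + 2) ^ kg"
    "\<And>x a b u d. x \<in> D \<Longrightarrow> enc (t x) = Lf \<Longrightarrow>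
       exec cg [code (enc x) @ a, b, u, d] [code (enc (g x)) @ a, b, u, d] ((sz x + 2) ^ kg)"
    using assms(3) by (rule polytime_onE) blast
  show ?thesis
  proof (rule polytime_onI)
    show "wf_com (if_com c cf cg)" using c f g by simp
    show "poly_bounded (\<lambda>n. (n + 2) ^ k + ((n + 2) ^ kf + (n + 2) ^ kg) + 35 * n + 14 * (n + 2) ^ k + 80)"
      by (intro poly_bounded_intros)
    show "poly_bounded (\<lambda>n. (n + 2) ^ kf + (n + 2) ^ kg)"
      by (intro poly_bounded_intros)
    fix x a b u d assume x: "x \<in> D"
    let ?m = "(sz x + 2) ^ kf + (sz x + 2) ^ kg" and ?v = "if enc (t x) \<noteq> Lf then f x else g x"
    have "exec cf [code (enc x) @ a, b, u, d] [code (enc ?v) @ a, b, u, d] ?m" if "enc (t x) \<noteq> Lf" for a b u d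
      using exec_mono[OF f(3)[OF x that], of ?m] that by simp
    moreover have "exec cg [code (enc x) @ a, b, u, d] [code (enc ?v) @ a, b, u, d] ?m" if "enc (t x) = Lf" for a b u d
      using exec_mono[OF g(3)[OF x that], of ?m] that by simp
    ultimately have "exec (if_com c cf cg) [code (enc x) @ a, b, u, d] [code (enc ?v) @ a, b, u, d]
        ((sz x + 2) ^ k + ?m + 35 * tsize (enc x) + 14 * tsize (enc (t x)) + 80)"
      using c(3)[OF x] by (rule exec_if_com[rotated])
    then show "exec (if_com c cf cg) [code (enc x) @ a, b, u, d] [code (enc ?v) @ a, b, u, d]
        ((sz x + 2) ^ k + ?m + 35 * sz x + 14 * (sz x + 2) ^ k + 80)"
      by (rule exec_mono) (use c(2)[OF x] in \<open>simp add: sz_def\<close>)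
  next
    fix x assume "x \<in> D"
    then show "sz (if enc (t x) \<noteq> Lf then f x else g x) \<le> (sz x + 2) ^ kf + (sz x + 2) ^ kg"
      using f(2)[of x] g(2)[of x] by auto
  qed
qed

subsection \<open>Encodings\<close>

instantiation tree :: enc
begin
definition "enc_tree (t::tree) = t"
instance by standard (simp add: enc_tree_def)
end

instantiation prod :: (enc, enc) enc
begin
definition "enc_prod p = Nd (enc (fst p)) (enc (snd p))"
instance by standard (auto simp: enc_prod_def prod_eq_iff dest: enc_inject)
end

instantiation bool :: enc
begin
definition "enc_bool b = (if b then Nd Lf Lf else Lf)"
instance by standard (auto simp: enc_bool_def split: if_splits)
end

instantiation list :: (enc) enc
begin
primrec enc_list where
  "enc_list [] = Lf"
| "enc_list (x # xs) = Nd (enc x) (enc_list xs)"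
instance
proof
  fix xs ys :: "'a list"
  show "enc xs = enc ys \<Longrightarrow> xs = ys"
    by (induction xs arbitrary: ys) (case_tac ys; auto dest: enc_inject)+
qed
end

text \<open>Numbers are encoded in unary. Polynomial time in a number thus means polynomial in its
  value, which is what lets a number act as padding, and \<open>nodes\<close> of its code is the
  number itself.\<close>

instantiation nat :: enc
begin
primrec enc_nat where
  "enc_nat 0 = Lf"
| "enc_nat (Suc n) = Nd Lf (enc_nat n)"
instance
proof
  fix m n :: nat
  show "enc m = enc n \<Longrightarrow> m = n"
    by (induction m arbitrary: n) (case_tac n; auto)+
qed
end

text \<open>Negative numbers are shifted by one, so that zero has a single code and incrementing or
  decrementing is a case distinction on the unary part.\<close>

instantiation int :: enc
begin
definition "enc_int i = enc (0 \<le> i, nat (if 0 \<le> i then i else - i - 1))"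
instance by standard (auto simp: enc_int_def dest!: enc_inject split: if_splits)
end

instantiation symbol :: enc
begin
definition "enc_symbol s = enc (case s of Blank \<Rightarrow> (0, 0) | Bit b \<Rightarrow> (1, of_bool b) | Sep \<Rightarrow> (2, 0)
   | Sym n \<Rightarrow> (3::nat, n::nat))"
instance by standard (auto simp: enc_symbol_def of_bool_def dest!: enc_inject split: symbol.splits if_splits)
end

instantiation state :: enc
begin
definition "enc_state q = enc (case q of Start \<Rightarrow> (0, 0) | Accept \<Rightarrow> (1, 0) | Reject \<Rightarrow> (2, 0) | Query \<Rightarrow> (3, 0)
   | Yes \<Rightarrow> (4, 0) | No \<Rightarrow> (5, 0) | Work n \<Rightarrow> (6::nat, n::nat))"
instance by standard (auto simp: enc_state_def dest!: enc_inject split: state.splits)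
end

instantiation direction :: enc
begin
definition "enc_direction d = enc (case d of Lft \<Rightarrow> 0 | Stay \<Rightarrow> 1 | Rgt \<Rightarrow> (2::nat))"
instance by standard (unfold enc_direction_def, drule enc_inject, auto split: direction.splits)
end

lemma sz_prod [simp]: "sz (a, b) = Suc (sz a + sz b)"
  by (simp add: sz_def enc_prod_def)

lemma sz_fst_snd: "sz p = Suc (sz (fst p) + sz (snd p))"
  by (simp add: sz_def enc_prod_def)

lemma sz_Nil [simp]: "sz [] = 1"
  by (simp add: sz_def)

lemma sz_Cons [simp]: "sz (x # xs) = Suc (sz x + sz xs)"
  by (simp add: sz_def)

lemma sz_bool: "sz (b::bool) \<le> 3"
  by (simp add: sz_def enc_bool_def)

lemma sz_append: "Suc (sz (xs @ ys)) = sz xs + sz ys"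
  by (induction xs) auto

lemma sz_append_le: "sz (xs @ ys) \<le> sz xs + sz ys"
  using sz_append[of xs ys] by linarith

lemma sz_rev [simp]: "sz (rev xs) = sz xs"
proof (induction xs)
  case (Cons x xs)
  then show ?case using sz_append[of "rev xs" "[x]"] by simp
qed simp

lemma sz_in_list: "x \<in> set xs \<Longrightarrow> sz x < sz xs"
  by (induction xs) auto

lemma length_less_sz: "length xs < sz xs"
  by (induction xs) auto

lemma length_le_nodes: "length xs \<le> nodes (enc xs)"
  by (induction xs) auto

lemma sz_list_le: "(\<And>x. x \<in> set xs \<Longrightarrow> sz x \<le> m) \<Longrightarrow> sz xs \<le> 1 + length xs * Suc m"
proof (induction xs)
  case (Cons x xs)
  have "sz x \<le> m" "sz xs \<le> 1 + length xs * Suc m" using Cons by auto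
  then show ?case by simp
qed simp

lemma sz_drop: "sz (drop i xs) \<le> sz xs"
  using sz_append[of "take i xs" "drop i xs"] sz_pos[of "take i xs"] unfolding append_take_drop_id by linarith

lemma sz_nat [simp]: "sz (n::nat) = 2 * n + 1"
  by (induction n) (auto simp: sz_def)

lemma nodes_nat [simp]: "nodes (enc (n::nat)) = n"
  by (induction n) auto

lemma sz_int: "sz (i::int) \<le> 5 + 2 * nat \<bar>i\<bar>"
proof -
  have "sz i = sz (0 \<le> i, nat (if 0 \<le> i then i else - i - 1))"
    by (simp only: sz_def enc_int_def)
  then show ?thesis using sz_bool[of "0 \<le> i"] by auto
qed

subsection \<open>Closure properties\<close>

lemma tsize_tfst: "tsize (tfst t) \<le> tsize t"
  by (cases t) (auto simp: tfst_def)

lemma tsize_tsnd: "tsize (tsnd t) \<le> tsize t"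
  by (cases t) (auto simp: tsnd_def)

lemma polytime_fst [polytime_intros]:
  assumes "polytime_on D f"
  shows "polytime_on D (\<lambda>x. fst (f x))"
proof -
  have "polytime tfst"
    by (rule polytime_onI[of fst_com "\<lambda>n. 32 * n + 45" "\<lambda>n. n"])
       (auto intro!: poly_bounded_intros exec_fst_com simp: sz_def enc_tree_def tsize_tfst)
  moreover have "polytime_on D (\<lambda>x. enc (f x))"
    by (rule polytime_on_recode[OF assms]) (simp add: enc_tree_def)
  ultimately have "polytime_on D (\<lambda>x. tfst (enc (f x)))" by (rule polytime_comp)
  then show ?thesis by (rule polytime_on_recode) (simp add: enc_prod_def enc_tree_def tfst_def)
qed

text \<open>Pairs, nonempty lists and successors are all encoded as nodes, so this one program
  yields \<open>snd\<close>, \<open>tl\<close> and the predecessor.\<close>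

lemma polytime_tsnd:
  assumes "polytime_on D f"
  shows "polytime_on D (\<lambda>x. tsnd (enc (f x)))"
proof -
  have "polytime tsnd"
    by (rule polytime_onI[of snd_com "\<lambda>n. 32 * n + 45" "\<lambda>n. n"])
       (auto intro!: poly_bounded_intros exec_snd_com simp: sz_def enc_tree_def tsize_tsnd)
  moreover have "polytime_on D (\<lambda>x. enc (f x))"
    by (rule polytime_on_recode[OF assms]) (simp add: enc_tree_def)
  ultimately show ?thesis by (rule polytime_comp)
qed

lemma polytime_snd [polytime_intros]: "polytime_on D f \<Longrightarrow> polytime_on D (\<lambda>x. snd (f x))"
  by (rule polytime_on_recode[OF polytime_tsnd]) (auto simp: enc_prod_def enc_tree_def tsnd_def)

lemma polytime_tl [polytime_intros]: "polytime_on D f \<Longrightarrow> polytime_on D (\<lambda>x. tl (f x))"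
  by (rule polytime_on_recode[OF polytime_tsnd]) (auto simp: enc_tree_def tsnd_def tl_def split: list.splits)

lemma polytime_Pair [polytime_intros]:
  assumes "polytime_on D f" "polytime_on D g"
  shows "polytime_on D (\<lambda>x. (f x, g x))"
proof -
  obtain cf kf where f: "wf_com cf" "\<And>x. x \<in> D \<Longrightarrow> sz (f x) \<le> (sz x + 2) ^ kf"
    "\<And>x a b u d. x \<in> D \<Longrightarrow>
       exec cf [code (enc x) @ a, b, u, d] [code (enc (f x)) @ a, b, u, d] ((sz x + 2) ^ kf)"
    using assms(1) by (rule polytime_onE) blast
  obtain cg kg where g: "wf_com cg" "\<And>x. x \<in> D \<Longrightarrow> sz (g x) \<le> (sz x + 2) ^ kg"
    "\<And>x a b u d. x \<in> D \<Longrightarrow>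
       exec cg [code (enc x) @ a, b, u, d] [code (enc (g x)) @ a, b, u, d] ((sz x + 2) ^ kg)"
    using assms(2) by (rule polytime_onE) blast
  show ?thesis
  proof (rule polytime_onI)
    show "wf_com (pair_com cf cg)" using f g by simp
    show "poly_bounded (\<lambda>n. (n + 2) ^ kf + (n + 2) ^ kg + 35 * n + 18 * (n + 2) ^ kf + 100)"
      by (intro poly_bounded_intros)
    show "poly_bounded (\<lambda>n. Suc ((n + 2) ^ kf + (n + 2) ^ kg))"
      by (intro poly_bounded_intros)
    fix x a b u d assume x: "x \<in> D"
    show "exec (pair_com cf cg) [code (enc x) @ a, b, u, d] [code (enc (f x, g x)) @ a, b, u, d]
        ((sz x + 2) ^ kf + (sz x + 2) ^ kg + 35 * sz x + 18 * (sz x + 2) ^ kf + 100)"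
      using exec_mono[OF exec_pair_com[OF f(3)[OF x] g(3)[OF x]]] f(2)[OF x]
      by (simp add: enc_prod_def sz_def)
  next
    fix x assume "x \<in> D"
    then show "sz (f x, g x) \<le> Suc ((sz x + 2) ^ kf + (sz x + 2) ^ kg)"
      using f(2)[of x] g(2)[of x] by auto
  qed
qed

lemma polytime_Cons [polytime_intros]:
  "polytime_on D f \<Longrightarrow> polytime_on D g \<Longrightarrow> polytime_on D (\<lambda>x. f x # g x)"
  by (rule polytime_on_recode[OF polytime_Pair[of D f g]]) (auto simp: enc_prod_def)

lemma polytime_Nd [polytime_intros]:
  "polytime_on D f \<Longrightarrow> polytime_on D g \<Longrightarrow> polytime_on D (\<lambda>x. Nd (f x) (g x))"
  by (rule polytime_on_recode[OF polytime_Pair[of D f g]]) (auto simp: enc_prod_def enc_tree_def)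

lemma polytime_Suc [polytime_intros]: "polytime_on D f \<Longrightarrow> polytime_on D (\<lambda>x. Suc (f x))"
  by (rule polytime_on_recode[OF polytime_Pair[OF polytime_const[of D Lf], of f]])
     (auto simp: enc_prod_def enc_tree_def)

lemma polytime_if_on:
  assumes "polytime_on D b" "polytime_on {x \<in> D. b x} f" "polytime_on {x \<in> D. \<not> b x} g"
  shows "polytime_on D (\<lambda>x. if b x then f x else g x)"
proof -
  have b: "(enc (b x) \<noteq> Lf) = b x" for x by (simp add: enc_bool_def)
  have b': "(enc (b x) = Lf) = (\<not> b x)" for x by (simp add: enc_bool_def)
  show ?thesis using polytime_on_if_Lf[of D b f g] assms unfolding b b' by simp
qed

lemma polytime_if [polytime_intros]:
  "polytime_on D b \<Longrightarrow> polytime_on D f \<Longrightarrow> polytime_on D g \<Longrightarrow> polytime_on D (\<lambda>x. if b x then f x else g x)"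
  by (rule polytime_if_on) (auto elim: polytime_on_subset)

lemma polytime_not [polytime_intros]: "polytime_on D b \<Longrightarrow> polytime_on D (\<lambda>x. \<not> b x)"
  by (rule polytime_on_cong[OF polytime_if[OF _ polytime_const[of _ False] polytime_const[of _ True]]]) auto

lemma polytime_conj [polytime_intros]:
  "polytime_on D b \<Longrightarrow> polytime_on D b' \<Longrightarrow> polytime_on D (\<lambda>x. b x \<and> b' x)"
  by (rule polytime_on_cong[OF polytime_if[OF _ _ polytime_const[of _ False]], of _ b b']) auto

lemma polytime_disj [polytime_intros]:
  "polytime_on D b \<Longrightarrow> polytime_on D b' \<Longrightarrow> polytime_on D (\<lambda>x. b x \<or> b' x)"
  by (rule polytime_on_cong[OF polytime_if[OF _ polytime_const[of _ True]], of _ b b']) auto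

lemma polytime_case_tree [polytime_intros]:
  assumes t: "polytime_on D t" and "polytime_on D f"
    and g: "polytime (\<lambda>p. g (fst p) (fst (snd p)) (snd (snd p)))"
  shows "polytime_on D (\<lambda>x. case t x of Lf \<Rightarrow> f x | Nd l r \<Rightarrow> g x l r)"
proof -
  \<comment> \<open>On this subset the pair \<open>(x, t x)\<close> and the triple of
    \<open>x\<close> with the two subtrees have the same code, so the node branch receives its
    arguments without any computation.\<close>
  let ?E = "{x \<in> D. enc (t x) \<noteq> Lf}"
  have "polytime_on ?E (\<lambda>x. (x, t x))"
    by (intro polytime_intros polytime_on_subset[OF t]) auto
  then have "polytime_on ?E (\<lambda>x. (x, tfst (t x), tsnd (t x)))"
    by (rule polytime_on_recode) (auto simp: enc_tree_def enc_prod_def tfst_def tsnd_def split: tree.splits)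
  then have "polytime_on ?E (\<lambda>x. g x (tfst (t x)) (tsnd (t x)))"
    using polytime_comp[OF g] by fastforce
  moreover have "polytime_on {x \<in> D. enc (t x) = Lf} f"
    by (rule polytime_on_subset[OF assms(2)]) auto
  ultimately have "polytime_on D (\<lambda>x. if enc (t x) \<noteq> Lf then g x (tfst (t x)) (tsnd (t x)) else f x)"
    using t by (intro polytime_on_if_Lf)
  then show ?thesis
    by (rule polytime_on_cong) (auto simp: enc_tree_def tfst_def tsnd_def split: tree.splits)
qed

lemma polytime_case_list [polytime_intros]:
  assumes t: "polytime_on D t" and "polytime_on D f"
    and g: "polytime (\<lambda>p. g (fst p) (fst (snd p)) (snd (snd p)))"
  shows "polytime_on D (\<lambda>x. case t x of [] \<Rightarrow> f x | y # ys \<Rightarrow> g x y ys)"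
proof -
  let ?E = "{x \<in> D. enc (t x) \<noteq> Lf}"
  have ne: "(enc (t x) \<noteq> Lf) = (t x \<noteq> [])" for x by (cases "t x") auto
  have "polytime_on ?E (\<lambda>x. (x, t x))"
    by (intro polytime_intros polytime_on_subset[OF t]) auto
  then have "polytime_on ?E (\<lambda>x. (x, hd (t x), tl (t x)))"
    by (rule polytime_on_recode) (auto simp: ne enc_prod_def neq_Nil_conv)
  then have "polytime_on ?E (\<lambda>x. g x (hd (t x)) (tl (t x)))"
    using polytime_comp[OF g] by fastforce
  moreover have "polytime_on {x \<in> D. enc (t x) = Lf} f"
    by (rule polytime_on_subset[OF assms(2)]) auto
  ultimately have "polytime_on D (\<lambda>x. if enc (t x) \<noteq> Lf then g x (hd (t x)) (tl (t x)) else f x)"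
    using t by (intro polytime_on_if_Lf)
  then show ?thesis
    by (rule polytime_on_cong) (auto split: list.splits)
qed

lemma polytime_case_nat [polytime_intros]:
  assumes t: "polytime_on D t" and "polytime_on D f"
    and g: "polytime (\<lambda>p. g (fst p) (snd p))"
  shows "polytime_on D (\<lambda>x. case t x of 0 \<Rightarrow> f x | Suc n \<Rightarrow> g x n)"
proof -
  let ?E = "{x \<in> D. enc (t x) \<noteq> Lf}"
  have ne: "(enc (t x) \<noteq> Lf) = (t x \<noteq> 0)" for x by (cases "t x") auto
  have "polytime_on ?E (\<lambda>x. (x, tsnd (enc (t x))))"
    by (intro polytime_intros polytime_tsnd polytime_on_subset[OF t]) auto
  then have "polytime_on ?E (\<lambda>x. (x, t x - 1))"
    by (rule polytime_on_recode) (auto simp: ne enc_prod_def enc_tree_def tsnd_def gr0_conv_Suc)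
  then have "polytime_on ?E (\<lambda>x. g x (t x - 1))"
    using polytime_comp[OF g] by fastforce
  moreover have "polytime_on {x \<in> D. enc (t x) = Lf} f"
    by (rule polytime_on_subset[OF assms(2)]) auto
  ultimately have "polytime_on D (\<lambda>x. if enc (t x) \<noteq> Lf then g x (t x - 1) else f x)"
    using t by (intro polytime_on_if_Lf)
  then show ?thesis
    by (rule polytime_on_cong) (auto split: nat.splits)
qed

text \<open>Iterating a polynomial-time function may blow up its values, as repeated doubling shows.
  The uniform bound \<open>q\<close> on all intermediate values excludes this: every round then
  costs a polynomial in the size of the original input.\<close>

lemma polytime_iterate0:
  fixes f :: "'b::enc \<Rightarrow> 'b" and n :: "'a::enc \<Rightarrow> 'c::enc"
  assumes f: "polytime f" and n: "polytime_on D n" and s: "polytime_on D s" and q: "poly_bounded q"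
    and le: "\<And>x i. x \<in> D \<Longrightarrow> i \<le> nodes (enc (n x)) \<Longrightarrow> sz ((f ^^ i) (s x)) \<le> q (sz x)"
  shows "polytime_on D (\<lambda>x. (f ^^ nodes (enc (n x))) (s x))"
proof -
  obtain k where k: "\<And>n. q n \<le> (n + 2) ^ k" "\<And>m n. m \<le> n \<Longrightarrow> q m \<le> (n + 2) ^ k"
    using q by (rule poly_boundedE) blast
  obtain cf kf where cf: "wf_com cf"
    "\<And>x a b u d. exec cf [code (enc x) @ a, b, u, d] [code (enc (f x)) @ a, b, u, d] ((sz x + 2) ^ kf)"
    using f by (rule polytime_onE) blast
  obtain c kc where c: "wf_com c" "\<And>x. x \<in> D \<Longrightarrow> sz (n x, s x) \<le> (sz x + 2) ^ kc"
    "\<And>x a b u d. x \<in> D \<Longrightarrow>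
       exec c [code (enc x) @ a, b, u, d] [code (enc (n x, s x)) @ a, b, u, d] ((sz x + 2) ^ kc)"
    using polytime_Pair[OF n s] by (rule polytime_onE) blast
  show ?thesis
  proof (rule polytime_onI)
    show "wf_com (c ;; iterate_com cf)" using c cf by simp
    show "poly_bounded (\<lambda>n. (n + 2) ^ kc + ((n + 2) ^ kc * ((((n + 2) ^ k) + 2) ^ kf + 16) + 30) + 1)"
      by (intro poly_bounded_intros)
    show "poly_bounded q" by fact
    fix x a b u d assume x: "x \<in> D"
    have "exec cf [code (enc ((f ^^ i) (s x))) @ a, b, u, d] [code (enc ((f ^^ Suc i) (s x))) @ a, b, u, d]
        ((((sz x + 2) ^ k) + 2) ^ kf)" if "i < nodes (enc (n x))" for i a b u d
    proof -
      have "sz ((f ^^ i) (s x)) \<le> (sz x + 2) ^ k"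
        using le[OF x, of i] that k(1)[of "sz x"] by simp
      then show ?thesis using exec_mono[OF cf(2)[of "(f ^^ i) (s x)"]] by (simp add: power_mono)
    qed
    from exec_iterate_com[of "enc (n x)" cf "\<lambda>i. enc ((f ^^ i) (s x))", OF this]
    have "exec (iterate_com cf) [code (enc (n x, s x)) @ a, b, u, d]
       [code (enc ((f ^^ nodes (enc (n x))) (s x))) @ a, b, u, d]
       (tsize (enc (n x)) * ((((sz x + 2) ^ k) + 2) ^ kf + 16) + 30)"
      by (simp add: enc_prod_def)
    moreover have "tsize (enc (n x)) \<le> (sz x + 2) ^ kc"
      using c(2)[OF x] by (simp add: sz_def enc_prod_def)
    ultimately have "exec (iterate_com cf) [code (enc (n x, s x)) @ a, b, u, d]
       [code (enc ((f ^^ nodes (enc (n x))) (s x))) @ a, b, u, d]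
       ((sz x + 2) ^ kc * ((((sz x + 2) ^ k) + 2) ^ kf + 16) + 30)"
      by (auto elim!: exec_mono)
    from exec_seq[OF c(3)[OF x] this order_refl]
    show "exec (c ;; iterate_com cf) [code (enc x) @ a, b, u, d]
       [code (enc ((f ^^ nodes (enc (n x))) (s x))) @ a, b, u, d]
       ((sz x + 2) ^ kc + ((sz x + 2) ^ kc * ((((sz x + 2) ^ k) + 2) ^ kf + 16) + 30) + 1)" .
  next
    fix x assume "x \<in> D"
    then show "sz ((f ^^ nodes (enc (n x))) (s x)) \<le> q (sz x)" using le by blast
  qed
qed

lemma polytime_iterate:
  fixes f :: "'a::enc \<Rightarrow> 'b::enc \<Rightarrow> 'b" and n :: "'a \<Rightarrow> 'c::enc"
  assumes f: "polytime (\<lambda>p. f (fst p) (snd p))" and n: "polytime_on D n" and s: "polytime_on D s"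
    and q: "poly_bounded q"
    and le: "\<And>x i. x \<in> D \<Longrightarrow> i \<le> nodes (enc (n x)) \<Longrightarrow> sz ((f x ^^ i) (s x)) \<le> q (sz x)"
  shows "polytime_on D (\<lambda>x. (f x ^^ nodes (enc (n x))) (s x))"
proof -
  let ?g = "\<lambda>p. (fst p, f (fst p) (snd p))"
  have g: "(?g ^^ i) (x, y) = (x, (f x ^^ i) y)" for i x y
    by (induction i) auto
  have "polytime ?g" using f by (intro polytime_intros)
  moreover have "polytime_on D (\<lambda>x. (x, s x))" using s by (intro polytime_intros)
  moreover have "poly_bounded (\<lambda>n. Suc (n + q n))" using q by (intro poly_bounded_intros)
  moreover have "sz ((?g ^^ i) (x, s x)) \<le> Suc (sz x + q (sz x))"
    if "x \<in> D" "i \<le> nodes (enc (n x))" for x i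
    using le[OF that] by (simp add: g)
  ultimately have "polytime_on D (\<lambda>x. (?g ^^ nodes (enc (n x))) (x, s x))"
    using n polytime_iterate0[of ?g D n "\<lambda>x. (x, s x)"] by blast
  then have "polytime_on D (\<lambda>x. snd ((?g ^^ nodes (enc (n x))) (x, s x)))"
    by (rule polytime_snd)
  then show ?thesis by (simp add: g)
qed

lemma polytime_funpow:
  fixes f :: "'a::enc \<Rightarrow> 'b::enc \<Rightarrow> 'b"
  assumes "polytime (\<lambda>p. f (fst p) (snd p))" "polytime_on D n" "polytime_on D s" "poly_bounded q"
    and "\<And>x i. x \<in> D \<Longrightarrow> i \<le> n x \<Longrightarrow> sz ((f x ^^ i) (s x)) \<le> q (sz x)"
  shows "polytime_on D (\<lambda>x. (f x ^^ n x) (s x))"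
  using polytime_iterate[OF assms(1-4)] assms(5) by simp

subsection \<open>Lists\<close>

lemma polytime_foldl:
  assumes g: "polytime (\<lambda>p. g (fst p) (fst (snd p)) (snd (snd p)))"
    and s: "polytime_on D s" and xs: "polytime_on D xs" and q: "poly_bounded q"
    and le: "\<And>x i. x \<in> D \<Longrightarrow> sz (foldl (g x) (s x) (take i (xs x))) \<le> q (sz x)"
  shows "polytime_on D (\<lambda>x. foldl (g x) (s x) (xs x))"
proof -
  define h where "h = (\<lambda>x p. case fst p of [] \<Rightarrow> p | y # ys \<Rightarrow> (ys, g x (snd p) y))"
  have h: "(h x ^^ i) (ys, a) = (drop i ys, foldl (g x) a (take i ys))" for x i ys a
  proof (induction i arbitrary: ys a)
    case (Suc i)
    have "(h x ^^ Suc i) (ys, a) = (h x ^^ i) (h x (ys, a))" by (simp only: funpow_Suc_right comp_apply)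
    also have "\<dots> = (drop (Suc i) ys, foldl (g x) a (take (Suc i) ys))"
      by (cases ys) (simp_all add: h_def Suc[unfolded h_def])
    finally show ?case .
  qed simp
  have "polytime (\<lambda>p. h (fst p) (snd p))"
    unfolding h_def
    by (intro polytime_intros polytime_comp[OF g, where g = "\<lambda>p. (fst (fst p), snd (snd (fst p)), fst (snd p))", simplified])
  moreover obtain k where k: "\<And>x n. x \<in> D \<Longrightarrow> sz x \<le> n \<Longrightarrow> sz (xs x) \<le> (n + 2) ^ k"
    using xs by (rule polytime_on_sz) blast
  moreover have "polytime_on D (\<lambda>x. (xs x, s x))" using xs s by (intro polytime_intros)
  moreover have "poly_bounded (\<lambda>n. Suc ((n + 2) ^ k + q n))" using q by (intro poly_bounded_intros)
  moreover have "sz ((h x ^^ i) (xs x, s x)) \<le> Suc ((sz x + 2) ^ k + q (sz x))" if "x \<in> D" for x i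
    using le[OF that, of i] k[OF that order_refl] sz_drop[of i "xs x"] by (simp add: h)
  ultimately have "polytime_on D (\<lambda>x. (h x ^^ nodes (enc (xs x))) (xs x, s x))"
    using xs by (intro polytime_iterate) auto
  then have "polytime_on D (\<lambda>x. snd ((h x ^^ nodes (enc (xs x))) (xs x, s x)))"
    by (rule polytime_snd)
  then show ?thesis by (simp add: h length_le_nodes)
qed

text \<open>If the growth per entry does not depend on the accumulator, the total growth is at most
  the number of entries times a polynomial. This covers the folds that build their result piece by
  piece.\<close>

lemma polytime_foldl_add:
  assumes g: "polytime (\<lambda>p. g (fst p) (fst (snd p)) (snd (snd p)))"
    and s: "polytime_on D s" and xs: "polytime_on D xs" and q: "poly_bounded q"
    and le: "\<And>x a y. sz (g x a y) \<le> sz a + q (sz x + sz y)"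
  shows "polytime_on D (\<lambda>x. foldl (g x) (s x) (xs x))"
proof -
  obtain k where k: "\<And>x n. x \<in> D \<Longrightarrow> sz x \<le> n \<Longrightarrow> sz (xs x) \<le> (n + 2) ^ k"
    using xs by (rule polytime_on_sz) blast
  obtain l where l: "\<And>x n. x \<in> D \<Longrightarrow> sz x \<le> n \<Longrightarrow> sz (s x) \<le> (n + 2) ^ l"
    using s by (rule polytime_on_sz) blast
  obtain m where m: "\<And>n n'. n \<le> n' \<Longrightarrow> q n \<le> (n' + 2) ^ m"
    using q by (rule poly_boundedE) blast
  let ?q = "\<lambda>n. (n + (n + 2) ^ k + 2) ^ m"
  have *: "sz (foldl (g x) a ys) \<le> sz a + length ys * ?q (sz x)" if "set ys \<subseteq> set (xs x)" "x \<in> D" for x a ys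
    using that
  proof (induction ys arbitrary: a)
    case (Cons y ys)
    have "sz y \<le> (sz x + 2) ^ k" using sz_in_list[of y "xs x"] k[of x] Cons.prems by fastforce
    then have "sz (g x a y) \<le> sz a + ?q (sz x)"
      using le[of x a y] m[of "sz x + sz y" "sz x + (sz x + 2) ^ k"] by simp
    moreover have "sz (foldl (g x) (g x a y) ys) \<le> sz (g x a y) + length ys * ?q (sz x)"
      using Cons by auto
    ultimately show ?case by simp
  qed simp
  show ?thesis
  proof (rule polytime_foldl[OF g s xs])
    show "poly_bounded (\<lambda>n. (n + 2) ^ l + (n + 2) ^ k * ?q n)" by (intro poly_bounded_intros)
    fix x i assume x: "x \<in> D"
    have "sz (foldl (g x) (s x) (take i (xs x))) \<le> sz (s x) + length (take i (xs x)) * ?q (sz x)"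
      by (rule *[OF set_take_subset x])
    also have "length (take i (xs x)) \<le> (sz x + 2) ^ k"
      using length_less_sz[of "xs x"] k[OF x order_refl] by simp
    finally show "sz (foldl (g x) (s x) (take i (xs x))) \<le> (sz x + 2) ^ l + (sz x + 2) ^ k * ?q (sz x)"
      using l[OF x order_refl] by (meson add_mono le_trans mult_le_mono1 order_refl)
  qed
qed

lemma polytime_rev [polytime_intros]:
  assumes "polytime_on D xs"
  shows "polytime_on D (\<lambda>x. rev (xs x))"
proof -
  have "foldl (\<lambda>a y. y # a) zs ys = rev ys @ zs" for ys zs :: "'b list"
    by (induction ys arbitrary: zs) auto
  moreover have "polytime_on D (\<lambda>x. foldl (\<lambda>a y. y # a) [] (xs x))"
    by (rule polytime_foldl_add[where g = "\<lambda>x a y. y # a" and q = Suc])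
       (auto intro!: polytime_intros assms poly_bounded_intros)
  ultimately show ?thesis by simp
qed

lemma polytime_append [polytime_intros]:
  assumes "polytime_on D xs" "polytime_on D ys"
  shows "polytime_on D (\<lambda>x. xs x @ ys x)"
proof -
  have "foldl (\<lambda>a y. y # a) zs ys = rev ys @ zs" for ys zs :: "'b list"
    by (induction ys arbitrary: zs) auto
  moreover have "polytime_on D (\<lambda>x. foldl (\<lambda>a y. y # a) (ys x) (rev (xs x)))"
    by (rule polytime_foldl_add[where g = "\<lambda>x a y. y # a" and q = Suc])
       (auto intro!: polytime_intros assms poly_bounded_intros)
  ultimately show ?thesis by simp
qed

lemma polytime_map [polytime_intros]:
  assumes f: "polytime (\<lambda>p. f (fst p) (snd p))" and xs: "polytime_on D xs"
  shows "polytime_on D (\<lambda>x. map (f x) (xs x))"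
proof -
  have *: "foldl (\<lambda>a y. f x y # a) zs ys = rev (map (f x) ys) @ zs" for x ys zs
    by (induction ys arbitrary: zs) auto
  obtain k where k: "\<And>x n. sz x \<le> n \<Longrightarrow> sz (f (fst x) (snd x)) \<le> (n + 2) ^ k"
    using f by (rule polytime_on_sz) blast
  have "polytime_on D (\<lambda>x. foldl (\<lambda>a y. f x y # a) [] (xs x))"
  proof (rule polytime_foldl_add[where g = "\<lambda>x a y. f x y # a"])
    show "polytime (\<lambda>p. f (fst p) (snd (snd p)) # fst (snd p))"
      by (intro polytime_intros polytime_comp[OF f, where g = "\<lambda>p. (fst p, snd (snd p))", simplified])
    show "poly_bounded (\<lambda>n. Suc ((Suc n + 2) ^ k))" by (intro poly_bounded_intros)
    show "sz (f x y # a) \<le> sz a + Suc ((Suc (sz x + sz y) + 2) ^ k)" for x y a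
      using k[of "(x, y)" "Suc (sz x + sz y)"] by simp
  qed (auto intro: polytime_intros xs)
  then have "polytime_on D (\<lambda>x. rev (foldl (\<lambda>a y. f x y # a) [] (xs x)))" by (rule polytime_rev)
  then show ?thesis by (simp add: *)
qed

lemma polytime_concat [polytime_intros]:
  assumes "polytime_on D xs"
  shows "polytime_on D (\<lambda>x. concat (xs x))"
proof -
  have "foldl (\<lambda>a y. a @ y) zs ys = zs @ concat ys" for ys and zs :: "'b list"
    by (induction ys arbitrary: zs) auto
  moreover have "polytime_on D (\<lambda>x. foldl (\<lambda>a y. a @ y) [] (xs x))"
    by (rule polytime_foldl_add[where g = "\<lambda>x a y. a @ y" and q = "\<lambda>n. n"])
       (auto intro!: polytime_intros assms poly_bounded_intros order.trans[OF sz_append_le])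
  ultimately show ?thesis by simp
qed

lemma polytime_ex_list [polytime_intros]:
  assumes f: "polytime (\<lambda>p. f (fst p) (snd p))" and xs: "polytime_on D xs"
  shows "polytime_on D (\<lambda>x. \<exists>y\<in>set (xs x). f x y)"
proof -
  have *: "foldl (\<lambda>a y. a \<or> f x y) b ys \<longleftrightarrow> b \<or> (\<exists>y\<in>set ys. f x y)" for x ys b
    by (induction ys arbitrary: b) auto
  have "polytime_on D (\<lambda>x. foldl (\<lambda>a y. a \<or> f x y) False (xs x))"
  proof (rule polytime_foldl[where g = "\<lambda>x a y. a \<or> f x y"])
    show "polytime (\<lambda>p. fst (snd p) \<or> f (fst p) (snd (snd p)))"
      by (intro polytime_intros polytime_comp[OF f, where g = "\<lambda>p. (fst p, snd (snd p))", simplified])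
    show "poly_bounded (\<lambda>n. 3)" by (intro poly_bounded_intros)
  qed (auto intro: polytime_intros xs sz_bool)
  then show ?thesis by (simp add: *)
qed

lemma polytime_length [polytime_intros]:
  assumes "polytime_on D xs"
  shows "polytime_on D (\<lambda>x. length (xs x))"
proof -
  have "foldl (\<lambda>a y. Suc a) n ys = n + length ys" for n and ys :: "'b list"
    by (induction ys arbitrary: n) auto
  moreover have "polytime_on D (\<lambda>x. foldl (\<lambda>a y. Suc a) 0 (xs x))"
    by (rule polytime_foldl_add[where g = "\<lambda>x a y. Suc a" and q = "\<lambda>n. 2"])
       (auto intro!: polytime_intros assms poly_bounded_intros)
  ultimately show ?thesis by simp
qed

lemma polytime_add [polytime_intros]:
  assumes "polytime_on D f" "polytime_on D g"
  shows "polytime_on D (\<lambda>x. f x + g x :: nat)"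
proof -
  obtain k where k: "\<And>x n. x \<in> D \<Longrightarrow> sz x \<le> n \<Longrightarrow> sz (f x) \<le> (n + 2) ^ k"
    using assms(1) by (rule polytime_on_sz) blast
  obtain l where l: "\<And>x n. x \<in> D \<Longrightarrow> sz x \<le> n \<Longrightarrow> sz (g x) \<le> (n + 2) ^ l"
    using assms(2) by (rule polytime_on_sz) blast
  have S: "(Suc ^^ i) n = i + n" for i n by (induction i) auto
  have "polytime_on D (\<lambda>x. (Suc ^^ f x) (g x))"
  proof (rule polytime_funpow[where f = "\<lambda>x. Suc", OF _ assms])
    show "poly_bounded (\<lambda>n. (n + 2) ^ k + (n + 2) ^ l)" by (intro poly_bounded_intros)
    show "sz ((Suc ^^ i) (g x)) \<le> (sz x + 2) ^ k + (sz x + 2) ^ l" if "x \<in> D" "i \<le> f x" for x i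
      using k[OF that(1) order_refl] l[OF that(1) order_refl] that(2) by (simp add: S)
  qed (intro polytime_intros)
  then show ?thesis by (simp add: S)
qed

lemma polytime_mult [polytime_intros]:
  assumes "polytime_on D f" "polytime_on D g"
  shows "polytime_on D (\<lambda>x. f x * g x :: nat)"
proof -
  obtain k where k: "\<And>x n. x \<in> D \<Longrightarrow> sz x \<le> n \<Longrightarrow> sz (f x) \<le> (n + 2) ^ k"
    using assms(1) by (rule polytime_on_sz) blast
  obtain l where l: "\<And>x n. x \<in> D \<Longrightarrow> sz x \<le> n \<Longrightarrow> sz (g x) \<le> (n + 2) ^ l"
    using assms(2) by (rule polytime_on_sz) blast
  have S: "snd (((\<lambda>p. (fst p, fst p + snd p)) ^^ i) (a, b)) = i * a + b \<and>
      fst (((\<lambda>p. (fst p, fst p + snd p)) ^^ i) (a, b)) = a" for i a b :: nat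
    by (induction i) auto
  have "polytime_on D (\<lambda>x. ((\<lambda>p. (fst p, fst p + snd p)) ^^ f x) (g x, 0::nat))"
  proof (rule polytime_funpow[where f = "\<lambda>x p. (fst p, fst p + snd p)", OF _ assms(1)])
    show "poly_bounded (\<lambda>n. Suc ((n + 2) ^ l + (2 * ((n + 2) ^ k * (n + 2) ^ l) + 1)))" by (intro poly_bounded_intros)
    show "sz (((\<lambda>p. (fst p, fst p + snd p)) ^^ i) (g x, 0)) \<le>
        Suc ((sz x + 2) ^ l + (2 * ((sz x + 2) ^ k * (sz x + 2) ^ l) + 1))" if "x \<in> D" "i \<le> f x" for x i
    proof -
      have "i * g x \<le> (sz x + 2) ^ k * (sz x + 2) ^ l"
        using k[OF that(1) order_refl] l[OF that(1) order_refl] that(2) by (intro mult_mono) auto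
      then show ?thesis
        using l[OF that(1) order_refl] S[of i "g x" 0] sz_fst_snd[of "((\<lambda>p. (fst p, fst p + snd p)) ^^ i) (g x, 0)"]
        by simp
    qed
  qed (intro polytime_intros assms(2))+
  then have "polytime_on D (\<lambda>x. snd (((\<lambda>p. (fst p, fst p + snd p)) ^^ f x) (g x, 0::nat)))"
    by (rule polytime_snd)
  then show ?thesis by (simp add: S)
qed

lemma polytime_power [polytime_intros]:
  "polytime_on D f \<Longrightarrow> polytime_on D (\<lambda>x. f x ^ k :: nat)"
  by (induction k) (auto intro: polytime_intros)

lemma polytime_comp2:
  assumes "polytime (\<lambda>p. h (fst p) (snd p))" "polytime_on D f" "polytime_on D g"
  shows "polytime_on D (\<lambda>x. h (f x) (g x))"
  using polytime_comp[OF assms(1) polytime_Pair[OF assms(2,3)]] by simp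

subsection \<open>Equality and finite tables\<close>

definition eq_step :: "bool \<times> (tree \<times> tree) list \<Rightarrow> bool \<times> (tree \<times> tree) list" where
  "eq_step p = (case snd p of [] \<Rightarrow> p | y # ys \<Rightarrow>
     (case fst y of
        Lf \<Rightarrow> (case snd y of Lf \<Rightarrow> (fst p, ys) | Nd l r \<Rightarrow> (False, []))
      | Nd a b \<Rightarrow> (case snd y of Lf \<Rightarrow> (False, []) | Nd l r \<Rightarrow> (fst p, (a, l) # (b, r) # ys))))"

lemma polytime_eq_step: "polytime eq_step"
  unfolding eq_step_def by (intro polytime_intros)

lemma eq_step_correct:
  "(fst (eq_step p) \<and> (\<forall>(a, b)\<in>set (snd (eq_step p)). a = b)) = (fst p \<and> (\<forall>(a, b)\<in>set (snd p). a = b))"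
  by (auto simp: eq_step_def split: list.splits tree.splits)

lemma eq_step_sz: "sz (eq_step p) \<le> sz p"
  by (cases p)
     (auto simp: eq_step_def sz_def enc_prod_def enc_tree_def enc_bool_def split: list.splits tree.splits)

text \<open>Each step on a nonempty work list removes at least one symbol from its first components,
  so the size of the first tree bounds the number of steps.\<close>

lemma eq_step_progress:
  "(\<Sum>y\<leftarrow>snd p. tsize (fst y)) \<le> Suc n \<Longrightarrow> (\<Sum>y\<leftarrow>snd (eq_step p). tsize (fst y)) \<le> n"
  by (auto simp: eq_step_def split: list.splits tree.splits)

lemma eq_step_iterate:
  "(fst ((eq_step ^^ i) p) \<and> (\<forall>(a, b)\<in>set (snd ((eq_step ^^ i) p)). a = b)) =
     (fst p \<and> (\<forall>(a, b)\<in>set (snd p). a = b)) \<and>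
   sz ((eq_step ^^ i) p) \<le> sz p \<and>
   ((\<Sum>y\<leftarrow>snd p. tsize (fst y)) \<le> i + n \<longrightarrow> (\<Sum>y\<leftarrow>snd ((eq_step ^^ i) p). tsize (fst y)) \<le> n)"
proof (induction i arbitrary: n)
  case (Suc i)
  show ?case
    using Suc[of "Suc n"] eq_step_correct[of "(eq_step ^^ i) p"] eq_step_sz[of "(eq_step ^^ i) p"]
      eq_step_progress[of "(eq_step ^^ i) p" n]
    by (simp add: le_trans)
qed simp

lemma eq_step_final:
  assumes "(\<Sum>y\<leftarrow>snd p. tsize (fst y)) \<le> i"
  shows "fst ((eq_step ^^ i) p) = (fst p \<and> (\<forall>(a, b)\<in>set (snd p). a = b))"
proof -
  let ?r = "(eq_step ^^ i) p"
  have 0: "(\<Sum>y\<leftarrow>snd ?r. tsize (fst y)) = 0"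
    using eq_step_iterate[of i p 0] assms by simp
  have "snd ?r = []"
  proof (cases "snd ?r")
    case (Cons y ys)
    then have "tsize (fst y) = 0" using 0 by simp
    then show ?thesis using tsize_pos[of "fst y"] by simp
  qed
  then show ?thesis using eq_step_iterate[of i p 0] by simp
qed

lemma polytime_eq [polytime_intros]:
  assumes "polytime_on D f" "polytime_on D g"
  shows "polytime_on D (\<lambda>x. f x = g x)"
proof -
  \<comment> \<open>A tree with exactly \<open>tsize (enc (f x))\<close> inner nodes, the number of
    comparison steps that suffice.\<close>
  let ?n = "\<lambda>x. Nd (enc (f x)) (enc (f x))" and ?s = "\<lambda>x. (True, [(enc (f x), enc (g x))])"
  have f: "polytime_on D (\<lambda>x. enc (f x))" and g: "polytime_on D (\<lambda>x. enc (g x))"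
    by (rule polytime_on_recode[OF assms(1)] polytime_on_recode[OF assms(2)]; simp add: enc_tree_def)+
  then have s: "polytime_on D ?s" by (intro polytime_intros)
  obtain k where k: "\<And>x n. x \<in> D \<Longrightarrow> sz x \<le> n \<Longrightarrow> sz (?s x) \<le> (n + 2) ^ k"
    using s by (rule polytime_on_sz) blast
  have "polytime_on D (\<lambda>x. (eq_step ^^ nodes (enc (?n x))) (?s x))"
  proof (rule polytime_iterate0[OF polytime_eq_step _ s])
    show "poly_bounded (\<lambda>n. (n + 2) ^ k)" by (intro poly_bounded_intros)
    show "sz ((eq_step ^^ i) (?s x)) \<le> (sz x + 2) ^ k" if "x \<in> D" for x i
      using eq_step_iterate[of i "?s x" 0] k[OF that order_refl] le_trans by blast
  qed (intro polytime_intros f)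
  then have "polytime_on D (\<lambda>x. fst ((eq_step ^^ nodes (enc (?n x))) (?s x)))"
    by (rule polytime_fst)
  moreover have "fst ((eq_step ^^ nodes (enc (?n x))) (?s x)) = (f x = g x)" for x
    by (subst eq_step_final) (auto simp: enc_tree_def tsize_nodes dest: enc_inject)
  ultimately show ?thesis by simp
qed

text \<open>A finite function is a cascade of equality tests with a default elsewhere. The range
  condition makes the set of all values finite, which later bounds the branching of a
  machine.\<close>

lemma polytime_table:
  fixes f :: "'a::enc \<Rightarrow> 'b::enc"
  assumes "finite S"
  shows "\<exists>g. polytime g \<and> (\<forall>x\<in>S. g x = f x) \<and> range g \<subseteq> insert d (f ` S)"
  using assms
proof (induction S)
  case empty
  show ?case by (rule exI[of _ "\<lambda>_. d"]) (auto intro: polytime_intros)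
next
  case (insert a S)
  then obtain g where g: "polytime g" "\<forall>x\<in>S. g x = f x" "range g \<subseteq> insert d (f ` S)" by blast
  have "polytime (\<lambda>x. if x = a then f a else g x)" by (intro polytime_intros g)
  moreover have "range (\<lambda>x. if x = a then f a else g x) \<subseteq> insert d (f ` insert a S)" using g(3) by auto
  ultimately show ?case using g(2) by (intro exI[of _ "\<lambda>x. if x = a then f a else g x"]) auto
qed

subsection \<open>Binary arithmetic\<close>

abbreviation bval :: "bool list \<Rightarrow> nat" where
  "bval \<equiv> horner_sum of_bool 2"

lemma bval_less: "bval xs < 2 ^ length xs"
  by (induction xs) (auto simp: of_bool_def)

lemma bval_append: "bval (xs @ ys) = bval xs + 2 ^ length xs * bval ys"
  by (simp add: horner_sum_append)

lemma bval_False [simp]: "bval (map (\<lambda>_. False) ys) = 0"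
  by (induction ys) auto

lemma bval_eq_0: "bval xs = 0 \<longleftrightarrow> (\<forall>x\<in>set xs. \<not> x)"
  by (induction xs) auto

lemma sz_bools: "sz (xs :: bool list) \<le> 1 + 4 * length xs"
  using sz_list_le[of xs 3] sz_bool by simp

text \<open>Addition with carry, or subtraction with borrow if \<open>s\<close> is set, on the length of the first argument.\<close>

primrec ripple :: "bool \<Rightarrow> bool list \<Rightarrow> bool list \<Rightarrow> bool \<Rightarrow> bool list \<times> bool" where
  "ripple s [] ys c = ([], c)"
| "ripple s (x # xs) ys c =
     (let y = (ys \<noteq> [] \<and> hd ys);
          r = ripple s xs (tl ys) (((x \<noteq> s) \<and> (y \<or> c)) \<or> (y \<and> c))
      in ((x \<noteq> (y \<noteq> c)) # fst r, snd r))"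

lemma length_ripple [simp]: "length (fst (ripple s xs ys c)) = length xs"
  by (induction xs arbitrary: ys c) (simp_all add: Let_def)

text \<open>Schoolbook addition modulo \<open>2 ^ length xs\<close>, where the last carry is the
  overflow. Digits of \<open>ys\<close> beyond that length are never read.\<close>

lemma ripple_add:
  "bval (fst (ripple False xs ys c)) + 2 ^ length xs * of_bool (snd (ripple False xs ys c)) =
   of_bool c + bval xs + bval (take (length xs) ys)"
proof (induction xs arbitrary: ys c)
  case (Cons x xs)
  show ?case
  proof (cases ys)
    case Nil
    show ?thesis using Cons[of "[]" "x \<and> c"] by (cases x; cases c) (simp_all add: Nil Let_def)
  next
    case (Cons y zs)
    show ?thesis using Cons.IH[of zs "x \<and> (y \<or> c) \<or> y \<and> c"]
      by (cases x; cases y; cases c) (simp_all add: Cons Let_def)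
  qed
qed simp

lemma ripple_sub:
  "bval (fst (ripple True xs ys c)) + of_bool c + bval (take (length xs) ys) =
   bval xs + 2 ^ length xs * of_bool (snd (ripple True xs ys c))"
proof (induction xs arbitrary: ys c)
  case (Cons x xs)
  show ?case
  proof (cases ys)
    case Nil
    show ?thesis using Cons[of "[]" "\<not> x \<and> c"] by (cases x; cases c) (simp_all add: Nil Let_def)
  next
    case (Cons y zs)
    show ?thesis using Cons.IH[of zs "\<not> x \<and> (y \<or> c) \<or> y \<and> c"]
      by (cases x; cases y; cases c) (simp_all add: Cons Let_def)
  qed
qed simp

definition ripple_step :: "bool \<Rightarrow> bool list \<times> bool list \<times> bool \<Rightarrow> bool \<Rightarrow> bool list \<times> bool list \<times> bool" where
  "ripple_step s p x =
     (case fst (snd p) of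
        [] \<Rightarrow> ((x \<noteq> snd (snd p)) # fst p, [], (x \<noteq> s) \<and> snd (snd p))
      | y # ys \<Rightarrow> ((x \<noteq> (y \<noteq> snd (snd p))) # fst p, ys, ((x \<noteq> s) \<and> (y \<or> snd (snd p))) \<or> (y \<and> snd (snd p))))"

lemma foldl_ripple_step:
  "foldl (ripple_step s) (a, ys, c) xs =
   (rev (fst (ripple s xs ys c)) @ a, drop (length xs) ys, snd (ripple s xs ys c))"
proof (induction xs arbitrary: a ys c)
  case (Cons x xs)
  show ?case by (cases ys) (simp_all add: ripple_step_def Cons[unfolded ripple_step_def] Let_def)
qed simp

lemma polytime_ripple:
  assumes "polytime_on D f" "polytime_on D g"
  shows "polytime_on D (\<lambda>x. ripple s (f x) (g x) c)"
proof -
  obtain k where k: "\<And>x n. x \<in> D \<Longrightarrow> sz x \<le> n \<Longrightarrow> sz (f x) \<le> (n + 2) ^ k"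
    using assms(1) by (rule polytime_on_sz) blast
  obtain l where l: "\<And>x n. x \<in> D \<Longrightarrow> sz x \<le> n \<Longrightarrow> sz (g x) \<le> (n + 2) ^ l"
    using assms(2) by (rule polytime_on_sz) blast
  have "polytime_on D (\<lambda>x. foldl (ripple_step s) ([], g x, c) (f x))"
  proof (rule polytime_foldl[where g = "\<lambda>x. ripple_step s"])
    show "polytime (\<lambda>p. ripple_step s (fst (snd p)) (snd (snd p)))" for p :: "'a \<times> (bool list \<times> bool list \<times> bool) \<times> bool"
      unfolding ripple_step_def by (intro polytime_intros)
    show "poly_bounded (\<lambda>n. 6 + 4 * (n + 2) ^ k + (n + 2) ^ l)" by (intro poly_bounded_intros)
    fix x i assume x: "x \<in> D"
    have "length (rev (fst (ripple s (take i (f x)) (g x) c))) \<le> (sz x + 2) ^ k"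
      using length_less_sz[of "f x"] k[OF x order_refl] by simp
    then have "sz (rev (fst (ripple s (take i (f x)) (g x) c))) \<le> 1 + 4 * (sz x + 2) ^ k"
      using sz_bools[of "rev (fst (ripple s (take i (f x)) (g x) c))"] by simp
    then show "sz (foldl (ripple_step s) ([], g x, c) (take i (f x))) \<le> 6 + 4 * (sz x + 2) ^ k + (sz x + 2) ^ l"
      unfolding foldl_ripple_step
      using sz_drop[of "length (take i (f x))" "g x"] l[OF x order_refl] sz_bool[of "snd (ripple s (take i (f x)) (g x) c)"]
      by simp
  qed (intro polytime_intros assms)+
  then have "polytime_on D (\<lambda>x. (rev (fst (foldl (ripple_step s) ([], g x, c) (f x))),
      snd (snd (foldl (ripple_step s) ([], g x, c) (f x)))))"
    by (intro polytime_intros)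
  then show ?thesis by (simp add: foldl_ripple_step)
qed

text \<open>Padding \<open>xs\<close> by the length of \<open>ys\<close> ensures that no digit of
  \<open>ys\<close> is cut off. Lengths therefore add up instead of taking the maximum.\<close>

definition badd :: "bool list \<Rightarrow> bool list \<Rightarrow> bool list" where
  "badd xs ys = (let r = ripple False (xs @ map (\<lambda>_. False) ys) ys False in fst r @ [snd r])"

definition bsub :: "bool list \<Rightarrow> bool list \<Rightarrow> bool list" where
  "bsub xs ys = fst (ripple True xs ys False)"

definition bless :: "bool list \<Rightarrow> bool list \<Rightarrow> bool" where
  "bless xs ys = snd (ripple True (xs @ map (\<lambda>_. False) ys) ys False)"

lemma bval_badd: "bval (badd xs ys) = bval xs + bval ys"
  using ripple_add[of "xs @ map (\<lambda>_. False) ys" ys False]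
  by (simp add: badd_def Let_def bval_append)

lemma length_badd: "length (badd xs ys) = length xs + length ys + 1"
  by (simp add: badd_def Let_def)

text \<open>A number is smaller exactly if subtracting the other one ends with a borrow, provided
  that all digits of the subtrahend take part.\<close>

lemma bless_iff: "bless xs ys \<longleftrightarrow> bval xs < bval ys"
proof -
  let ?xs = "xs @ map (\<lambda>_. False) ys"
  have 1: "bval (fst (ripple True ?xs ys False)) + bval ys = bval xs + 2 ^ length ?xs * of_bool (bless xs ys)"
    using ripple_sub[of ?xs ys False] by (simp add: bless_def bval_append)
  have 2: "bval (fst (ripple True ?xs ys False)) < 2 ^ length ?xs"
    using bval_less[of "fst (ripple True ?xs ys False)"] by simp
  show ?thesis using 1 2 by (cases "bless xs ys") auto
qed

text \<open>If \<open>ys\<close> is not larger than \<open>xs\<close>, its digits beyond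
  \<open>length xs\<close> are zeros and may be cut off. Subtraction thus works without padding and
  keeps the length, so remainders in long division stay short.\<close>

lemma bval_bsub:
  assumes "bval ys \<le> bval xs"
  shows "bval (bsub xs ys) = bval xs - bval ys"
proof -
  have "bval ys = bval (take (length xs) ys) + 2 ^ length (take (length xs) ys) * bval (drop (length xs) ys)"
    using bval_append[of "take (length xs) ys" "drop (length xs) ys"] by simp
  moreover have "bval (drop (length xs) ys) = 0"
  proof (rule ccontr)
    assume *: "bval (drop (length xs) ys) \<noteq> 0"
    then have "length (take (length xs) ys) = length xs" by (cases "length xs \<le> length ys") auto
    then have "bval ys \<ge> 2 ^ length xs * bval (drop (length xs) ys)" using calculation by simp
    moreover have "2 ^ length xs * 1 \<le> 2 ^ length xs * bval (drop (length xs) ys)"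
      using * by (intro mult_le_mono2) simp
    ultimately have "2 ^ length xs \<le> bval ys" by linarith
    then show False using assms bval_less[of xs] by linarith
  qed
  ultimately have t: "bval (take (length xs) ys) = bval ys" by simp
  have "bval (bsub xs ys) < 2 ^ length xs"
    using bval_less[of "bsub xs ys"] by (simp add: bsub_def)
  then show ?thesis using ripple_sub[of xs ys False] assms t
    by (cases "snd (ripple True xs ys False)") (auto simp: bsub_def)
qed

lemma length_bsub [simp]: "length (bsub xs ys) = length xs"
  by (simp add: bsub_def)

lemma polytime_badd [polytime_intros]:
  "polytime_on D f \<Longrightarrow> polytime_on D g \<Longrightarrow> polytime_on D (\<lambda>x. badd (f x) (g x))"
  unfolding badd_def Let_def by (intro polytime_intros polytime_ripple)

lemma polytime_bsub [polytime_intros]: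
  "polytime_on D f \<Longrightarrow> polytime_on D g \<Longrightarrow> polytime_on D (\<lambda>x. bsub (f x) (g x))"
  unfolding bsub_def by (intro polytime_intros polytime_ripple)

lemma polytime_bless [polytime_intros]:
  "polytime_on D f \<Longrightarrow> polytime_on D g \<Longrightarrow> polytime_on D (\<lambda>x. bless (f x) (g x))"
  unfolding bless_def by (intro polytime_intros polytime_ripple)

section \<open>Multiplication and long division\<close>

definition bmul :: "bool list \<Rightarrow> bool list \<Rightarrow> bool list" where
  "bmul xs ys = foldl (\<lambda>a y. badd (False # a) (if y then xs else [])) [] (rev ys)"

text \<open>Horner's scheme, starting from the most significant digit. The length claim is the one
  needed for polynomial time: one operand of each \<open>badd\<close> is \<open>xs\<close> or empty,
  so every round adds at most \<open>length xs + 2\<close> digits.\<close>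

lemma foldl_bmul:
  "bval (foldl (\<lambda>a y. badd (False # a) (if y then xs else [])) b (rev ys)) =
     bval b * 2 ^ length ys + bval xs * bval ys \<and>
   length (foldl (\<lambda>a y. badd (False # a) (if y then xs else [])) b (rev ys)) \<le> length b + length ys * (length xs + 2)"
  by (induction ys) (auto simp: bval_badd length_badd algebra_simps)

lemma bval_bmul: "bval (bmul xs ys) = bval xs * bval ys"
  using foldl_bmul[of xs "[]" ys] by (simp add: bmul_def)

lemma polytime_bmul [polytime_intros]:
  assumes "polytime_on D f" "polytime_on D g"
  shows "polytime_on D (\<lambda>x. bmul (f x) (g x))"
proof (rule polytime_comp2[OF _ assms])
  let ?h = "\<lambda>p a y. badd (False # a) (if y then fst p else [])"
  show "polytime (\<lambda>p. bmul (fst p) (snd p))"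
    unfolding bmul_def
  proof (rule polytime_foldl[where g = ?h])
    show "poly_bounded (\<lambda>n. 1 + 4 * (n * (n + 2)))" by (intro poly_bounded_intros)
    fix x :: "bool list \<times> bool list" and i
    let ?y = "rev (take i (rev (snd x)))"
    have "length (foldl (?h x) [] (rev ?y)) \<le> length ?y * (length (fst x) + 2)"
      using foldl_bmul[of "fst x" "[]" ?y] by simp
    also have "\<dots> \<le> sz x * (sz x + 2)"
      using length_less_sz[of "fst x"] length_less_sz[of "snd x"] sz_fst_snd[of x]
      by (intro mult_mono) auto
    finally show "sz (foldl (?h x) [] (take i (rev (snd x)))) \<le> 1 + 4 * (sz x * (sz x + 2))"
      using sz_bools[of "foldl (?h x) [] (take i (rev (snd x)))"] by simp
  qed (intro polytime_intros)+
qed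

definition bdivmod_step :: "bool list \<Rightarrow> bool list \<times> bool list \<Rightarrow> bool \<Rightarrow> bool list \<times> bool list" where
  "bdivmod_step d p x = (if bless (x # snd p) d then (False # fst p, x # snd p)
     else (True # fst p, bsub (x # snd p) d))"

definition bdivmod :: "bool list \<Rightarrow> bool list \<Rightarrow> bool list \<times> bool list" where
  "bdivmod xs d = foldl (bdivmod_step d) ([], []) (rev xs)"

text \<open>A remainder below \<open>d\<close> stays below \<open>2 * d\<close> when the next digit
  is appended, so subtracting \<open>d\<close> at most once restores the invariant and yields one
  digit of the quotient.\<close>

lemma bdivmod_step_correct:
  assumes "p' = bdivmod_step d p x" "bval (snd p) < bval d"
  shows "bval (fst p') * bval d + bval (snd p') = of_bool x + 2 * (bval (fst p) * bval d + bval (snd p)) \<and>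
    bval (snd p') < bval d"
proof (cases "bless (x # snd p) d")
  case True
  then show ?thesis using assms by (auto simp: bdivmod_step_def bless_iff)
next
  case False
  then have le: "bval d \<le> bval (x # snd p)" by (simp add: bless_iff)
  have "bval (snd p') = bval (x # snd p) - bval d" "bval (fst p') = 1 + 2 * bval (fst p)"
    using False bval_bsub[OF le] assms by (simp_all add: bdivmod_step_def)
  then show ?thesis using le assms(2) by (auto simp: algebra_simps of_bool_def split: if_splits)
qed

lemma foldl_bdivmod:
  assumes "0 < bval d"
  shows "bval (fst (bdivmod xs d)) * bval d + bval (snd (bdivmod xs d)) = bval xs \<and>
    bval (snd (bdivmod xs d)) < bval d"
  unfolding bdivmod_def
proof (induction xs)
  case (Cons x xs)
  have "foldl (bdivmod_step d) ([], []) (rev (x # xs)) = bdivmod_step d (foldl (bdivmod_step d) ([], []) (rev xs)) x"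
    by simp
  from bdivmod_step_correct[OF this] show ?case using Cons by auto
qed (use assms in simp)

lemma bval_bdivmod:
  assumes "0 < bval d"
  shows "bval (fst (bdivmod xs d)) = bval xs div bval d" "bval (snd (bdivmod xs d)) = bval xs mod bval d"
proof -
  show "bval (fst (bdivmod xs d)) = bval xs div bval d"
    using foldl_bdivmod[OF assms, of xs] by (metis div_mult_self3 div_less assms add.right_neutral less_not_refl)
  show "bval (snd (bdivmod xs d)) = bval xs mod bval d"
    using foldl_bdivmod[OF assms, of xs] by (metis mod_mult_self3 mod_less)
qed

lemma length_foldl_bdivmod:
  "length (fst (foldl (bdivmod_step d) p ys)) = length (fst p) + length ys \<and>
   length (snd (foldl (bdivmod_step d) p ys)) = length (snd p) + length ys"
  by (induction ys arbitrary: p) (auto simp: bdivmod_step_def)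

lemma length_bdivmod [simp]:
  "length (fst (bdivmod xs d)) = length xs" "length (snd (bdivmod xs d)) = length xs"
  using length_foldl_bdivmod[of d "([], [])" "rev xs"] by (simp_all add: bdivmod_def)

lemma polytime_bdivmod [polytime_intros]:
  assumes "polytime_on D f" "polytime_on D g"
  shows "polytime_on D (\<lambda>x. bdivmod (f x) (g x))"
proof (rule polytime_comp2[OF _ assms])
  show "polytime (\<lambda>p. bdivmod (fst p) (snd p))"
    unfolding bdivmod_def
  proof (rule polytime_foldl[where g = "\<lambda>p. bdivmod_step (snd p)"])
    show "polytime (\<lambda>p. bdivmod_step (snd (fst p)) (fst (snd p)) (snd (snd p)))"
      for p :: "(bool list \<times> bool list) \<times> (bool list \<times> bool list) \<times> bool"
      unfolding bdivmod_step_def by (intro polytime_intros)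
    show "poly_bounded (\<lambda>n. 3 + 8 * n)" by (intro poly_bounded_intros)
    fix x :: "bool list \<times> bool list" and i
    let ?r = "foldl (bdivmod_step (snd x)) ([], []) (take i (rev (fst x)))"
    have "length (fst ?r) \<le> sz x" "length (snd ?r) \<le> sz x"
      using length_foldl_bdivmod[of "snd x" "([], [])" "take i (rev (fst x))"]
        length_less_sz[of "fst x"] sz_fst_snd[of x] by auto
    then show "sz ?r \<le> 3 + 8 * sz x"
      using sz_bools[of "fst ?r"] sz_bools[of "snd ?r"] sz_fst_snd[of ?r] by simp
  qed (intro polytime_intros)+
qed

section \<open>Euclid's algorithm\<close>

definition euclid_step :: "nat \<times> nat \<Rightarrow> nat \<times> nat" where
  "euclid_step p = (if snd p = 0 then p else (snd p, fst p mod snd p))"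

text \<open>For \<open>b \<le> a\<close> and \<open>b > 0\<close>, the remainder is at most half of
  \<open>a\<close>, so each step at least halves the product of the two numbers. The number of steps
  is therefore linear in the number of digits.\<close>

lemma euclid_product:
  "b \<le> a \<Longrightarrow> a * b < 2 ^ n \<Longrightarrow> snd ((euclid_step ^^ n) (a, b)) = 0"
proof (induction n arbitrary: a b)
  case 0
  then show ?case by auto
next
  case (Suc n)
  show ?case
  proof (cases "b = 0")
    case True
    then have "euclid_step (a, b) = (a, b)" by (simp add: euclid_step_def)
    then have "(euclid_step ^^ Suc n) (a, b) = (euclid_step ^^ n) (a, b)"
      by (simp only: funpow_Suc_right comp_apply)
    then show ?thesis using Suc.IH[of b a] Suc.prems True by simp
  next
    case False
    have "1 \<le> a div b" using Suc.prems(1) False by (simp add: div_greater_zero_iff Suc_le_eq)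
    then have "b + a mod b \<le> a" using div_mult_mod_eq[of a b] mult_le_mono1[of 1 "a div b" b] by linarith
    moreover have m: "a mod b < b" using False by simp
    ultimately have "2 * (a mod b) \<le> a" by linarith
    then have "2 * (b * (a mod b)) \<le> a * b" using mult_le_mono1[of "2 * (a mod b)" a b] by (simp add: mult.commute mult.left_commute)
    then have "b * (a mod b) < 2 ^ n" using Suc.prems(2) unfolding power_Suc by linarith
    then have "snd ((euclid_step ^^ n) (b, a mod b)) = 0" using Suc.IH[of "a mod b" b] m by simp
    moreover have "euclid_step (a, b) = (b, a mod b)" using False by (simp add: euclid_step_def)
    then have "(euclid_step ^^ Suc n) (a, b) = (euclid_step ^^ n) (b, a mod b)"
      by (simp only: funpow_Suc_right comp_apply)
    ultimately show ?thesis by simp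
  qed
qed

lemma euclid_gcd: "gcd (fst ((euclid_step ^^ n) p)) (snd ((euclid_step ^^ n) p)) = gcd (fst p) (snd p)"
proof (induction n)
  case (Suc n)
  have "gcd (fst (euclid_step q)) (snd (euclid_step q)) = gcd (fst q) (snd q)" for q
    by (simp add: euclid_step_def gcd_red_nat[symmetric] gcd.commute)
  then show ?case using Suc by simp
qed simp

text \<open>The additional step in \<open>n < m\<close> brings the two numbers into the order that
  \<open>euclid_product\<close> requires.\<close>

lemma euclid_terminates:
  assumes "a * b < 2 ^ n" "n < m"
  shows "fst ((euclid_step ^^ m) (a, b)) = gcd a b"
proof -
  let ?p = "euclid_step (a, b)"
  have "snd ?p \<le> fst ?p" "fst ?p * snd ?p \<le> a * b"
    using mod_less_divisor[of b a] mult_le_mono[OF mod_less_eq_dividend[of a b] order_refl, of b]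
    by (auto simp: euclid_step_def mult.commute intro: less_imp_le)
  moreover have "(2::nat) ^ n \<le> 2 ^ (m - 1)" using assms(2) by (intro power_increasing) auto
  ultimately have "snd ((euclid_step ^^ (m - 1)) (fst ?p, snd ?p)) = 0"
    using assms(1) by (intro euclid_product) linarith+
  then have "snd ((euclid_step ^^ m) (a, b)) = 0"
    using assms(2) by (metis comp_apply funpow_Suc_right gr_implies_not0 Suc_diff_1 not_gr0 prod.collapse)
  then show ?thesis using euclid_gcd[of m "(a, b)"] by simp
qed

definition bgcd_step :: "bool list \<times> bool list \<Rightarrow> bool list \<times> bool list" where
  "bgcd_step p = (if \<exists>y\<in>set (snd p). y then (snd p, snd (bdivmod (fst p) (snd p))) else p)"

definition bgcd :: "bool list \<Rightarrow> bool list \<Rightarrow> bool list" where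
  "bgcd xs ys = fst ((bgcd_step ^^ Suc (length xs + length ys)) (xs, ys))"

lemma bgcd_step_euclid: "map_prod bval bval (bgcd_step p) = euclid_step (map_prod bval bval p)"
proof (cases "bval (snd p) = 0")
  case True
  then show ?thesis by (auto simp: bgcd_step_def euclid_step_def bval_eq_0)
next
  case False
  then have "\<exists>y\<in>set (snd p). y" by (simp add: bval_eq_0)
  with False show ?thesis using bval_bdivmod[of "snd p"]
    by (simp add: bgcd_step_def euclid_step_def map_prod_def split_beta)
qed

lemma bval_bgcd: "bval (bgcd xs ys) = gcd (bval xs) (bval ys)"
proof -
  have *: "map_prod bval bval ((bgcd_step ^^ n) p) = (euclid_step ^^ n) (map_prod bval bval p)" for n p
    by (induction n) (simp_all add: bgcd_step_euclid)
  have "bval xs * bval ys < 2 ^ (length xs + length ys)"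
    unfolding power_add using bval_less by (intro mult_strict_mono) auto
  from euclid_terminates[OF this, of "Suc (length xs + length ys)"]
  show ?thesis
    using arg_cong[OF *[of "Suc (length xs + length ys)" "(xs, ys)"], of fst]
    by (simp only: bgcd_def fst_map_prod map_prod_simp lessI)
qed

lemma length_bgcd_steps:
  "length (fst p) \<le> m \<Longrightarrow> length (snd p) \<le> m \<Longrightarrow>
   length (fst ((bgcd_step ^^ n) p)) \<le> m \<and> length (snd ((bgcd_step ^^ n) p)) \<le> m"
  by (induction n) (auto simp: bgcd_step_def)

lemma polytime_bgcd [polytime_intros]:
  assumes "polytime_on D f" "polytime_on D g"
  shows "polytime_on D (\<lambda>x. bgcd (f x) (g x))"
proof (rule polytime_comp2[OF _ assms])
  have "polytime (\<lambda>p. (bgcd_step ^^ Suc (length (fst p) + length (snd p))) (fst p, snd p))"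
  proof (rule polytime_funpow[where f = "\<lambda>x. bgcd_step"])
    show "polytime (\<lambda>p. bgcd_step (snd p))" for p :: "(bool list \<times> bool list) \<times> bool list \<times> bool list"
      unfolding bgcd_step_def by (intro polytime_intros)
    show "poly_bounded (\<lambda>n. 3 + 8 * n)" by (intro poly_bounded_intros)
    fix x :: "bool list \<times> bool list" and i
    let ?r = "(bgcd_step ^^ i) (fst x, snd x)"
    have "length (fst ?r) \<le> sz x" "length (snd ?r) \<le> sz x"
      using length_bgcd_steps[of "(fst x, snd x)" "sz x" i]
        length_less_sz[of "fst x"] length_less_sz[of "snd x"] sz_fst_snd[of x] by auto
    then show "sz ?r \<le> 3 + 8 * sz x"
      using sz_bools[of "fst ?r"] sz_bools[of "snd ?r"] sz_fst_snd[of ?r] by simp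
  qed (intro polytime_intros)+
  then show "polytime (\<lambda>p. bgcd (fst p) (snd p))"
    unfolding bgcd_def by (rule polytime_fst)
qed

text \<open>The most significant digit comes last. Reading from the end drops leading zeros until
  the first \<open>True\<close>, which gives the canonical digits produced by
  \<open>binary\<close>.\<close>

definition bnorm :: "bool list \<Rightarrow> bool list" where
  "bnorm xs = foldl (\<lambda>a x. if a = [] \<and> \<not> x then [] else x # a) [] (rev xs)"

lemma bnorm_binary: "bnorm xs = binary (bval xs)"
proof (induction xs)
  case Nil
  show ?case by (simp add: bnorm_def binary.simps)
next
  case (Cons x xs)
  have "bnorm (x # xs) = (if bnorm xs = [] \<and> \<not> x then [] else x # bnorm xs)"
    by (simp add: bnorm_def)
  also have "\<dots> = binary (bval (x # xs))"
    unfolding Cons using binary.simps[of "bval xs"] binary.simps[of "bval (x # xs)"]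
    by (cases x) (auto split: if_splits)
  finally show ?case .
qed

lemma polytime_bnorm [polytime_intros]:
  assumes "polytime_on D f"
  shows "polytime_on D (\<lambda>x. bnorm (f x))"
proof (rule polytime_comp[OF _ assms])
  show "polytime bnorm"
    unfolding bnorm_def
    by (rule polytime_foldl_add[where g = "\<lambda>_ a x. if a = [] \<and> \<not> x then [] else x # a" and q = "\<lambda>n. n + 1"])
       (auto intro!: polytime_intros poly_bounded_intros)
qed

lemma bval_binary: "bval (binary n) = n"
proof (induction n rule: less_induct)
  case (less n)
  show ?case
  proof (cases "n = 0")
    case False
    then have "bval (binary (n div 2)) = n div 2" using less[of "n div 2"] by simp
    then show ?thesis using False by (subst binary.simps) (simp add: mod2_eq_if[symmetric] of_bool_odd_eq_mod_2)
  qed (simp add: binary.simps)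
qed

text \<open>Fractions are pairs of numerator and denominator. The subtraction of the numerators is truncated,
  so the result is meaningful only if \<open>q\<close> does not exceed \<open>p\<close>.\<close>

definition bdiff :: "(bool list \<times> bool list) \<Rightarrow> (bool list \<times> bool list) \<Rightarrow> bool list \<times> bool list" where
  "bdiff p q = (let n = bsub (bmul (fst p) (snd q)) (bmul (fst q) (snd p)); d = bmul (snd p) (snd q); g = bgcd n d
     in (bnorm (fst (bdivmod n g)), bnorm (fst (bdivmod d g))))"

definition bfrac :: "bool list \<times> bool list \<Rightarrow> rat" where
  "bfrac p = of_nat (bval (fst p)) / of_nat (bval (snd p))"

lemma polytime_bdiff [polytime_intros]:
  "polytime_on D f \<Longrightarrow> polytime_on D g \<Longrightarrow> polytime_on D (\<lambda>x. bdiff (f x) (g x))"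
  unfolding bdiff_def Let_def by (intro polytime_intros)

lemma bval_bdiff:
  assumes "0 < bval (snd p)" "0 < bval (snd q)" "bfrac q \<le> bfrac p"
    and "n = bval (fst p) * bval (snd q) - bval (fst q) * bval (snd p)" "d = bval (snd p) * bval (snd q)"
  shows "bdiff p q = (binary (n div gcd n d), binary (d div gcd n d))"
    "bfrac p - bfrac q = of_nat n / of_nat d"
proof -
  have le: "bval (fst q) * bval (snd p) \<le> bval (fst p) * bval (snd q)"
  proof -
    have "rat_of_nat (bval (fst q)) * of_nat (bval (snd p)) \<le> of_nat (bval (fst p)) * of_nat (bval (snd q))"
      using assms by (simp add: bfrac_def field_simps)
    then show ?thesis by (simp only: of_nat_mult[symmetric] of_nat_le_iff)
  qed
  define ns ds where "ns = bsub (bmul (fst p) (snd q)) (bmul (fst q) (snd p))" and "ds = bmul (snd p) (snd q)"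
  have n: "bval ns = n"
    unfolding ns_def assms(4) using le by (subst bval_bsub) (simp_all add: bval_bmul)
  have d: "bval ds = d" by (simp add: ds_def assms(5) bval_bmul)
  have "0 < bval (bgcd ns ds)" using assms by (simp add: bval_bgcd d)
  then show "bdiff p q = (binary (n div gcd n d), binary (d div gcd n d))"
    by (simp add: bdiff_def Let_def ns_def[symmetric] ds_def[symmetric] bnorm_binary bval_bdivmod bval_bgcd n d)
  show "bfrac p - bfrac q = of_nat n / of_nat d"
    using assms(1,2) le by (simp add: bfrac_def assms(4,5) of_nat_diff field_simps)
qed

text \<open>The capital tape displays the capital in lowest terms and with canonical digits, and the
  game may read it. The computed fraction must therefore be this normal form literally; an equal
  rational number would not do.\<close>

lemma quotient_of_bdiff:
  assumes "0 < bval (snd p)" "0 < bval (snd q)" "bfrac q \<le> bfrac p"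
  shows "quotient_of (bfrac p - bfrac q) = (int (bval (fst (bdiff p q))), int (bval (snd (bdiff p q))))"
    "fst (bdiff p q) = binary (bval (fst (bdiff p q)))" "snd (bdiff p q) = binary (bval (snd (bdiff p q)))"
proof -
  define n d where "n = bval (fst p) * bval (snd q) - bval (fst q) * bval (snd p)" and "d = bval (snd p) * bval (snd q)"
  note v = bval_bdiff[OF assms n_def d_def]
  have "0 < d" using assms by (simp add: d_def)
  have "bfrac p - bfrac q = Fract (int n) (int d)"
    unfolding v(2) by (simp add: Fract_of_int_quotient)
  then have "quotient_of (bfrac p - bfrac q) = Rat.normalize (int n, int d)"
    by (simp add: quotient_of_Fract)
  also have "\<dots> = (int (n div gcd n d), int (d div gcd n d))"
    using \<open>0 < d\<close> by (simp add: Rat.normalize_def Let_def zdiv_int gcd_int_int_eq)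
  finally show "quotient_of (bfrac p - bfrac q) = (int (bval (fst (bdiff p q))), int (bval (snd (bdiff p q))))"
    by (simp add: v(1) bval_binary)
  show "fst (bdiff p q) = binary (bval (fst (bdiff p q)))" "snd (bdiff p q) = binary (bval (snd (bdiff p q)))"
    by (simp_all add: v(1) bval_binary)
qed

lemma length_binary: "n < 2 ^ k \<Longrightarrow> length (binary n) \<le> k"
proof (induction k arbitrary: n)
  case 0
  then show ?case by (simp add: binary.simps)
next
  case (Suc k)
  show ?case
  proof (cases "n = 0")
    case False
    have "n div 2 < 2 ^ k" using Suc.prems by (simp add: less_mult_imp_div_less mult.commute)
    then show ?thesis using Suc.IH False by (subst binary.simps) simp
  qed (simp add: binary.simps)
qed

text \<open>Truncated subtraction does not exceed the minuend and cancelling only shrinks a number.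
  Hence both parts grow by no more digits than the denominator of \<open>q\<close> has, however long
  its numerator is.\<close>

lemma length_bdiff:
  assumes "0 < bval (snd p)" "0 < bval (snd q)" "bfrac q \<le> bfrac p"
  shows "length (fst (bdiff p q)) \<le> length (fst p) + length (snd q)"
    "length (snd (bdiff p q)) \<le> length (snd p) + length (snd q)"
proof -
  define n d where "n = bval (fst p) * bval (snd q) - bval (fst q) * bval (snd p)" and "d = bval (snd p) * bval (snd q)"
  have prod: "bval xs * bval ys < 2 ^ (length xs + length ys)" for xs ys
    unfolding power_add using bval_less by (intro mult_strict_mono) auto
  show "length (fst (bdiff p q)) \<le> length (fst p) + length (snd q)"
    unfolding bval_bdiff(1)[OF assms n_def d_def] fst_conv
    using prod[of "fst p" "snd q"] div_le_dividend[of n "gcd n d"] diff_le_self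
    by (intro length_binary) (metis le_less_trans n_def)
  show "length (snd (bdiff p q)) \<le> length (snd p) + length (snd q)"
    unfolding bval_bdiff(1)[OF assms n_def d_def] snd_conv
    using prod[of "snd p" "snd q"] div_le_dividend[of d "gcd n d"]
    by (intro length_binary) (metis le_less_trans d_def)
qed

section \<open>Simulating machines in polynomial time\<close>

lemma polytime_int_view: "polytime_on D f \<Longrightarrow> polytime_on D (\<lambda>x. (0 \<le> f x, nat (if 0 \<le> f x then f x else - f x - 1)))"
  by (erule polytime_on_recode) (simp add: enc_int_def)

lemma polytime_of_nat [polytime_intros]:
  assumes "polytime_on D f"
  shows "polytime_on D (\<lambda>x. int (f x))"
  by (rule polytime_on_recode[OF polytime_Pair[OF polytime_const[of D True] assms]]) (simp add: enc_int_def)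

lemma polytime_int_inc [polytime_intros]:
  assumes "polytime_on D f"
  shows "polytime_on D (\<lambda>x. f x + 1 :: int)"
proof -
  let ?v = "\<lambda>x. (0 \<le> f x, nat (if 0 \<le> f x then f x else - f x - 1))"
  have "polytime_on D (\<lambda>x. if fst (?v x) then (True, Suc (snd (?v x)))
      else (case snd (?v x) of 0 \<Rightarrow> (True, 0) | Suc n \<Rightarrow> (False, n)))"
    by (intro polytime_intros polytime_int_view assms)
  then show ?thesis
    by (rule polytime_on_recode) (auto simp: enc_int_def nat_add_distrib split: nat.splits intro!: arg_cong[of _ _ enc])
qed

lemma polytime_int_dec [polytime_intros]:
  assumes "polytime_on D f"
  shows "polytime_on D (\<lambda>x. f x - 1 :: int)"
proof -
  let ?v = "\<lambda>x. (0 \<le> f x, nat (if 0 \<le> f x then f x else - f x - 1))"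
  have "polytime_on D (\<lambda>x. if fst (?v x) then (case snd (?v x) of 0 \<Rightarrow> (False, 0) | Suc n \<Rightarrow> (True, n))
      else (False, Suc (snd (?v x))))"
    by (intro polytime_intros polytime_int_view assms)
  then show ?thesis
    by (rule polytime_on_recode) (auto simp: enc_int_def split: nat.splits intro!: arg_cong[of _ _ enc])
qed

lemma polytime_shift [polytime_intros]:
  assumes "polytime_on D f" "polytime_on D g"
  shows "polytime_on D (\<lambda>x. shift (f x) (g x))"
proof -
  have "shift d i = (if d = Lft then i - 1 else if d = Rgt then i + 1 else i)" for d i
    by (cases d) auto
  then show ?thesis using assms by (simp only:) (intro polytime_intros)
qed

lemma polytime_zip [polytime_intros]:
  assumes "polytime_on D f" "polytime_on D g"
  shows "polytime_on D (\<lambda>x. zip (f x) (g x))"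
proof -
  define h :: "('b \<times> 'c) list \<times> 'c list \<Rightarrow> 'b \<Rightarrow> ('b \<times> 'c) list \<times> 'c list"
    where "h = (\<lambda>p x. case snd p of [] \<Rightarrow> p | y # ys \<Rightarrow> ((x, y) # fst p, ys))"
  have h: "fst (foldl h (a, ys) xs) = rev (zip xs ys) @ a" for a xs ys
  proof (induction xs arbitrary: a ys)
    case (Cons x xs)
    show ?case
    proof (cases ys)
      case Nil
      have "foldl h (a, []) zs = (a, [])" for zs by (induction zs) (simp_all add: h_def)
      then show ?thesis using Nil by (simp add: h_def)
    next
      case (Cons y zs)
      then show ?thesis using Cons.IH[of "(x, y) # a" zs] by (simp add: h_def)
    qed
  qed simp
  have "polytime_on D (\<lambda>x. foldl h ([], g x) (f x))"
    by (rule polytime_foldl_add[where g = "\<lambda>_. h" and q = "\<lambda>n. n + 2"])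
       (unfold h_def, (intro polytime_intros assms poly_bounded_intros; fail)+, auto split: list.splits)
  then have "polytime_on D (\<lambda>x. rev (fst (foldl h ([], g x) (f x))))" by (intro polytime_intros)
  then show ?thesis by (simp add: h)
qed

subsection \<open>Tapes\<close>

text \<open>A tape is represented by the history of its write operations, latest first, and the head position.\<close>

type_synonym rtape = "(int \<times> symbol) list \<times> int"

primrec lookup :: "(int \<times> symbol) list \<Rightarrow> int \<Rightarrow> symbol" where
  "lookup [] i = Blank"
| "lookup (w # ws) i = (if fst w = i then snd w else lookup ws i)"

definition abs_tape :: "rtape \<Rightarrow> tape" where
  "abs_tape r = (lookup (fst r), snd r)"

definition rscan :: "rtape \<Rightarrow> symbol" where
  "rscan r = lookup (fst r) (snd r)"

definition rupdate :: "symbol \<times> direction \<Rightarrow> rtape \<Rightarrow> rtape" where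
  "rupdate w r = ((snd r, fst w) # fst r, shift (snd w) (snd r))"

definition rtape_of :: "symbol list \<Rightarrow> rtape" where
  "rtape_of ss = (fst (foldl (\<lambda>p s. ((snd p, s) # fst p, snd p + 1)) ([], 0) ss), 0)"

lemma scanned_abs [simp]: "scanned (abs_tape r) = rscan r"
  by (simp add: scanned_def abs_tape_def rscan_def)

lemma update_abs: "update_tape w (abs_tape r) = abs_tape (rupdate w r)"
  by (auto simp: update_tape_def abs_tape_def rupdate_def)

lemma foldl_rtape_of:
  assumes "p = foldl (\<lambda>p s. ((snd p, s) # fst p, snd p + 1)) (ws, n) ss"
  shows "snd p = n + int (length ss)" "length (fst p) = length ws + length ss"
    "lookup (fst p) i = (if n \<le> i \<and> i < n + int (length ss) then ss ! nat (i - n) else lookup ws i)"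
    "set (fst p) \<subseteq> set ws \<union> {n..n + int (length ss)} \<times> set ss"
  unfolding assms
proof (induction ss rule: rev_induct)
  case (snoc s ss)
  let ?p = "foldl (\<lambda>p s. ((snd p, s) # fst p, snd p + 1)) (ws, n) ss"
  { case 1 show ?case using snoc(1) by simp }
  { case 2 show ?case using snoc(2) by simp }
  { case 3
    have "lookup (fst (foldl (\<lambda>p s. ((snd p, s) # fst p, snd p + 1)) (ws, n) (ss @ [s]))) i =
       (if n + int (length ss) = i then s else lookup (fst ?p) i)" using snoc(1) by simp
    then show ?case using snoc(3) by (auto simp: nth_append) }
  { case 4 show ?case using snoc(4,1) by auto }
qed auto

lemma abs_rtape_of: "abs_tape (rtape_of ss) = tape_of ss"
proof
  show "snd (abs_tape (rtape_of ss)) = snd (tape_of ss)" by (simp add: abs_tape_def rtape_of_def tape_of_def)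
  show "fst (abs_tape (rtape_of ss)) = fst (tape_of ss)"
    by (rule ext) (simp add: abs_tape_def rtape_of_def tape_of_def foldl_rtape_of(3)[OF refl])
qed

lemma abs_blank: "abs_tape ([], 0) = blank_tape"
  using abs_rtape_of[of "[]"] by (simp add: rtape_of_def)

lemma polytime_lookup [polytime_intros]:
  assumes "polytime_on D f" "polytime_on D g"
  shows "polytime_on D (\<lambda>x. lookup (f x) (g x))"
proof (rule polytime_comp2[OF _ assms])
  have l: "foldl (\<lambda>a y. if fst y = i then snd y else a) Blank (rev ws) = lookup ws i" for i :: int and ws
    by (induction ws) auto
  have "polytime (\<lambda>p :: (int \<times> symbol) list \<times> int. foldl (\<lambda>a y. if fst y = snd p then snd y else a) Blank (rev (fst p)))"
    by (rule polytime_foldl_add[where g = "\<lambda>p a y. if fst y = snd p then snd y else a" and q = "\<lambda>n. n"])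
       (auto intro!: polytime_intros poly_bounded_intros)
  then show "polytime (\<lambda>p. lookup (fst p) (snd p))" by (simp add: l)
qed

lemma polytime_rscan [polytime_intros]: "polytime_on D f \<Longrightarrow> polytime_on D (\<lambda>x. rscan (f x))"
  unfolding rscan_def by (intro polytime_intros)

lemma polytime_rupdate [polytime_intros]:
  "polytime_on D f \<Longrightarrow> polytime_on D g \<Longrightarrow> polytime_on D (\<lambda>x. rupdate (f x) (g x))"
  unfolding rupdate_def by (intro polytime_intros)

lemma polytime_rtape_of [polytime_intros]:
  assumes "polytime_on D f"
  shows "polytime_on D (\<lambda>x. rtape_of (f x))"
proof (rule polytime_comp[OF _ assms])
  let ?g = "\<lambda>(p :: (int \<times> symbol) list \<times> int) s. ((snd p, s) # fst p, snd p + 1)"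
  have "polytime (\<lambda>ss. foldl ?g ([], 0) ss)"
  proof (rule polytime_foldl[where g = "\<lambda>_. ?g"])
    let ?b = "\<lambda>n::nat. Suc ((1 + n * Suc (Suc (5 + 2 * n + n))) + (5 + 2 * n))"
    show "poly_bounded ?b" by (intro poly_bounded_intros)
    fix ss :: "symbol list" and i
    let ?p = "foldl ?g ([], 0) (take i ss)"
    note p = foldl_rtape_of[OF refl, of "[]" 0 "take i ss"]
    have l: "length (take i ss) \<le> sz ss" using length_less_sz[of ss] by simp
    have "sz y \<le> Suc (5 + 2 * sz ss + sz ss)" if "y \<in> set (fst ?p)" for y
    proof -
      have y: "fst y \<in> {0..int (length (take i ss))}" "snd y \<in> set ss"
        using p(4) that set_take_subset[of i ss] by (auto simp: mem_Times_iff dest!: subsetD)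
      have "nat \<bar>fst y\<bar> \<le> sz ss" using y(1) l by auto
      then show ?thesis using sz_int[of "fst y"] sz_in_list[OF y(2)] sz_fst_snd[of y] by simp
    qed
    then have "sz (fst ?p) \<le> 1 + length (fst ?p) * Suc (Suc (5 + 2 * sz ss + sz ss))" by (rule sz_list_le)
    also have "\<dots> \<le> 1 + sz ss * Suc (Suc (5 + 2 * sz ss + sz ss))"
      using p(2) l by (intro add_mono mult_le_mono) auto
    finally show "sz ?p \<le> ?b (sz ss)"
      using sz_int[of "snd ?p"] p(1) l sz_fst_snd[of ?p] by auto
  qed (intro polytime_intros)+
  then show "polytime rtape_of" unfolding rtape_of_def by (intro polytime_intros)
qed

definition rblock_step :: "(symbol \<Rightarrow> bool) \<Rightarrow> (int \<times> symbol) list \<Rightarrow> symbol list \<times> nat \<Rightarrow> symbol list \<times> nat" where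
  "rblock_step P ws p = (if P (lookup ws (int (snd p))) then (lookup ws (int (snd p)) # fst p, Suc (snd p)) else p)"

definition rblock :: "(symbol \<Rightarrow> bool) \<Rightarrow> (int \<times> symbol) list \<Rightarrow> symbol list" where
  "rblock P ws = rev (fst ((rblock_step P ws ^^ length ws) ([], 0)))"

lemma lookup_Blank: "i \<notin> fst ` set ws \<Longrightarrow> lookup ws i = Blank"
  by (induction ws) auto

lemma lookup_in: "lookup ws i \<in> insert Blank (snd ` set ws)"
  by (induction ws) auto

text \<open>A cell that was never written is blank, so every cell of a block satisfying
  \<open>P\<close> occurs among the writes. The block therefore ends, and as many rounds as there
  are writes suffice to read it.\<close>

lemma block_bound:
  assumes "\<not> P Blank"
  shows "\<exists>n. \<not> P (lookup ws (int n))" "(LEAST n. \<not> P (lookup ws (int n))) \<le> length ws"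
proof -
  have in_keys: "int n \<in> fst ` set ws" if "P (lookup ws (int n))" for n
    using that assms lookup_Blank by metis
  have *: "m \<le> length ws" if "\<And>n. n < m \<Longrightarrow> P (lookup ws (int n))" for m
  proof -
    have "int ` {..<m} \<subseteq> fst ` set ws" using that in_keys by auto
    then have "card (int ` {..<m}) \<le> card (fst ` set ws)" by (intro card_mono) auto
    also have "\<dots> \<le> length ws" using card_image_le card_length le_trans by blast
    finally show ?thesis by (simp add: card_image)
  qed
  show "\<exists>n. \<not> P (lookup ws (int n))" using *[of "Suc (length ws)"] by auto
  show "(LEAST n. \<not> P (lookup ws (int n))) \<le> length ws"
    by (rule *) (use not_less_Least in blast)
qed

lemma rblock_steps:
  assumes "\<not> P Blank" "N = (LEAST n. \<not> P (lookup ws (int n)))"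
  shows "(rblock_step P ws ^^ i) ([], 0) = (rev (map (\<lambda>j. lookup ws (int j)) [0..<min i N]), min i N)"
proof (induction i)
  case (Suc i)
  have N: "\<not> P (lookup ws (int N))" unfolding assms(2) using block_bound(1)[of P, OF assms(1)] by (rule LeastI_ex)
  have "P (lookup ws (int i))" if "i < N" using that not_less_Least unfolding assms(2) by blast
  with N Suc show ?case by (cases "i < N") (auto simp: rblock_step_def min_def)
qed simp

lemma block_abs:
  assumes "\<not> P Blank"
  shows "block P (abs_tape r) = rblock P (fst r)"
  using block_bound(2)[of P, OF assms, of "fst r"] rblock_steps[of P _ "fst r" "length (fst r)", OF assms refl]
  by (simp add: block_def rblock_def abs_tape_def min_absorb2)

lemma length_rblock: "\<not> P Blank \<Longrightarrow> length (rblock P ws) \<le> length ws"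
  using rblock_steps[of P _ ws "length ws"] by (simp add: rblock_def)

lemma polytime_rblock:
  assumes P: "polytime P" "\<not> P Blank" and "polytime_on D f"
  shows "polytime_on D (\<lambda>x. rblock P (f x))"
proof (rule polytime_comp[OF _ assms(3)])
  have "polytime (\<lambda>ws. (rblock_step P ws ^^ length ws) ([], 0))"
  proof (rule polytime_funpow)
    show "polytime (\<lambda>p. rblock_step P (fst p) (snd p))"
      unfolding rblock_step_def by (intro polytime_intros polytime_comp[OF P(1)])
    let ?b = "\<lambda>n. Suc ((1 + n * Suc (sz Blank + n)) + (2 * n + 1))"
    show "poly_bounded ?b" by (intro poly_bounded_intros)
    fix ws :: "(int \<times> symbol) list" and i assume i: "i \<le> length ws"
    let ?N = "min i (LEAST n. \<not> P (lookup ws (int n)))"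
    let ?l = "rev (map (\<lambda>j. lookup ws (int j)) [0..<?N])"
    have n: "?N \<le> sz ws" using i length_less_sz[of ws] by simp
    have s: "sz (lookup ws j) \<le> sz Blank + sz ws" for j
      using lookup_in[of ws j] sz_in_list[of _ ws] sz_fst_snd by fastforce
    have "sz ?l \<le> 1 + length ?l * Suc (sz Blank + sz ws)"
      by (rule sz_list_le) (use s in auto)
    also have "\<dots> \<le> 1 + sz ws * Suc (sz Blank + sz ws)" using n by (intro add_mono mult_le_mono) auto
    finally show "sz ((rblock_step P ws ^^ i) ([], 0)) \<le> ?b (sz ws)"
      unfolding rblock_steps[of P, OF P(2) refl] using n by simp
  qed (intro polytime_intros)+
  then show "polytime (rblock P)" unfolding rblock_def by (intro polytime_intros)
qed

subsection \<open>Configurations\<close>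

type_synonym rconfig = "state \<times> rtape list"

definition represents :: "'c config_scheme \<Rightarrow> rconfig \<Rightarrow> bool" where
  "represents c rc \<longleftrightarrow> state c = fst rc \<and> tapes c = map abs_tape (snd rc)"

definition rperform :: "action \<Rightarrow> rconfig \<Rightarrow> rconfig" where
  "rperform a rc = (fst a, map (\<lambda>y. rupdate (fst y) (snd y)) (zip (snd a) (snd rc)))"

definition rsuccs :: "(state \<times> symbol list \<Rightarrow> action list) \<Rightarrow> rconfig \<Rightarrow> rconfig list" where
  "rsuccs tb rc = (if fst rc = Query \<or> fst rc = Accept \<or> fst rc = Reject then []
     else map (\<lambda>a. rperform a rc) (tb (fst rc, map rscan (snd rc))))"

text \<open>One number bounds the length of the history, the distance of the head and all addresses
  written. Each of these grows by at most one per step, so \<open>n\<close> behaves like a time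
  bound.\<close>

definition good_tape :: "symbol set \<Rightarrow> nat \<Rightarrow> rtape \<Rightarrow> bool" where
  "good_tape \<Gamma> n r \<longleftrightarrow> length (fst r) \<le> n \<and> nat \<bar>snd r\<bar> \<le> n \<and> (\<forall>y\<in>set (fst r). nat \<bar>fst y\<bar> \<le> n \<and> snd y \<in> \<Gamma>)"

definition good :: "'a machine_scheme \<Rightarrow> nat \<Rightarrow> rconfig \<Rightarrow> bool" where
  "good M n rc \<longleftrightarrow> fst rc \<in> states M \<and> length (snd rc) = tape_count M \<and> (\<forall>r\<in>set (snd rc). good_tape (alphabet M) n r)"

text \<open>The lists are free of repetitions so that determinism of the machine means lists of
  length at most 1.\<close>

definition is_table :: "'a machine_scheme \<Rightarrow> (state \<times> symbol list \<Rightarrow> action list) \<Rightarrow> bool" where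
  "is_table M tb \<longleftrightarrow> polytime tb \<and> (\<forall>q\<in>states M. \<forall>ss. length ss = tape_count M \<and> set ss \<subseteq> alphabet M \<longrightarrow>
     set (tb (q, ss)) = delta M q ss \<and> distinct (tb (q, ss)))"

lemma good_tape_mono: "good_tape \<Gamma> m r \<Longrightarrow> m \<le> n \<Longrightarrow> good_tape \<Gamma> n r"
  unfolding good_tape_def by (meson le_trans)

lemma good_mono: "good M m rc \<Longrightarrow> m \<le> n \<Longrightarrow> good M n rc"
  unfolding good_def using good_tape_mono by blast

lemma good_blank: "good_tape \<Gamma> n ([], 0)"
  by (simp add: good_tape_def)

lemma good_rtape_of: "set ss \<subseteq> \<Gamma> \<Longrightarrow> good_tape \<Gamma> (length ss) (rtape_of ss)"
  using foldl_rtape_of(2,4)[OF refl, of "[]" 0 ss] by (fastforce simp: good_tape_def rtape_of_def)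

lemma good_rupdate:
  assumes "good_tape \<Gamma> n r" "fst w \<in> \<Gamma>"
  shows "good_tape \<Gamma> (Suc n) (rupdate w r)"
proof -
  have "nat \<bar>shift d i\<bar> \<le> Suc n" if "nat \<bar>i\<bar> \<le> n" for d i using that by (cases d) auto
  then show ?thesis using assms by (fastforce simp: good_tape_def rupdate_def)
qed

lemma wf_delta:
  assumes "wf_machine M" "q \<in> states M" "length ss = tape_count M" "set ss \<subseteq> alphabet M" "a \<in> delta M q ss"
  shows "fst a \<in> states M" "length (snd a) = tape_count M" "fst ` set (snd a) \<subseteq> alphabet M"
proof -
  have "\<forall>(q', ws)\<in>delta M q ss. q' \<in> states M \<and> length ws = tape_count M \<and> fst ` set ws \<subseteq> alphabet M"
  proof -
    have "\<forall>q\<in>states M. \<forall>ss. length ss = tape_count M \<and> set ss \<subseteq> alphabet M \<longrightarrow>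
        (\<forall>(q', ws)\<in>delta M q ss. q' \<in> states M \<and> length ws = tape_count M \<and> fst ` set ws \<subseteq> alphabet M)"
      using assms(1) unfolding wf_machine_def by (elim conjE)
    from mp[OF spec[OF bspec[OF this assms(2)]] conjI[OF assms(3,4)]] show ?thesis .
  qed
  then have "case a of (q', ws) \<Rightarrow> q' \<in> states M \<and> length ws = tape_count M \<and> fst ` set ws \<subseteq> alphabet M"
    using assms(5) by blast
  then show "fst a \<in> states M" "length (snd a) = tape_count M" "fst ` set (snd a) \<subseteq> alphabet M"
    by (simp_all add: split_beta)
qed

lemma delta_finite:
  assumes "wf_machine M" "q \<in> states M" "length ss = tape_count M" "set ss \<subseteq> alphabet M"
  shows "finite (delta M q ss)"
proof -
  have "finite (UNIV :: direction set)"
  proof -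
    have "(UNIV :: direction set) = {Lft, Stay, Rgt}" using direction.exhaust by auto
    then show ?thesis by (metis finite.simps)
  qed
  then have "finite (states M \<times> {ws. set ws \<subseteq> alphabet M \<times> (UNIV :: direction set) \<and> length ws = tape_count M})"
    using assms(1) by (intro finite_cartesian_product finite_lists_length_eq) (auto simp: wf_machine_def)
  moreover have "delta M q ss \<subseteq> states M \<times> {ws. set ws \<subseteq> alphabet M \<times> (UNIV :: direction set) \<and> length ws = tape_count M}"
    using wf_delta[OF assms] by (fastforce simp: mem_Times_iff)
  ultimately show ?thesis by (rule rev_finite_subset)
qed

text \<open>A well-formed machine has finitely many states and tuples of scanned symbols, so its
  enumerated transitions form a finite table. The range of the table is finite too, which gives a
  uniform bound \<open>b\<close> on the branching.\<close>

lemma table_exists: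
  assumes "wf_machine M"
  shows "\<exists>tb b. is_table M tb \<and> (\<forall>y. length (tb y) \<le> b)"
proof -
  let ?S = "states M \<times> {ss. set ss \<subseteq> alphabet M \<and> length ss = tape_count M}"
  have fin: "finite ?S" using assms by (auto simp: wf_machine_def finite_lists_length_eq)
  have "\<forall>y\<in>?S. \<exists>l. set l = delta M (fst y) (snd y) \<and> distinct l"
  proof
    fix y assume "y \<in> ?S"
    then have "finite (delta M (fst y) (snd y))" using delta_finite[OF assms] by auto
    then show "\<exists>l. set l = delta M (fst y) (snd y) \<and> distinct l" by (rule finite_distinct_list)
  qed
  from bchoice[OF this] obtain f where f: "\<forall>y\<in>?S. set (f y) = delta M (fst y) (snd y) \<and> distinct (f y)" by (elim exE)
  obtain tb where tb: "polytime tb" "\<forall>y\<in>?S. tb y = f y" "range tb \<subseteq> insert [] (f ` ?S)"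
    using polytime_table[OF fin, of f "[]"] by blast
  have "is_table M tb"
    using tb f unfolding is_table_def by auto
  moreover have "finite (range tb)" using tb(3) by (rule finite_subset) (simp only: finite.insertI finite_imageI fin)
  then have "\<forall>y. length (tb y) \<le> Max (length ` range tb)" by simp
  ultimately show ?thesis by blast
qed

lemma rscan_good:
  assumes "good_tape \<Gamma> n r" "Blank \<in> \<Gamma>"
  shows "rscan r \<in> \<Gamma>"
  using assms lookup_in[of "fst r" "snd r"] by (auto simp: good_tape_def rscan_def)

lemma good_scans:
  assumes "wf_machine M" "good M n rc"
  shows "length (map rscan (snd rc)) = tape_count M" "set (map rscan (snd rc)) \<subseteq> alphabet M" "fst rc \<in> states M"
  using assms rscan_good by (fastforce simp: good_def wf_machine_def)+

lemma set_rsuccs: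
  assumes "wf_machine M" "is_table M tb" "good M n rc"
  shows "set (rsuccs tb rc) = (if fst rc \<in> {Query, Accept, Reject} then {}
     else (\<lambda>a. rperform a rc) ` delta M (fst rc) (map rscan (snd rc)))"
  using assms(2) good_scans[OF assms(1,3)] unfolding is_table_def rsuccs_def by auto

lemma good_rsuccs:
  assumes "wf_machine M" "is_table M tb" "good M n rc" "rc' \<in> set (rsuccs tb rc)"
  shows "good M (Suc n) rc'"
proof -
  obtain a where a: "a \<in> delta M (fst rc) (map rscan (snd rc))" "rc' = rperform a rc"
    using assms(4) set_rsuccs[OF assms(1-3)] by (auto split: if_splits)
  have v: "fst a \<in> states M" "length (snd a) = tape_count M" "fst ` set (snd a) \<subseteq> alphabet M"
    using wf_delta[OF assms(1) good_scans(3,1,2)[OF assms(1,3)] a(1)] by auto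
  have "good_tape (alphabet M) (Suc n) (rupdate w r)" if "(w, r) \<in> set (zip (snd a) (snd rc))" for w r
  proof (rule good_rupdate)
    show "good_tape (alphabet M) n r" using assms(3) set_zip_rightD[OF that] by (simp add: good_def)
    show "fst w \<in> alphabet M" using v(3) set_zip_leftD[OF that] by auto
  qed
  then show ?thesis
    using v assms(3) a(2) by (auto simp: good_def rperform_def)
qed

lemma represents_rperform:
  "represents c rc \<Longrightarrow> perform a c = c\<lparr>state := fst (rperform a rc), tapes := map abs_tape (snd (rperform a rc))\<rparr>"
proof -
  have "map2 update_tape ws (map abs_tape rs) = map abs_tape (map (\<lambda>y. rupdate (fst y) (snd y)) (zip ws rs))" for ws rs
    by (rule nth_equalityI) (auto simp: update_abs)
  moreover assume "represents c rc"
  ultimately show ?thesis by (simp add: perform_def rperform_def represents_def)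
qed

lemma moves_rsuccs:
  assumes "wf_machine M" "is_table M tb" "good M n rc" "represents c rc"
  shows "moves M c = (\<lambda>rc'. c\<lparr>state := fst rc', tapes := map abs_tape (snd rc')\<rparr>) ` set (rsuccs tb rc)"
proof -
  have "map scanned (tapes c) = map rscan (snd rc)" "state c = fst rc"
    using assms(4) by (auto simp: represents_def)
  then show ?thesis
    unfolding set_rsuccs[OF assms(1-3)] moves_def
    by (simp add: image_image represents_rperform[OF assms(4)])
qed

lemma polytime_rperform [polytime_intros]:
  "polytime_on D f \<Longrightarrow> polytime_on D g \<Longrightarrow> polytime_on D (\<lambda>x. rperform (f x) (g x))"
  unfolding rperform_def by (intro polytime_intros)

lemma polytime_rsuccs:
  assumes "is_table M tb" "polytime_on D f"
  shows "polytime_on D (\<lambda>x. rsuccs tb (f x))"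
proof (rule polytime_comp[OF _ assms(2)])
  have tb: "polytime tb" using assms(1) by (simp add: is_table_def)
  show "polytime (rsuccs tb)"
    unfolding rsuccs_def by (intro polytime_intros polytime_comp[OF tb])
qed

text \<open>For a fixed machine each state or symbol contributes at most a constant, the maximum of
  their sizes; addresses and head positions are unary, but bounded by \<open>n\<close>.\<close>

lemma good_sz:
  assumes "wf_machine M"
  shows "\<exists>q. poly_bounded q \<and> (\<forall>n rc. good M n rc \<longrightarrow> sz rc \<le> q n)"
proof -
  define S where "S = Max (sz ` states M)"
  define A where "A = Max (sz ` alphabet M)"
  have S: "sz q \<le> S" if "q \<in> states M" for q
    using that assms by (simp add: S_def wf_machine_def)
  have A: "sz s \<le> A" if "s \<in> alphabet M" for s
    using that assms by (simp add: A_def wf_machine_def)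
  let ?t = "\<lambda>n. Suc ((1 + n * Suc (Suc (5 + 2 * n + A))) + (5 + 2 * n))"
  have "sz r \<le> ?t n" if "good_tape (alphabet M) n r" for n r
  proof -
    have "sz y \<le> Suc (5 + 2 * n + A)" if "y \<in> set (fst r)" for y
    proof -
      have "nat \<bar>fst y\<bar> \<le> n" "sz (snd y) \<le> A"
        using that \<open>good_tape (alphabet M) n r\<close> A by (auto simp: good_tape_def)
      then show ?thesis using sz_fst_snd[of y] sz_int[of "fst y"] by linarith
    qed
    then have "sz (fst r) \<le> 1 + length (fst r) * Suc (Suc (5 + 2 * n + A))" by (rule sz_list_le)
    also have "\<dots> \<le> 1 + n * Suc (Suc (5 + 2 * n + A))"
      using that by (intro add_mono mult_le_mono) (auto simp: good_tape_def)
    finally show ?thesis using sz_fst_snd[of r] sz_int[of "snd r"] that by (simp add: good_tape_def)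
  qed
  then have "sz (snd rc) \<le> 1 + tape_count M * Suc (?t n)" if "good M n rc" for n rc
    using sz_list_le[of "snd rc" "?t n"] that by (simp add: good_def)
  then have "sz rc \<le> Suc (S + (1 + tape_count M * Suc (?t n)))" if "good M n rc" for n rc
    using sz_fst_snd[of rc] S[of "fst rc"] that by (fastforce simp: good_def)
  moreover have "poly_bounded (\<lambda>n. Suc (S + (1 + tape_count M * Suc (?t n))))"
    by (intro poly_bounded_intros)
  ultimately show ?thesis by (intro exI[of _ "\<lambda>n. Suc (S + (1 + tape_count M * Suc (?t n)))"]) blast
qed

text \<open>The disjunction stands for membership in \<open>range Bit\<close>, in a form built from
  equality tests.\<close>

definition rquery :: "rconfig \<Rightarrow> bool list" where
  "rquery rc = (case snd rc of [] \<Rightarrow> [] | _ # rs \<Rightarrow> (case rs of [] \<Rightarrow> [] | r # _ \<Rightarrow>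
     map (\<lambda>s. s = Bit True) (rblock (\<lambda>s. s = Bit False \<or> s = Bit True) (fst r))))"

definition ranswer :: "bool \<Rightarrow> rconfig \<Rightarrow> rconfig" where
  "ranswer b rc = (if b then Yes else No, case snd rc of [] \<Rightarrow> [] | r # rs \<Rightarrow> r # ([], 0) # tl rs)"

lemma tape_word_abs:
  "tape_word (abs_tape r) = map (\<lambda>s. s = Bit True) (rblock (\<lambda>s. s = Bit False \<or> s = Bit True) (fst r))"
proof -
  have "(\<lambda>s. s \<in> range Bit) = (\<lambda>s. s = Bit False \<or> s = Bit True)"
    by (auto simp: fun_eq_iff)
  then show ?thesis using block_abs[of "\<lambda>s. s = Bit False \<or> s = Bit True" r] by (simp add: tape_word_def)
qed

lemma represents_query:
  assumes "represents c rc" "2 \<le> length (snd rc)"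
  shows "query_word c = rquery rc"
proof -
  obtain r0 r1 rs where "snd rc = r0 # r1 # rs"
    using assms(2) by (auto simp: numeral_2_eq_2 Suc_le_length_iff)
  then show ?thesis using assms(1) by (simp add: query_word_def rquery_def represents_def tape_word_abs)
qed

lemma represents_answer:
  assumes "represents c rc" "2 \<le> length (snd rc)"
  shows "represents (answer A c) (ranswer (rquery rc \<in> A) rc)"
proof -
  obtain r0 r1 rs where "snd rc = r0 # r1 # rs"
    using assms(2) by (auto simp: numeral_2_eq_2 Suc_le_length_iff)
  then show ?thesis using assms represents_query[OF assms]
    by (simp add: answer_def ranswer_def represents_def abs_blank)
qed

lemma good_ranswer:
  assumes "wf_machine M" "good M n rc"
  shows "good M n (ranswer b rc)"
proof -
  have "2 \<le> length (snd rc)" using assms by (simp add: good_def wf_machine_def)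
  then obtain r0 r1 rs where "snd rc = r0 # r1 # rs"
    by (auto simp: numeral_2_eq_2 Suc_le_length_iff)
  then show ?thesis using assms by (auto simp: good_def ranswer_def wf_machine_def good_blank)
qed

lemma length_rquery:
  assumes "good M n rc"
  shows "length (rquery rc) \<le> n"
proof -
  have "length (rblock (\<lambda>s. s = Bit False \<or> s = Bit True) (fst r)) \<le> n" if "r \<in> set (snd rc)" for r
    using length_rblock[of "\<lambda>s. s = Bit False \<or> s = Bit True" "fst r"] that assms
    by (fastforce simp: good_def good_tape_def)
  then show ?thesis by (auto simp: rquery_def split: list.splits)
qed

lemma polytime_rquery [polytime_intros]: "polytime_on D f \<Longrightarrow> polytime_on D (\<lambda>x. rquery (f x))"
  unfolding rquery_def by (intro polytime_intros polytime_rblock) auto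

lemma polytime_ranswer [polytime_intros]:
  "polytime_on D f \<Longrightarrow> polytime_on D g \<Longrightarrow> polytime_on D (\<lambda>x. ranswer (f x) (g x))"
  unfolding ranswer_def by (intro polytime_intros)

section \<open>Exponential time as padded polynomial time\<close>

text \<open>The answer must be correct for every padding above the threshold. This permits raising
  the exponent at will and handing one padding on to the decision procedure of an oracle.\<close>

definition pad_decidable :: "language \<Rightarrow> bool" where
  "pad_decidable L \<longleftrightarrow> (\<exists>F c. polytime F \<and>
     (\<forall>x (P::nat). 2 ^ (length x ^ c + c) \<le> P \<longrightarrow> F (x, P) = (x \<in> L)))"

lemma poly_bounded_exponent:
  assumes "poly_bounded p"
  shows "\<exists>e. \<forall>n. p n \<le> n ^ e + e"
proof -
  obtain k where k: "\<And>n. p n \<le> (n + 2) ^ k" using assms unfolding poly_bounded_def by blast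
  \<comment> \<open>For \<open>n \<ge> 2\<close> the estimate \<open>n + 2 \<le> n ^ 2\<close>
    doubles the exponent; for \<open>n \<le> 1\<close> the whole bound is at most the constant
    \<open>3 ^ k\<close>.\<close>
  let ?e = "2 * k + 3 ^ k"
  have "p n \<le> n ^ ?e + ?e" for n
  proof (cases "n \<le> 1")
    case True
    then have "(n + 2) ^ k \<le> 3 ^ k" by (intro power_mono) auto
    then show ?thesis using k[of n] by linarith
  next
    case False
    then have "2 * n \<le> n * n" by (intro mult_le_mono1) simp
    then have "n + 2 \<le> n ^ 2" using False unfolding power2_eq_square by linarith
    then have "(n + 2) ^ k \<le> (n ^ 2) ^ k" by (intro power_mono) auto
    also have "\<dots> = n ^ (2 * k)" by (simp add: power_mult)
    also have "\<dots> \<le> n ^ ?e" using False by (intro power_increasing) auto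
    finally show ?thesis using k[of n] by linarith
  qed
  then show ?thesis by blast
qed

lemma decides_in_time_mono:
  assumes "decides_in_time A M L T" "\<And>n. T n \<le> T' n"
  shows "decides_in_time A M L T'"
  using assms unfolding decides_in_time_def by (meson le_trans)

subsection \<open>From padded polynomial time to exponential time\<close>

text \<open>Turns the raw input into the tree code of a list. A list code is built from its last
  entry on, so the word is first reversed onto stack 1; then the symbols of each entry and of its
  list node are pushed in reverse.\<close>

definition load :: com where
  "load = Loop (\<lambda>ss. ss ! 0 \<noteq> Blank) (move 0 1) ;; push 0 (Bit False) ;;
     Loop (\<lambda>ss. ss ! 1 \<noteq> Blank)
       (Cond (\<lambda>ss. ss ! 1 = Bit True)
          (push 0 (Bit False) ;; push 0 (Bit False) ;; push 0 (Bit True) ;; push 0 (Bit True))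
          (push 0 (Bit False) ;; push 0 (Bit True)) ;; pop 1)"

lemma wf_load [simp]: "wf_com load"
  by (simp add: load_def)

lemma exec_load: "exec load [map Bit x, [], [], []] [code (enc x), [], [], []] (26 * length x + 10)"
proof -
  have 1: "exec (Loop (\<lambda>ss. ss ! 0 \<noteq> Blank) (move 0 1)) [map Bit xs, b, [], []]
      [[], rev (map Bit xs) @ b, [], []] (6 * length xs + 1)" for xs b
  proof (induction xs arbitrary: b)
    case Nil
    show ?case using exec_loop_stop[of "\<lambda>ss. ss ! 0 \<noteq> Blank" "[[], b, [], []]"] by simp
  next
    case (Cons x xs)
    show ?case
      using exec_loop_step[OF _ exec_moves(1) Cons.IH[of "Bit x # b"]] by simp
  qed
  let ?C = "Cond (\<lambda>ss. ss ! 1 = Bit True)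
          (push 0 (Bit False) ;; push 0 (Bit False) ;; push 0 (Bit True) ;; push 0 (Bit True))
          (push 0 (Bit False) ;; push 0 (Bit True))"
  have 2: "exec (Loop (\<lambda>ss. ss ! 1 \<noteq> Blank) (?C ;; pop 1)) [code (enc ys), map Bit zs, [], []]
      [code (enc (rev zs @ ys)), [], [], []] (20 * length zs + 1)" for ys zs
  proof (induction zs arbitrary: ys)
    case Nil
    show ?case using exec_loop_stop[of "\<lambda>ss. ss ! 1 \<noteq> Blank" "[code (enc ys), [], [], []]"] by simp
  next
    case (Cons z zs)
    have "exec ?C [code (enc ys), Bit z # map Bit zs, [], []] [code (enc (z # ys)), Bit z # map Bit zs, [], []] 16"
    proof (rule exec_cond)
      assume "tops [code (enc ys), Bit z # map Bit zs, [], []] ! 1 = Bit True"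
      then have "z" by simp
      moreover have "exec (push 0 (Bit False) ;; push 0 (Bit False) ;; push 0 (Bit True) ;; push 0 (Bit True))
         [a, b, u, d] [Bit True # Bit True # Bit False # Bit False # a, b, u, d] 15" for a b u d
        by (rule exec_seq[OF exec_pushes(1) exec_seq[OF exec_pushes(1) exec_seq[OF exec_pushes(1)
          exec_pushes(1) order_refl] order_refl]]) simp_all
      ultimately show "exec (push 0 (Bit False) ;; push 0 (Bit False) ;; push 0 (Bit True) ;; push 0 (Bit True))
         [code (enc ys), Bit z # map Bit zs, [], []] [code (enc (z # ys)), Bit z # map Bit zs, [], []] 15"
        by (simp add: enc_bool_def)
    next
      assume "tops [code (enc ys), Bit z # map Bit zs, [], []] ! 1 \<noteq> Bit True"
      then have "\<not> z" by simp
      moreover have "exec (push 0 (Bit False) ;; push 0 (Bit True)) [a, b, u, d] [Bit True # Bit False # a, b, u, d] 15" for a b u d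
        by (rule exec_seq[OF exec_pushes(1) exec_pushes(1)]) simp_all
      ultimately show "exec (push 0 (Bit False) ;; push 0 (Bit True))
         [code (enc ys), Bit z # map Bit zs, [], []] [code (enc (z # ys)), Bit z # map Bit zs, [], []] 15"
        by (simp add: enc_bool_def)
    qed simp
    from exec_seq[OF this exec_pops(2) order_refl]
    have b: "exec (?C ;; pop 1) [code (enc ys), map Bit (z # zs), [], []] [code (enc (z # ys)), map Bit zs, [], []] (16 + 1 + 1)"
      by simp
    have "exec (Loop (\<lambda>ss. ss ! 1 \<noteq> Blank) (?C ;; pop 1)) [code (enc ys), map Bit (z # zs), [], []]
      [code (enc (rev zs @ z # ys)), [], [], []] (20 * length (z # zs) + 1)"
      by (rule exec_loop_step[OF _ b Cons.IH[of "z # ys"]]) simp_all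
    then show ?case by simp
  qed
  have 1: "exec (Loop (\<lambda>ss. ss ! 0 \<noteq> Blank) (move 0 1)) [map Bit x, [], [], []]
      [[], map Bit (rev x), [], []] (6 * length x + 1)"
    using 1[of x "[]"] by (simp add: rev_map)
  have 2: "exec (Loop (\<lambda>ss. ss ! 1 \<noteq> Blank) (?C ;; pop 1)) [[Bit False], map Bit (rev x), [], []]
      [code (enc x), [], [], []] (20 * length x + 1)"
    using 2[of "[]" "rev x"] by simp
  show ?thesis
    unfolding load_def
    by (rule exec_seq[OF 1 exec_seq[OF exec_pushes(1) 2 order_refl]]) simp_all
qed

lemma pad_decidable_EXP:
  assumes "pad_decidable L"
  shows "L \<in> EXP"
proof -
  obtain F c where F: "polytime F" "\<And>x (P::nat). 2 ^ (length x ^ c + c) \<le> P \<Longrightarrow> F (x, P) = (x \<in> L)"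
    using assms unfolding pad_decidable_def by blast
  define N where "N x = length x ^ c + c" for x :: "bool list"
  have p1: "polytime (\<lambda>x. (N x, x, 1::nat))" unfolding N_def by (intro polytime_intros)
  obtain c1 k1 where c1: "wf_com c1"
    "\<And>x a b u d. exec c1 [code (enc x) @ a, b, u, d] [code (enc (N x, x, 1::nat)) @ a, b, u, d] ((sz x + 2) ^ k1)"
    using p1 by (rule polytime_onE) blast
  \<comment> \<open>Doubling \<open>N x\<close> times produces the padding \<open>2 ^ N x\<close>.
    Its size is exponential in the input, so this loop is not an instance of
    \<open>polytime_iterate\<close> and is timed by \<open>exec_iterate_com\<close>
    directly.\<close>
  define dbl :: "bool list \<times> nat \<Rightarrow> bool list \<times> nat" where "dbl p = (fst p, snd p + snd p)" for p
  have p2: "polytime dbl" unfolding dbl_def by (intro polytime_intros)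
  obtain c2 k2 where c2: "wf_com c2"
    "\<And>x a b u d. exec c2 [code (enc x) @ a, b, u, d] [code (enc (dbl x)) @ a, b, u, d] ((sz x + 2) ^ k2)"
    using p2 by (rule polytime_onE) blast
  obtain c3 k3 where c3: "wf_com c3"
    "\<And>x a b u d. exec c3 [code (enc x) @ a, b, u, d] [code (enc (F x)) @ a, b, u, d] ((sz x + 2) ^ k3)"
    using F(1) by (rule polytime_onE) blast
  \<comment> \<open>With \<open>y\<close> for \<open>length x + 2 ^ N x\<close>, the summands are
    the times of loading, of computing \<open>(N x, x, 1)\<close>, of the doublings and of
    \<open>F\<close>. The sizes inside are those of \<open>szx\<close> and
    \<open>szp\<close>.\<close>
  define q where "q y = 26 * y + 10 + ((4 * y + 3) ^ k1 + ((2 * y + 1) * ((4 * y + 5) ^ k2 + 16) + 30 + (4 * y + 5) ^ k3 + 1) + 1) + 1"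
    for y :: nat
  have q: "poly_bounded q" unfolding q_def by (intro poly_bounded_intros)
  let ?c = "load ;; c1 ;; iterate_com c2 ;; c3"
  have ex: "exec ?c [map Bit x, [], [], []] [code (enc (F (x, 2 ^ N x))), [], [], []] (q (length x + 2 ^ N x))" for x
  proof -
    let ?y = "length x + 2 ^ N x"
    have szx: "sz x \<le> 4 * ?y + 1" using sz_bools[of x] by simp
    have szp: "sz (x, 2 ^ i :: nat) \<le> 4 * ?y + 3" if "i \<le> N x" for i
    proof -
      have "(2::nat) ^ i \<le> 2 ^ N x" using that by (intro power_increasing) auto
      moreover have "sz (x, A) \<le> 4 * (length x + B) + 3" if "A \<le> B" for A B :: nat
        using sz_bools[of x] that by simp
      ultimately show ?thesis by blast
    qed
    have "exec c2 [code (enc (x, 2 ^ i :: nat)) @ a, b, u, d] [code (enc (x, 2 ^ Suc i :: nat)) @ a, b, u, d] ((4 * ?y + 5) ^ k2)"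
      if "i < nodes (enc (N x))" for i a b u d
    proof -
      have "(sz (x, 2 ^ i :: nat) + 2) ^ k2 \<le> (4 * ?y + 5) ^ k2"
        using szp[of i] that by (intro power_mono) auto
      then show ?thesis using exec_mono[OF c2(2)[of "(x, 2 ^ i)"]] by (simp add: dbl_def mult_2)
    qed
    from exec_iterate_com[of "enc (N x)" c2 "\<lambda>i. enc (x, 2 ^ i :: nat)", OF this, of "[]" "[]" "[]" "[]"]
    have "exec (iterate_com c2) [code (enc (N x, x, 1::nat)), [], [], []] [code (enc (x, 2 ^ N x :: nat)), [], [], []]
        (tsize (enc (N x)) * ((4 * ?y + 5) ^ k2 + 16) + 30)"
      by (simp add: enc_prod_def)
    moreover have "tsize (enc (N x)) \<le> 2 * ?y + 1"
    proof -
      have "tsize (enc (N x)) = 2 * N x + 1" using sz_nat[of "N x"] unfolding sz_def .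
      moreover have "2 * A + 1 \<le> 2 * (length x + B) + 1" if "A < B" for A B :: nat
        using that by simp
      ultimately show ?thesis using less_exp[of "N x"] by metis
    qed
    ultimately have it: "exec (iterate_com c2) [code (enc (N x, x, 1::nat)), [], [], []] [code (enc (x, 2 ^ N x :: nat)), [], [], []]
        ((2 * ?y + 1) * ((4 * ?y + 5) ^ k2 + 16) + 30)"
      by (elim exec_mono) (intro add_mono mult_le_mono1 order_refl)
    have e1: "exec c1 [code (enc x), [], [], []] [code (enc (N x, x, 1::nat)), [], [], []] ((4 * ?y + 3) ^ k1)"
      using exec_mono[OF c1(2)[of x "[]" "[]" "[]" "[]"], of "(4 * ?y + 3) ^ k1"] szx by (simp add: power_mono)
    have e3: "exec c3 [code (enc (x, 2 ^ N x :: nat)), [], [], []] [code (enc (F (x, 2 ^ N x))), [], [], []] ((4 * ?y + 5) ^ k3)"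
    proof -
      have "(sz (x, 2 ^ N x :: nat) + 2) ^ k3 \<le> (4 * ?y + 5) ^ k3" using szp[of "N x"] by (intro power_mono) auto
      then show ?thesis using exec_mono[OF c3(2)[of "(x, 2 ^ N x)" "[]" "[]" "[]" "[]"]] by simp
    qed
    show ?thesis
      by (rule exec_seq[OF exec_load exec_seq[OF e1 exec_seq[OF it e3 order_refl] order_refl]])
         (simp add: q_def)
  qed
  obtain K where K: "\<And>n. q n + 2 \<le> (n + 2) ^ K"
    using poly_bounded_add[OF q poly_bounded_const[of 2]] unfolding poly_bounded_def by blast
  \<comment> \<open>This is the final exponent: \<open>n + 2 ^ (n ^ c + c) + 2\<close> is at most
    \<open>2 ^ (n + (n ^ c + c) + 2)\<close>, and the machine needs its \<open>K\<close>-th power as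
    time.\<close>
  have "poly_bounded (\<lambda>n. (n + (n ^ c + c) + 2) * K)" by (intro poly_bounded_intros)
  then obtain e where e: "\<And>n. (n + (n ^ c + c) + 2) * K \<le> n ^ e + e"
    using poly_bounded_exponent by blast
  have ex_M: "\<exists>M. wf_machine M \<and> deterministic M \<and> oracle_free M \<and>
      decides_in_time {} M L (\<lambda>n. q (n + 2 ^ (n ^ c + c)) + 2)"
  proof (rule compile_decides)
    show "wf_com ?c" using c1 c2 c3 by simp
    fix x
    have "tops [code (enc (F (x, 2 ^ N x))), [], [], []] ! 0 = Bit True \<longleftrightarrow> x \<in> L"
      using F(2)[of x "2 ^ N x"] by (simp add: N_def enc_bool_def)
    then show "\<exists>s. s \<noteq> [] \<and> exec ?c [map Bit x, [], [], []] s (q (length x + 2 ^ (length x ^ c + c))) \<and>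
        (tops s ! 0 = Bit True) = (x \<in> L)"
      using ex[of x] unfolding N_def by blast
  qed
  have time: "q (n + 2 ^ (n ^ c + c)) + 2 \<le> 2 ^ (n ^ e + e)" for n
  proof -
    let ?N = "n ^ c + c"
    have "n + 1 < 2 ^ (n + 1)" by (rule less_exp)
    then have "n + 2 \<le> 2 ^ (n + 1)" by simp
    also have "\<dots> \<le> 2 ^ (n + ?N + 1)" by (intro power_increasing) auto
    finally have "n + 2 \<le> 2 ^ (n + ?N + 1)" .
    moreover have "(2::nat) ^ ?N \<le> 2 ^ (n + ?N + 1)" by (intro power_increasing) auto
    ultimately have "n + 2 ^ ?N + 2 \<le> 2 ^ (n + ?N + 2)" by simp
    then have "(n + 2 ^ ?N + 2) ^ K \<le> (2 ^ (n + ?N + 2)) ^ K" by (intro power_mono) auto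
    also have "\<dots> = 2 ^ ((n + ?N + 2) * K)" by (simp only: power_mult)
    also have "\<dots> \<le> 2 ^ (n ^ e + e)" using e[of n] by (intro power_increasing) auto
    finally show ?thesis using K[of "n + 2 ^ ?N"] by linarith
  qed
  obtain M where M: "wf_machine M" "deterministic M" "oracle_free M"
    "decides_in_time {} M L (\<lambda>n. q (n + 2 ^ (n ^ c + c)) + 2)"
    using ex_M by blast
  have "decides_in_time {} M L (\<lambda>n. 2 ^ (n ^ e + e))"
    by (rule decides_in_time_mono[OF M(4) time])
  with M show ?thesis unfolding EXP_def by blast
qed

subsection \<open>Exhaustive simulation of nondeterministic oracle machines\<close>

lemma polytime_Bit [polytime_intros]:
  assumes "polytime_on D f"
  shows "polytime_on D (\<lambda>x. Bit (f x))"
proof -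
  have "polytime_on D (\<lambda>x. if f x then Bit True else Bit False)" by (intro polytime_intros assms)
  then show ?thesis by (rule polytime_on_cong) auto
qed

lemma polytime_le [polytime_intros]:
  assumes "polytime_on D f" "polytime_on D g"
  shows "polytime_on D (\<lambda>x. f x \<le> (g x :: nat))"
proof (rule polytime_comp2[OF _ assms])
  have *: "((\<lambda>m. case m of 0 \<Rightarrow> 0 | Suc k \<Rightarrow> k) ^^ n) m = m - n" for m n :: nat
    by (induction n) (auto split: nat.splits)
  have "polytime (\<lambda>p :: nat \<times> nat. ((\<lambda>m. case m of 0 \<Rightarrow> 0 | Suc k \<Rightarrow> k) ^^ snd p) (fst p))"
  proof (rule polytime_funpow[where f = "\<lambda>_ m. case m of 0 \<Rightarrow> 0 | Suc k \<Rightarrow> k"])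
    show "poly_bounded (\<lambda>n. n)" by (intro poly_bounded_intros)
    show "sz (((\<lambda>m. case m of 0 \<Rightarrow> 0 | Suc k \<Rightarrow> k) ^^ i) (fst x)) \<le> sz x" for x :: "nat \<times> nat" and i
      unfolding * using sz_fst_snd[of x] by simp
  qed (intro polytime_intros)+
  then have "polytime (\<lambda>p :: nat \<times> nat. fst p - snd p = 0)" unfolding * by (intro polytime_intros)
  then show "polytime (\<lambda>p :: nat \<times> nat. fst p \<le> snd p)" by simp
qed

definition abs_config :: "rconfig \<Rightarrow> config" where
  "abs_config rc = \<lparr>state = fst rc, tapes = map abs_tape (snd rc)\<rparr>"

definition osuccs :: "(state \<times> symbol list \<Rightarrow> action list) \<Rightarrow> (bool list \<times> nat \<Rightarrow> bool) \<Rightarrow> nat \<Rightarrow> rconfig \<Rightarrow> rconfig list" where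
  "osuccs tb F P rc = (if fst rc = Query then [ranswer (F (rquery rc, P)) rc] else rsuccs tb rc)"

text \<open>One level of the breadth-first search. The list of configurations is cut down to nothing when it
  exceeds the padding, which keeps the search polynomial in the size of the padded input.\<close>

definition level :: "(state \<times> symbol list \<Rightarrow> action list) \<Rightarrow> (bool list \<times> nat \<Rightarrow> bool) \<Rightarrow> nat \<Rightarrow>
    bool \<times> rconfig list \<Rightarrow> bool \<times> rconfig list" where
  "level tb F P s = (fst s \<or> (\<exists>rc\<in>set (snd s). fst rc = Accept),
     if length (concat (map (osuccs tb F P) (snd s))) \<le> P then concat (map (osuccs tb F P) (snd s)) else [])"

definition rinput :: "nat \<Rightarrow> bool list \<Rightarrow> rconfig" where
  "rinput k x = (Start, rtape_of (map Bit x) # replicate (k - 1) ([], 0))"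

lemma abs_rinput: "abs_config (rinput (tape_count M) x) = input_config M x"
  by (simp add: abs_config_def rinput_def input_config_def abs_rtape_of abs_blank)

lemma good_rinput:
  assumes "wf_machine M"
  shows "good M (length x) (rinput (tape_count M) x)"
proof -
  have "set (map Bit x) \<subseteq> alphabet M"
  proof
    fix s assume "s \<in> set (map Bit x)"
    then obtain b where "s = Bit b" by auto
    then show "s \<in> alphabet M" using assms by (cases b) (auto simp: wf_machine_def)
  qed
  from good_rtape_of[OF this] have "good_tape (alphabet M) (length x) (rtape_of (map Bit x))" by simp
  then show ?thesis using assms by (auto simp: good_def rinput_def wf_machine_def good_blank)
qed

lemma good_osuccs:
  assumes "wf_machine M" "is_table M tb" "good M n rc" "rc' \<in> set (osuccs tb F P rc)"
  shows "good M (Suc n) rc'"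
proof (cases "fst rc = Query")
  case True
  then have "good M n rc'" using assms(4) good_ranswer[OF assms(1,3)] by (simp add: osuccs_def)
  then show ?thesis by (rule good_mono) simp
next
  case False
  then show ?thesis using assms good_rsuccs by (simp add: osuccs_def)
qed

lemma abs_osuccs:
  assumes "wf_machine M" "is_table M tb" "good M n rc" "F (rquery rc, P) = (rquery rc \<in> B)"
  shows "abs_config ` set (osuccs tb F P rc) = {c. oracle_step B M (abs_config rc) c}"
proof -
  have r: "represents (abs_config rc) rc" by (simp add: represents_def abs_config_def)
  have "2 \<le> length (snd rc)" using assms(1,3) by (simp add: good_def wf_machine_def)
  note a = represents_answer[OF r this, of B]
  show ?thesis
  proof (cases "fst rc = Query")
    case True
    have "answer B (abs_config rc) = abs_config (ranswer (rquery rc \<in> B) rc)"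
      using a by (simp add: represents_def abs_config_def)
    then show ?thesis using True assms(4) by (simp add: osuccs_def oracle_step_def abs_config_def)
  next
    case False
    have "moves M (abs_config rc) = abs_config ` set (rsuccs tb rc)"
      unfolding moves_rsuccs[OF assms(1-3) r] by (simp add: abs_config_def)
    then show ?thesis using False by (simp add: osuccs_def oracle_step_def abs_config_def)
  qed
qed

lemma level_good:
  assumes "wf_machine M" "is_table M tb"
  shows "length (snd ((level tb F P ^^ i) (False, [rinput (tape_count M) x]))) \<le> Suc P \<and>
    (\<forall>rc\<in>set (snd ((level tb F P ^^ i) (False, [rinput (tape_count M) x]))). good M (length x + i) rc)"
proof (induction i)
  case 0
  show ?case using good_rinput[OF assms(1)] by simp
next
  case (Suc i)
  then show ?case using good_osuccs[OF assms] by (auto simp: level_def)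
qed

text \<open>The padding is a unary number, so that many rounds are affordable. The cut in
  \<open>level\<close> bounds the number of configurations, and \<open>level_good\<close> bounds the
  size of each.\<close>

lemma polytime_search:
  assumes wf: "wf_machine M" and tb: "is_table M tb" and F: "polytime F"
  shows "polytime (\<lambda>p. fst ((level tb F (snd p) ^^ snd p) (False, [rinput (tape_count M) (fst p)])))"
proof -
  obtain q where q: "poly_bounded q" "\<And>n rc. good M n rc \<Longrightarrow> sz rc \<le> q n"
    using good_sz[OF wf] by blast
  obtain k where k: "\<And>m n. m \<le> n \<Longrightarrow> q m \<le> (n + 2) ^ k" using q(1) by (rule poly_boundedE) blast
  have os: "polytime (\<lambda>p. osuccs tb F (fst p) (snd p))"
    unfolding osuccs_def by (intro polytime_intros polytime_comp[OF F] polytime_rsuccs[OF tb])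
  have "polytime (\<lambda>p. (level tb F (snd p) ^^ snd p) (False, [rinput (tape_count M) (fst p)]))"
  proof (rule polytime_funpow[where f = "\<lambda>p. level tb F (snd p)"])
    show "polytime (\<lambda>p. level tb F (snd (fst p)) (snd p))"
      for p :: "(bool list \<times> nat) \<times> bool \<times> rconfig list"
      unfolding level_def by (intro polytime_intros polytime_comp2[OF os])
    show "polytime (\<lambda>p :: bool list \<times> nat. (False, [rinput (tape_count M) (fst p)]))"
      unfolding rinput_def by (intro polytime_intros)
    let ?b = "\<lambda>n. Suc (3 + (1 + Suc n * Suc ((2 * n + 2) ^ k)))"
    show "poly_bounded ?b" by (intro poly_bounded_intros)
    fix p :: "bool list \<times> nat" and i assume i: "i \<le> snd p"
    let ?s = "(level tb F (snd p) ^^ i) (False, [rinput (tape_count M) (fst p)])"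
    note g = level_good[OF wf tb, of i F "snd p" "fst p"]
    have le: "length (fst p) + i \<le> 2 * sz p" "snd p \<le> sz p"
      using i length_less_sz[of "fst p"] sz_fst_snd[of p] sz_nat[of "snd p"] by linarith+
    have "sz rc \<le> (2 * sz p + 2) ^ k" if "rc \<in> set (snd ?s)" for rc
      using g that q(2)[of "length (fst p) + i" rc] k[OF le(1)] by (meson le_trans)
    then have "sz (snd ?s) \<le> 1 + length (snd ?s) * Suc ((2 * sz p + 2) ^ k)" by (rule sz_list_le)
    also have "\<dots> \<le> 1 + Suc (sz p) * Suc ((2 * sz p + 2) ^ k)"
      using g le(2) by (intro add_mono mult_le_mono) auto
    finally show "sz ?s \<le> ?b (sz p)" using sz_fst_snd[of ?s] sz_bool[of "fst ?s"] by linarith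
  qed (intro polytime_intros)+
  then show ?thesis by (rule polytime_fst)
qed

lemma length_concat_le:
  "(\<And>x. x \<in> set xs \<Longrightarrow> length (f x) \<le> b) \<Longrightarrow> length (concat (map f xs)) \<le> b * length xs"
proof (induction xs)
  case (Cons x xs)
  have "length (f x) \<le> b" "length (concat (map f xs)) \<le> b * length xs" using Cons by auto
  then show ?case by simp
qed simp

text \<open>Under the size assumptions the list is never cut, so it holds exactly the configurations
  reachable in \<open>i\<close> steps. The flag inspects a level only on leaving it, which is why
  \<open>P\<close> has to exceed the time bound strictly.\<close>

lemma search_correct:
  assumes wf: "wf_machine M" and tb: "is_table M tb" and dec: "decides_in_time B M L T"
    and b: "\<And>n rc. good M n rc \<Longrightarrow> length (rsuccs tb rc) \<le> b" "1 \<le> b"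
    and P: "T (length x) < P" "b ^ T (length x) \<le> P"
    and F: "\<And>w. length w \<le> length x + T (length x) \<Longrightarrow> F (w, P) = (w \<in> B)"
  shows "fst ((level tb F P ^^ P) (False, [rinput (tape_count M) x])) = (x \<in> L)"
proof -
  let ?r = "oracle_step B M" and ?c = "input_config M x"
  define s where "s i = (level tb F P ^^ i) (False, [rinput (tape_count M) x])" for i
  have s_Suc: "s (Suc i) = level tb F P (s i)" for i by (simp add: s_def)
  have good: "good M (length x + i) rc" if "rc \<in> set (snd (s i))" for i rc
    using level_good[OF wf tb] that unfolding s_def by blast
  have time: "m \<le> T (length x)" if "(?r ^^ m) ?c c" for m c
    using dec that unfolding decides_in_time_def by blast
  have inv: "abs_config ` set (snd (s i)) = {c. (?r ^^ i) ?c c} \<and> length (snd (s i)) \<le> b ^ i" for i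
  proof (induction i)
    case 0
    show ?case by (simp add: s_def abs_rinput)
  next
    case (Suc i)
    let ?l = "concat (map (osuccs tb F P) (snd (s i)))"
    have o: "abs_config ` set (osuccs tb F P rc) = {c. ?r (abs_config rc) c}" if "rc \<in> set (snd (s i))" for rc
    proof (rule abs_osuccs[OF wf tb good[OF that]])
      \<comment> \<open>A listed configuration is reached by a real computation, so \<open>i\<close>
        is within the time bound and the query is short enough for \<open>F\<close> to be
        reliable.\<close>
      have "(?r ^^ i) ?c (abs_config rc)" using Suc that by blast
      then have "i \<le> T (length x)" by (rule time)
      then show "F (rquery rc, P) = (rquery rc \<in> B)"
        using F length_rquery[OF good[OF that]] by simp
    qed
    have "abs_config ` set ?l = (\<Union>rc\<in>set (snd (s i)). abs_config ` set (osuccs tb F P rc))" by auto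
    also have "\<dots> = (\<Union>rc\<in>set (snd (s i)). {c. ?r (abs_config rc) c})" using o by simp
    also have "\<dots> = (\<Union>d\<in>abs_config ` set (snd (s i)). {c. ?r d c})" by simp
    also have "\<dots> = {c. (?r ^^ Suc i) ?c c}" using Suc by auto
    finally have l: "abs_config ` set ?l = {c. (?r ^^ Suc i) ?c c}" .
    have "length (osuccs tb F P rc) \<le> b" if "rc \<in> set (snd (s i))" for rc
      using b(1)[OF good[OF that]] b(2) by (simp add: osuccs_def)
    then have "length ?l \<le> b * length (snd (s i))"
      by (rule length_concat_le)
    also have "\<dots> \<le> b ^ Suc i" using Suc by simp
    finally have len: "length ?l \<le> b ^ Suc i" .
    \<comment> \<open>Within the time bound the branching limits the level; beyond it no
      configuration is left.\<close>
    have "length ?l \<le> P"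
    proof (cases "Suc i \<le> T (length x)")
      case True
      then have "b ^ Suc i \<le> b ^ T (length x)" using b(2) by (intro power_increasing) auto
      then show ?thesis using len P(2) by linarith
    next
      case False
      then have "{c. (?r ^^ Suc i) ?c c} = {}" using time by blast
      then have "set ?l = {}" using l by (metis image_is_empty)
      then have "length ?l = 0" by (simp only: set_empty list.size(3))
      then show ?thesis by linarith
    qed
    then have "snd (s (Suc i)) = ?l" by (simp add: s_Suc level_def)
    then show ?case using l len by simp
  qed
  have found: "fst (s i) \<longleftrightarrow> (\<exists>j<i. \<exists>c. (?r ^^ j) ?c c \<and> state c = Accept)" for i
  proof (induction i)
    case 0
    show ?case by (simp add: s_def)
  next
    case (Suc i)
    have "(\<exists>rc\<in>set (snd (s i)). fst rc = Accept) \<longleftrightarrow> (\<exists>c\<in>abs_config ` set (snd (s i)). state c = Accept)"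
      by (simp add: abs_config_def)
    also have "\<dots> \<longleftrightarrow> (\<exists>c. (?r ^^ i) ?c c \<and> state c = Accept)" using inv[of i] by simp
    finally show ?case using Suc by (auto simp: s_Suc level_def less_Suc_eq)
  qed
  have "x \<in> L \<longleftrightarrow> (\<exists>c. ?r\<^sup>*\<^sup>* ?c c \<and> state c = Accept)"
    using dec unfolding decides_in_time_def by blast
  also have "\<dots> \<longleftrightarrow> (\<exists>j c. (?r ^^ j) ?c c \<and> state c = Accept)"
    by (metis relpowp_imp_rtranclp rtranclp_imp_relpowp)
  also have "\<dots> \<longleftrightarrow> (\<exists>j<P. \<exists>c. (?r ^^ j) ?c c \<and> state c = Accept)"
    using time P(1) le_less_trans by blast
  finally show ?thesis using found[of P] by (simp add: s_def)
qed

lemma deterministic_rsuccs: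
  assumes "wf_machine M" "deterministic M" "is_table M tb" "good M n rc"
  shows "length (rsuccs tb rc) \<le> 1"
proof -
  let ?l = "tb (fst rc, map rscan (snd rc))"
  have l: "set ?l = delta M (fst rc) (map rscan (snd rc))" "distinct ?l"
    using assms(3) good_scans[OF assms(1,4)] unfolding is_table_def by blast+
  have "\<forall>a\<in>delta M (fst rc) (map rscan (snd rc)). \<forall>a'\<in>delta M (fst rc) (map rscan (snd rc)). a = a'"
    using assms(2) good_scans[OF assms(1,4)] unfolding deterministic_def by blast
  then have "card (set ?l) \<le> 1" using l(1) card_le_Suc0_iff_eq[OF finite_set, of ?l] by simp
  then have "length ?l \<le> 1" using l(2) by (simp add: distinct_card)
  then show ?thesis by (simp add: rsuccs_def)
qed

text \<open>Strictness is what the search requires. The increment 2 covers the case where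
  \<open>n\<close> and \<open>c\<close> are both 0: there \<open>n ^ c\<close> is 1, while the new
  power of \<open>n\<close> vanishes.\<close>

lemma pad_exponent: "2 ^ (n ^ c + c) < (2::nat) ^ (n ^ (c + 2) + (c + 2))"
proof -
  have "n ^ c \<le> n ^ (c + 2) + 1"
  proof (cases "n = 0")
    case False
    then have "n ^ c \<le> n ^ (c + 2)" by (intro power_increasing) linarith+
    then show ?thesis by linarith
  qed (simp add: power_0_left)
  then have "n ^ c + c < n ^ (c + 2) + (c + 2)" by simp
  then show ?thesis by (intro power_strict_increasing) auto
qed

lemma EXP_pad_decidable:
  assumes "L \<in> EXP"
  shows "pad_decidable L"
proof -
  obtain M c where M: "wf_machine M" "deterministic M" "decides_in_time {} M L (\<lambda>n. 2 ^ (n ^ c + c))"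
    using assms unfolding EXP_def by blast
  obtain tb where tb: "is_table M tb" using table_exists[OF M(1)] by blast
  let ?G = "\<lambda>p. fst ((level tb (\<lambda>_. False) (snd p) ^^ snd p) (False, [rinput (tape_count M) (fst p)]))"
  have "polytime ?G" by (intro polytime_search[OF M(1) tb] polytime_intros)
  moreover have "?G (x, P) = (x \<in> L)" if "2 ^ (length x ^ (c + 2) + (c + 2)) \<le> P" for x P
  proof -
    have "2 ^ (length x ^ c + c) < P" using that pad_exponent[of "length x" c] by linarith
    then show ?thesis
      using search_correct[OF M(1) tb M(3), where b = 1 and x = x and P = P and F = "\<lambda>_. False"]
        deterministic_rsuccs[OF M(1,2) tb] by simp
  qed
  ultimately show ?thesis unfolding pad_decidable_def by blast
qed

text \<open>Queries of a machine with polynomial time bound have polynomial length, so a larger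
  exponent makes the padding sufficient for the oracle procedure as well as for the search.\<close>

lemma NP_pad_decidable:
  assumes "pad_decidable B" "L \<in> NP_class B"
  shows "pad_decidable L"
proof -
  obtain F c where F: "polytime F" "\<And>x (P::nat). 2 ^ (length x ^ c + c) \<le> P \<Longrightarrow> F (x, P) = (x \<in> B)"
    using assms(1) unfolding pad_decidable_def by blast
  obtain M d where M: "wf_machine M" "decides_in_time B M L (\<lambda>n. n ^ d + d)"
    using assms(2) unfolding NP_class_def by blast
  obtain tb b where tb: "is_table M tb" "\<And>y. length (tb y) \<le> b" using table_exists[OF M(1)] by blast
  \<comment> \<open>A power of two as branching bound makes \<open>(2 ^ b) ^ T\<close> a power of
    two that can be compared with the padding.\<close>
  have b: "length (rsuccs tb rc) \<le> 2 ^ b" for rc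
  proof -
    have "length (rsuccs tb rc) \<le> b" using tb(2) by (simp add: rsuccs_def)
    then show ?thesis using less_exp[of b] by linarith
  qed
  \<comment> \<open>With \<open>T\<close> for \<open>n ^ d + d\<close>, the first summand provides
    for \<open>T < P\<close> and for the \<open>2 ^ (b * T)\<close> paths; the second is the padding
    exponent for queries of length up to \<open>n + T\<close>.\<close>
  have "poly_bounded (\<lambda>n. (b + 1) * (n ^ d + d) + ((n + (n ^ d + d)) ^ c + c))"
    by (intro poly_bounded_intros)
  then obtain e where e: "\<And>n. (b + 1) * (n ^ d + d) + ((n + (n ^ d + d)) ^ c + c) \<le> n ^ e + e"
    using poly_bounded_exponent by blast
  let ?G = "\<lambda>p. fst ((level tb F (snd p) ^^ snd p) (False, [rinput (tape_count M) (fst p)]))"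
  have "polytime ?G" by (intro polytime_search[OF M(1) tb(1)] F)
  moreover have "?G (x, P) = (x \<in> L)" if P: "2 ^ (length x ^ e + e) \<le> P" for x P
  proof -
    let ?T = "length x ^ d + d"
    note e' = e[of "length x"]
    have le: "2 ^ m \<le> P" if "m \<le> length x ^ e + e" for m
      using P power_increasing[OF that, of "2::nat"] by linarith
    have "2 ^ ?T \<le> P" using e' by (intro le) simp
    then have 1: "?T < P" using less_exp[of ?T] by linarith
    have "2 ^ (b * ?T) \<le> P" using e' by (intro le) (simp add: algebra_simps)
    then have 2: "(2 ^ b) ^ ?T \<le> P" by (simp only: power_mult)
    have 3: "F (w, P) = (w \<in> B)" if "length w \<le> length x + ?T" for w
    proof (rule F(2))
      have "length w ^ c \<le> (length x + ?T) ^ c" using that by (intro power_mono) auto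
      then show "2 ^ (length w ^ c + c) \<le> P" using e' by (intro le) linarith
    qed
    show ?thesis
      using search_correct[OF M(1) tb(1) M(2), where b = "2 ^ b" and x = x and P = P and F = F] b 1 2 3 by simp
  qed
  ultimately show ?thesis unfolding pad_decidable_def using F by blast
qed

lemma EXP_iff_pad_decidable: "L \<in> EXP \<longleftrightarrow> pad_decidable L"
  using EXP_pad_decidable pad_decidable_EXP by blast

lemma EXP_complement: "L \<in> EXP \<Longrightarrow> - L \<in> EXP"
proof -
  assume "L \<in> EXP"
  then obtain F c where F: "polytime F" "\<And>x (P::nat). 2 ^ (length x ^ c + c) \<le> P \<Longrightarrow> F (x, P) = (x \<in> L)"
    unfolding EXP_iff_pad_decidable pad_decidable_def by blast
  have "polytime (\<lambda>p. \<not> F p)" by (intro polytime_intros F)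
  then show "- L \<in> EXP" unfolding EXP_iff_pad_decidable pad_decidable_def
    using F(2) by (intro exI[of _ "\<lambda>p. \<not> F p"] exI[of _ c]) auto
qed

text \<open>Deterministic machines count as nondeterministic ones, so every level, including the
  lowest, is one application of \<open>NP_pad_decidable\<close>.\<close>

lemma Sigma_P_subset_EXP: "A \<in> EXP \<Longrightarrow> Sigma_P k A \<subseteq> EXP"
proof (induction k)
  case 0
  have "P_class A \<subseteq> NP_class A" unfolding P_class_def NP_class_def by blast
  then show ?case using 0 NP_pad_decidable by (auto simp: EXP_iff_pad_decidable)
next
  case (Suc k)
  then show ?case using NP_pad_decidable by (auto simp: EXP_iff_pad_decidable)
qed

section \<open>Replacing the empty oracle by an arbitrary one\<close>

text \<open>A machine for the empty oracle treats both answers as No; querying is kept because it blanks the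
  query tape. The original state Yes, which a transition may enter without a query, is renamed.\<close>

fun fresh_name :: "state \<Rightarrow> state" where
  "fresh_name Yes = Work 0"
| "fresh_name (Work n) = Work (Suc n)"
| "fresh_name q = q"

fun old_name :: "state \<Rightarrow> state" where
  "old_name Yes = No"
| "old_name (Work 0) = Yes"
| "old_name (Work (Suc n)) = Work n"
| "old_name q = q"

lemma old_fresh_name [simp]: "old_name (fresh_name q) = q"
  by (cases q) auto

lemma old_name_simps [simp]:
  "old_name q = Query \<longleftrightarrow> q = Query" "old_name q = Accept \<longleftrightarrow> q = Accept" "old_name q = Reject \<longleftrightarrow> q = Reject"
  by (cases q rule: old_name.cases; auto)+

definition ignore_answers :: "machine \<Rightarrow> machine" where
  "ignore_answers M = M\<lparr>states := insert Yes (fresh_name ` states M),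
     delta := (\<lambda>q ss. map_prod fresh_name id ` delta M (old_name q) ss)\<rparr>"

definition old_config :: "config \<Rightarrow> config" where
  "old_config c = c\<lparr>state := old_name (state c)\<rparr>"

lemma wf_ignore_answers:
  assumes wf: "wf_machine M"
  shows "wf_machine (ignore_answers M)"
proof -
  let ?M = "ignore_answers M"
  have st: "{Start, Accept, Reject, Query, Yes, No} \<subseteq> states M" using wf by (simp add: wf_machine_def)
  have "{Start, Accept, Reject, Query, Yes, No} \<subseteq> states ?M"
  proof -
    have "fresh_name ` {Start, Accept, Reject, Query, No} \<subseteq> fresh_name ` states M"
      using st by (intro image_mono) auto
    then show ?thesis by (auto simp: ignore_answers_def)
  qed
  moreover have "case a of (q', ws) \<Rightarrow> q' \<in> states ?M \<and> length ws = tape_count ?M \<and> fst ` set ws \<subseteq> alphabet ?M"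
    if "q \<in> states ?M" "length ss = tape_count ?M" "set ss \<subseteq> alphabet ?M" and a: "a \<in> delta ?M q ss" for q ss a
  proof -
    have q: "old_name q \<in> states M" using that(1) st by (auto simp: ignore_answers_def)
    obtain a' where a': "a' \<in> delta M (old_name q) ss" "a = map_prod fresh_name id a'"
      using a by (auto simp: ignore_answers_def)
    have "length ss = tape_count M" "set ss \<subseteq> alphabet M" using that by (auto simp: ignore_answers_def)
    from wf_delta[OF wf q this a'(1)] show ?thesis
      by (simp add: a'(2) ignore_answers_def map_prod_def split_beta)
  qed
  moreover have "finite (states ?M)" "finite (alphabet ?M)" "{Blank, Bit False, Bit True, Sep} \<subseteq> alphabet ?M" "2 \<le> tape_count ?M"
    using wf by (simp_all add: ignore_answers_def wf_machine_def)
  ultimately show ?thesis unfolding wf_machine_def by blast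
qed

lemma deterministic_ignore_answers:
  assumes "wf_machine M" "deterministic M"
  shows "deterministic (ignore_answers M)"
  unfolding deterministic_def
proof (intro ballI allI impI)
  fix q ss a a'
  assume q: "q \<in> states (ignore_answers M)"
    and ss: "length ss = tape_count (ignore_answers M) \<and> set ss \<subseteq> alphabet (ignore_answers M)"
    and a: "a \<in> delta (ignore_answers M) q ss" "a' \<in> delta (ignore_answers M) q ss"
  have "old_name q \<in> states M" using q assms(1) by (auto simp: ignore_answers_def wf_machine_def)
  moreover have "length ss = tape_count M \<and> set ss \<subseteq> alphabet M" using ss by (simp add: ignore_answers_def)
  ultimately have "\<forall>a\<in>delta M (old_name q) ss. \<forall>a'\<in>delta M (old_name q) ss. a = a'"
    using assms(2) unfolding deterministic_def by blast
  then show "a = a'" using a by (auto simp: ignore_answers_def)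
qed

text \<open>Stated for sets of successors, one equation covers both directions of the simulation.
  After a query, \<open>Yes\<close> and \<open>No\<close> both stand for the state \<open>No\<close>
  in which the empty oracle would have left the machine.\<close>

lemma step_ignore_answers:
  "old_config ` {d. oracle_step A (ignore_answers M) c d} = {d. oracle_step {} M (old_config c) d}"
proof (cases "state c = Query")
  case True
  then show ?thesis
    by (auto simp: oracle_step_def old_config_def answer_def query_word_def)
next
  case False
  have "old_config (perform (map_prod fresh_name id a) c) = perform a (old_config c)" for a
    by (cases a) (simp add: old_config_def perform_def)
  then have "old_config ` moves (ignore_answers M) c = moves M (old_config c)"
    by (simp add: moves_def ignore_answers_def image_image) (simp add: old_config_def)
  then show ?thesis using False by (simp add: oracle_step_def) (simp add: old_config_def)
qed

lemma steps_ignore_answers: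
  "old_config ` {d. (oracle_step A (ignore_answers M) ^^ m) c d} = {d. (oracle_step {} M ^^ m) (old_config c) d}"
proof (induction m)
  case (Suc m)
  have "old_config ` {d. (oracle_step A (ignore_answers M) ^^ Suc m) c d} =
      (\<Union>e\<in>{e. (oracle_step A (ignore_answers M) ^^ m) c e}. old_config ` {d. oracle_step A (ignore_answers M) e d})"
    by auto
  also have "\<dots> = (\<Union>e\<in>old_config ` {e. (oracle_step A (ignore_answers M) ^^ m) c e}. {d. oracle_step {} M e d})"
    by (simp add: step_ignore_answers)
  also have "\<dots> = {d. (oracle_step {} M ^^ Suc m) (old_config c) d}"
    unfolding Suc by auto
  finally show ?case .
qed simp

lemma decides_ignore_answers:
  assumes "decides_in_time {} M L T"
  shows "decides_in_time A (ignore_answers M) L T"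
proof -
  let ?r = "oracle_step A (ignore_answers M)" and ?s = "oracle_step {} M"
  have inp: "old_config (input_config (ignore_answers M) x) = input_config M x" for x
    by (simp add: old_config_def input_config_def ignore_answers_def)
  have 1: "(?s ^^ m) (input_config M x) (old_config c)"
    if "(?r ^^ m) (input_config (ignore_answers M) x) c" for m x c
  proof -
    have "old_config c \<in> old_config ` {d. (?r ^^ m) (input_config (ignore_answers M) x) d}" using that by blast
    then show ?thesis unfolding steps_ignore_answers inp by simp
  qed
  have 2: "\<exists>c'. (?r ^^ m) (input_config (ignore_answers M) x) c' \<and> old_config c' = c"
    if "(?s ^^ m) (input_config M x) c" for m x c
  proof -
    have "c \<in> {d. (?s ^^ m) (old_config (input_config (ignore_answers M) x)) d}" using that by (simp add: inp)
    then have "c \<in> old_config ` {d. (?r ^^ m) (input_config (ignore_answers M) x) d}"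
      unfolding steps_ignore_answers .
    then show ?thesis by blast
  qed
  have acc: "state (old_config c) = Accept \<longleftrightarrow> state c = Accept" for c by (simp add: old_config_def)
  show ?thesis unfolding decides_in_time_def
  proof (intro allI conjI impI)
    fix x m c assume "(?r ^^ m) (input_config (ignore_answers M) x) c"
    then show "m \<le> T (length x)" using 1 assms unfolding decides_in_time_def by blast
  next
    fix x
    have "x \<in> L \<longleftrightarrow> (\<exists>m c. (?s ^^ m) (input_config M x) c \<and> state c = Accept)"
      using assms unfolding decides_in_time_def rtranclp_is_Sup_relpowp by auto
    also have "\<dots> \<longleftrightarrow> (\<exists>m c. (?r ^^ m) (input_config (ignore_answers M) x) c \<and> state c = Accept)"
      using 1 2 acc by metis
    finally show "x \<in> L \<longleftrightarrow> (\<exists>c. ?r\<^sup>*\<^sup>* (input_config (ignore_answers M) x) c \<and> state c = Accept)"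
      unfolding rtranclp_is_Sup_relpowp by auto
  qed
qed

text \<open>The oracle enters at the lowest level only; the others are monotone in the level
  below.\<close>

lemma Sigma_P_empty_subset: "Sigma_P k {} \<subseteq> Sigma_P k A"
proof (induction k)
  case 0
  show ?case
  proof
    fix L assume "L \<in> Sigma_P 0 {}"
    then obtain M c where "wf_machine M" "deterministic M" "decides_in_time {} M L (\<lambda>n. n ^ c + c)"
      by (auto simp: P_class_def)
    then have "wf_machine (ignore_answers M)" "deterministic (ignore_answers M)"
      "decides_in_time A (ignore_answers M) L (\<lambda>n. n ^ c + c)"
      using wf_ignore_answers deterministic_ignore_answers decides_ignore_answers by blast+
    then show "L \<in> Sigma_P 0 A" by (auto simp: P_class_def)
  qed
next
  case (Suc k)
  then show ?case by auto
qed

section \<open>Playing against a betting game\<close>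

lemma polytime_dropWhile [polytime_intros]:
  assumes P: "polytime P" and "polytime_on D f"
  shows "polytime_on D (\<lambda>x. dropWhile P (f x))"
proof -
  let ?g = "\<lambda>a s. if fst a \<or> \<not> P s then (True, s # snd a) else a"
  have t: "foldl ?g (True, zs) xs = (True, rev xs @ zs)" for xs zs
    by (induction xs arbitrary: zs) auto
  have f: "snd (foldl ?g (False, []) xs) = rev (dropWhile P xs)" for xs
    by (induction xs) (auto simp: t)
  have "polytime_on D (\<lambda>x. foldl ?g (False, []) (f x))"
  proof (rule polytime_foldl_add[where g = "\<lambda>_. ?g"])
    show "polytime (\<lambda>p. ?g (fst (snd p)) (snd (snd p)))" for p :: "'b \<times> (bool \<times> 'a list) \<times> 'a"
      by (intro polytime_intros polytime_comp[OF P])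
    show "poly_bounded (\<lambda>n. n + 4)" by (intro poly_bounded_intros)
    show "sz (?g a y) \<le> sz a + (sz x + sz y + 4)" for x :: 'b and a y
      using sz_bool[of True] by (cases a) auto
  qed (intro polytime_intros assms)+
  then have "polytime_on D (\<lambda>x. rev (snd (foldl ?g (False, []) (f x))))" by (intro polytime_intros)
  then show ?thesis by (simp add: f)
qed

lemma polytime_takeWhile [polytime_intros]:
  assumes P: "polytime P" and "polytime_on D f"
  shows "polytime_on D (\<lambda>x. takeWhile P (f x))"
proof -
  let ?g = "\<lambda>a s. if fst a \<or> \<not> P s then (True, snd a) else (False, s # snd a)"
  have t: "foldl ?g (True, zs) xs = (True, zs)" for xs zs
    by (induction xs arbitrary: zs) auto
  have f: "snd (foldl ?g (False, zs) xs) = rev (takeWhile P xs) @ zs" for xs zs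
    by (induction xs arbitrary: zs) (auto simp: t)
  have "polytime_on D (\<lambda>x. foldl ?g (False, []) (f x))"
  proof (rule polytime_foldl_add[where g = "\<lambda>_. ?g"])
    show "polytime (\<lambda>p. ?g (fst (snd p)) (snd (snd p)))" for p :: "'b \<times> (bool \<times> 'a list) \<times> 'a"
      by (intro polytime_intros polytime_comp[OF P])
    show "poly_bounded (\<lambda>n. n + 4)" by (intro poly_bounded_intros)
    show "sz (?g a y) \<le> sz a + (sz x + sz y + 4)" for x :: 'b and a y
      using sz_bool[of True] sz_bool[of False] by (cases a) auto
  qed (intro polytime_intros assms)+
  then have "polytime_on D (\<lambda>x. rev (snd (foldl ?g (False, []) (f x))))" by (intro polytime_intros)
  then show ?thesis by (simp add: f)
qed

definition bits :: "symbol list \<Rightarrow> bool list" where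
  "bits ss = map (\<lambda>s. s = Bit True) ss"

lemma nat_of_symbols_bits: "nat_of_symbols ss = bval (bits ss)"
  by (induction ss) (simp_all add: nat_of_symbols_def bits_def)

definition rbet_tape :: "rconfig \<Rightarrow> rtape" where
  "rbet_tape rc = (case tl (tl (snd rc)) of [] \<Rightarrow> ([], 0) | r # _ \<Rightarrow> r)"

definition rbet :: "rconfig \<Rightarrow> symbol list" where
  "rbet rc = rblock (\<lambda>s. s \<noteq> Blank) (fst (rbet_tape rc))"

definition rsign :: "rconfig \<Rightarrow> bool" where
  "rsign rc = (case rbet rc of [] \<Rightarrow> False | s # _ \<Rightarrow> s = Bit True)"

definition ramount :: "rconfig \<Rightarrow> bool list \<times> bool list" where
  "ramount rc = (bits (takeWhile (\<lambda>s. s \<noteq> Sep) (tl (rbet rc))), bits (tl (dropWhile (\<lambda>s. s \<noteq> Sep) (tl (rbet rc)))))"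

text \<open>The adversary always lets the bet fail: the amount is subtracted whatever the sign, and
  the answer is the opposite of what was bet on.\<close>

definition rsettle :: "rconfig \<times> bool list \<times> bool list \<Rightarrow> rconfig \<times> bool list \<times> bool list" where
  "rsettle g = (let C = bdiff (snd g) (ramount (fst g)) in
     ((if rsign (fst g) then No else Yes,
       rtape_of (map Bit (fst C) @ Sep # map Bit (snd C)) # ([], 0) # ([], 0) # tl (tl (tl (snd (fst g))))), C))"

definition rgame_step :: "(state \<times> symbol list \<Rightarrow> action list) \<Rightarrow>
    rconfig \<times> bool list \<times> bool list \<Rightarrow> rconfig \<times> bool list \<times> bool list" where
  "rgame_step tb g = (if fst (fst g) = Query then rsettle g
     else (case rsuccs tb (fst g) of [] \<Rightarrow> g | rc # _ \<Rightarrow> (rc, snd g)))"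

lemma polytime_rbet [polytime_intros]: "polytime_on D f \<Longrightarrow> polytime_on D (\<lambda>x. rbet (f x))"
  unfolding rbet_def rbet_tape_def by (intro polytime_rblock polytime_intros) auto

lemma polytime_rsign [polytime_intros]: "polytime_on D f \<Longrightarrow> polytime_on D (\<lambda>x. rsign (f x))"
  unfolding rsign_def by (intro polytime_intros)

lemma polytime_ramount [polytime_intros]: "polytime_on D f \<Longrightarrow> polytime_on D (\<lambda>x. ramount (f x))"
  unfolding ramount_def bits_def by (intro polytime_intros)

lemma polytime_rsettle [polytime_intros]: "polytime_on D f \<Longrightarrow> polytime_on D (\<lambda>x. rsettle (f x))"
  unfolding rsettle_def Let_def by (intro polytime_intros)

lemma polytime_rgame_step: "is_table M tb \<Longrightarrow> polytime (rgame_step tb)"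
  unfolding rgame_step_def by (intro polytime_intros polytime_rsuccs) assumption

text \<open>The bet tape needs a bound of its own, since the bound common to all tapes also has to
  accommodate the much longer capital.\<close>

lemma good_tape_rsuccs_nth:
  assumes "wf_machine M" "is_table M tb" "good M n rc" "rc' \<in> set (rsuccs tb rc)" "i < tape_count M"
    "good_tape (alphabet M) m (snd rc ! i)"
  shows "good_tape (alphabet M) (Suc m) (snd rc' ! i)"
proof -
  obtain a where a: "a \<in> delta M (fst rc) (map rscan (snd rc))" "rc' = rperform a rc"
    using assms(4) set_rsuccs[OF assms(1-3)] by (auto split: if_splits)
  have v: "length (snd a) = tape_count M" "fst ` set (snd a) \<subseteq> alphabet M"
    using wf_delta[OF assms(1) good_scans(3,1,2)[OF assms(1,3)] a(1)] by auto
  have l: "length (snd rc) = tape_count M" using assms(3) by (simp add: good_def)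
  have "snd rc' ! i = rupdate (snd a ! i) (snd rc ! i)"
    using a(2) v(1) l assms(5) by (simp add: rperform_def)
  moreover have "fst (snd a ! i) \<in> alphabet M" using v assms(5) by (auto simp: image_subset_iff)
  ultimately show ?thesis using good_rupdate[OF assms(6)] by simp
qed

section \<open>The adversary and its language\<close>

locale betting =
  fixes G :: betting_game
  assumes game: "is_betting_game G"
begin

lemma wf: "wf_machine G" and det: "deterministic G" and tape_count: "3 \<le> tape_count G"
  and initial: "initial_capital G > 0"
  using game by (auto simp: is_betting_game_def)

text \<open>Only the current query is put to the language passed to \<^const>\<open>game_step\<close>, which makes the game lose its bet.\<close>

definition adv_step :: "game_config \<Rightarrow> game_config" where
  "adv_step c = game_step (if bet_sign c then {} else UNIV) G c"

definition adv :: "nat \<Rightarrow> game_config" where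
  "adv m = (adv_step ^^ m) (game_start G)"

definition adv_lang :: language where
  "adv_lang = {w. \<exists>m. state (adv m) = Query \<and> query_word (adv m) = w \<and> \<not> bet_sign (adv m)}"

lemma adv_Suc: "adv (Suc m) = adv_step (adv m)"
  by (simp add: adv_def)

lemma adv_step_eq:
  assumes "state c = Query \<Longrightarrow> query_word c \<in> B \<longleftrightarrow> \<not> bet_sign c"
  shows "game_step B G c = adv_step c"
  using assms by (auto simp: adv_step_def game_step_def settle_def answer_def new_capital_def Let_def)

text \<open>A language influences the game only through the answers to its queries, so agreement
  with the adversary before step \<open>j\<close> determines all configurations up to and including
  step \<open>j\<close>.\<close>

lemma play_eq_adv:
  assumes "\<And>i. i < j \<Longrightarrow> state (adv i) = Query \<Longrightarrow> query_word (adv i) \<in> B \<longleftrightarrow> \<not> bet_sign (adv i)"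
  shows "i \<le> j \<Longrightarrow> play B G i = adv i"
proof (induction i)
  case 0
  show ?case by (simp add: play_def adv_def)
next
  case (Suc i)
  then have "play B G (Suc i) = game_step B G (adv i)" by (simp add: play_def)
  also have "\<dots> = adv_step (adv i)" using Suc.prems assms by (intro adv_step_eq) simp
  finally show ?case by (simp add: adv_Suc)
qed

text \<open>By strong induction the queries before \<open>m'\<close> are distinct, so their answers
  cannot conflict and some language realises the play so far. The promise of the game against that
  language then excludes a repetition at \<open>m'\<close>.\<close>

lemma adv_distinct:
  assumes "m < m'" "state (adv m) = Query" "state (adv m') = Query"
  shows "query_word (adv m) \<noteq> query_word (adv m')"
  using assms
proof (induction m' arbitrary: m rule: less_induct)
  case (less m')
  \<comment> \<open>The finite language of the positive answers given before step \<open>m'\<close>.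
    Its play coincides with \<open>adv\<close> through step \<open>m'\<close> itself, because a
    query is asked before it is answered.\<close>
  define B where "B = {w. \<exists>m<m'. state (adv m) = Query \<and> query_word (adv m) = w \<and> \<not> bet_sign (adv m)}"
  have dist: "i = l" if "i < m'" "l < m'" "state (adv i) = Query" "state (adv l) = Query"
    "query_word (adv i) = query_word (adv l)" for i l
    using less.IH that by (metis nat_neq_iff)
  have "query_word (adv i) \<in> B \<longleftrightarrow> \<not> bet_sign (adv i)" if "i < m'" "state (adv i) = Query" for i
    using dist that unfolding B_def by blast
  then have "play B G i = adv i" if "i \<le> m'" for i using play_eq_adv that by blast
  then show ?case using game less.prems unfolding is_betting_game_def by (metis less_imp_le order_refl)
qed

lemma play_adv_lang: "play adv_lang G m = adv m"
proof (rule play_eq_adv[OF _ order_refl])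
  fix i assume i: "state (adv i) = Query"
  have "j = i" if "state (adv j) = Query" "query_word (adv j) = query_word (adv i)" for j
    using adv_distinct i that by (metis nat_neq_iff)
  then show "query_word (adv i) \<in> adv_lang \<longleftrightarrow> \<not> bet_sign (adv i)"
    using i unfolding adv_lang_def by blast
qed

lemma adv_bet:
  assumes "state (adv m) = Query"
  shows "bet_well_formed (adv m)" "0 \<le> bet_amount (adv m)" "bet_amount (adv m) \<le> capital (adv m)"
  using game assms play_adv_lang unfolding is_betting_game_def by metis+

text \<open>Every genuine step is charged at least one unit; only a halted game idles for free, and
  it is not in the query state. A query at step \<open>m\<close> thus bounds \<open>m\<close> by the
  elapsed time.\<close>

lemma elapsed_ge: "m \<le> elapsed (adv m) \<or> (state (adv m) \<noteq> Query \<and> moves G (adv m) = {})"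
proof (induction m)
  case (Suc m)
  then show ?case
    by (cases "state (adv m) = Query")
       (auto simp: adv_Suc adv_step_def game_step_def settle_def Let_def)
qed simp

section \<open>Simulating the play on encoded configurations\<close>

definition start_fraction :: "bool list \<times> bool list" where
  "start_fraction = (case quotient_of (initial_capital G) of (p, q) \<Rightarrow> (binary (nat p), binary (nat q)))"

definition rstart :: "rconfig \<times> bool list \<times> bool list" where
  "rstart = ((Start, rtape_of (rat_symbols (initial_capital G)) # replicate (tape_count G - 1) ([], 0)), start_fraction)"

definition radv :: "(state \<times> symbol list \<Rightarrow> action list) \<Rightarrow> nat \<Rightarrow> rconfig \<times> bool list \<times> bool list" where
  "radv tb m = (rgame_step tb ^^ m) rstart"

text \<open>A bet settled at step \<open>m\<close> lengthens numerator and denominator by at most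
  \<open>m\<close> digits, and \<open>m * m + m\<close> does not exceed the square of
  \<open>m + 1\<close>.\<close>

definition cap_length :: "nat \<Rightarrow> nat" where
  "cap_length m = length (fst start_fraction) + length (snd start_fraction) + m * m"

text \<open>A freshly written capital consists of two numbers and a separator; the last summand
  accounts for one unit of growth per step.\<close>

definition tape_length :: "nat \<Rightarrow> nat" where
  "tape_length m = 2 * cap_length m + 1 + m"

text \<open>The bet tape is blanked in every round and hence is short, which keeps the capital from growing
  faster than quadratically.\<close>

definition sim :: "game_config \<Rightarrow> nat \<Rightarrow> rconfig \<times> bool list \<times> bool list \<Rightarrow> bool" where
  "sim c m g \<longleftrightarrow> represents c (fst g) \<and>
     quotient_of (capital c) = (int (bval (fst (snd g))), int (bval (snd (snd g)))) \<and>
     length (fst (snd g)) \<le> cap_length m \<and> length (snd (snd g)) \<le> cap_length m \<and>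
     good G (tape_length m) (fst g) \<and> good_tape (alphabet G) m (snd (fst g) ! 2)"

lemma rat_symbols_eq:
  "quotient_of C = (int p, int q) \<Longrightarrow> rat_symbols C = map Bit (binary p) @ Sep # map Bit (binary q)"
  by (simp add: rat_symbols_def)

lemma in_alphabet: "set (map Bit xs @ Sep # map Bit ys) \<subseteq> alphabet G"
proof -
  have "Bit b \<in> alphabet G" for b using wf by (cases b) (auto simp: wf_machine_def)
  moreover have "Sep \<in> alphabet G" using wf by (simp add: wf_machine_def)
  ultimately show ?thesis by auto
qed

lemma cap_length_mono: "cap_length m \<le> cap_length (Suc m)" "cap_length m + m \<le> cap_length (Suc m)"
  by (simp_all add: cap_length_def)

lemma tape_length_Suc: "Suc (tape_length m) \<le> tape_length (Suc m)"
  using cap_length_mono(1)[of m] by (simp add: tape_length_def)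

lemma sim_start: "sim (adv 0) 0 rstart"
proof -
  obtain p q where pq: "quotient_of (initial_capital G) = (p, q)" by (metis surj_pair)
  have q: "0 < q" using quotient_of_denom_pos[OF pq] .
  have "initial_capital G = of_int p / of_int q" using quotient_of_div[OF pq] .
  then have p: "0 \<le> p" using initial q by (simp add: zero_less_divide_iff)
  have sf: "start_fraction = (binary (nat p), binary (nat q))" by (simp add: start_fraction_def pq)
  have rs: "rat_symbols (initial_capital G) = map Bit (binary (nat p)) @ Sep # map Bit (binary (nat q))"
    by (simp add: rat_symbols_def pq)
  have "good_tape (alphabet G) (length (rat_symbols (initial_capital G))) (rtape_of (rat_symbols (initial_capital G)))"
    unfolding rs by (rule good_rtape_of[OF in_alphabet])
  then have "good_tape (alphabet G) (tape_length 0) (rtape_of (rat_symbols (initial_capital G)))"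
    by (rule good_tape_mono) (simp add: rs tape_length_def cap_length_def sf)
  moreover have "Start \<in> states G" using wf by (simp add: wf_machine_def)
  ultimately have "good G (tape_length 0) (fst rstart)"
    using tape_count by (auto simp: good_def rstart_def good_blank)
  moreover have "snd (fst rstart) ! 2 = ([], 0)"
    using tape_count by (simp add: rstart_def nth_Cons numeral_2_eq_2)
  moreover have "represents (adv 0) (fst rstart)"
    by (simp add: represents_def adv_def game_start_def rstart_def abs_rtape_of abs_blank)
  moreover have "capital (adv 0) = initial_capital G" by (simp add: adv_def game_start_def)
  ultimately show ?thesis using p q
    by (simp add: sim_def rstart_def sf bval_binary pq good_blank cap_length_def)
qed

text \<open>The bound on the denominator comes from the bet tape: its history has at most
  \<open>m\<close> writes, and a block is no longer than the history.\<close>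

lemma sim_bet:
  assumes "sim c m g" "bet_well_formed c"
  shows "rsign (fst g) = bet_sign c" "bfrac (ramount (fst g)) = bet_amount c" "0 < bval (snd (ramount (fst g)))"
    "length (snd (ramount (fst g))) \<le> m"
proof -
  have "3 \<le> length (snd (fst g))" using assms(1) tape_count by (simp add: sim_def good_def)
  then obtain r0 r1 r2 rs where r: "snd (fst g) = r0 # r1 # r2 # rs"
    by (auto simp: numeral_3_eq_3 Suc_le_length_iff)
  have t: "rbet_tape (fst g) = snd (fst g) ! 2" "tapes c ! 2 = abs_tape (snd (fst g) ! 2)"
    using assms(1) by (simp_all add: r rbet_tape_def sim_def represents_def)
  have bet: "tape_contents (tapes c ! 2) = rbet (fst g)"
    unfolding tape_contents_def rbet_def t by (rule block_abs) simp
  obtain b ns ds where wfb: "rbet (fst g) = Bit b # map Bit ns @ Sep # map Bit ds" "nat_of_symbols (map Bit ds) > 0"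
    using assms(2) unfolding bet_well_formed_def bet by blast
  show "rsign (fst g) = bet_sign c" by (simp add: rsign_def bet_sign_def bet wfb(1))
  show "bfrac (ramount (fst g)) = bet_amount c"
    by (simp add: bfrac_def ramount_def bet_amount_def rat_of_symbols_def bet nat_of_symbols_bits)
  have d: "dropWhile (\<lambda>s. s \<noteq> Sep) (tl (rbet (fst g))) = Sep # map Bit ds"
    unfolding wfb(1) by (simp add: dropWhile_append)
  show "0 < bval (snd (ramount (fst g)))" using wfb(2) by (simp add: ramount_def d nat_of_symbols_bits)
  have "length (snd (ramount (fst g))) \<le> length (rbet (fst g))" by (simp add: ramount_def d bits_def) (simp add: wfb(1))
  also have "\<dots> \<le> length (fst (snd (fst g) ! 2))" unfolding rbet_def t by (rule length_rblock) simp
  also have "\<dots> \<le> m" using assms(1) by (simp add: sim_def good_tape_def)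
  finally show "length (snd (ramount (fst g))) \<le> m" .
qed

lemma sim_capital:
  assumes "sim c m g"
  shows "capital c = bfrac (snd g)" "0 < bval (snd (snd g))"
proof -
  have q: "quotient_of (capital c) = (int (bval (fst (snd g))), int (bval (snd (snd g))))"
    using assms by (simp add: sim_def)
  show "capital c = bfrac (snd g)" using quotient_of_div[OF q] by (simp add: bfrac_def)
  show "0 < bval (snd (snd g))" using quotient_of_denom_pos[OF q] by simp
qed

text \<open>A legal bet does not exceed the capital, so the truncated subtraction in
  \<open>bdiff\<close> is exact. The amount is nonnegative, so a lost bet cannot raise the
  capital.\<close>

lemma sim_settle:
  assumes s: "sim (adv m) m g" and Q: "state (adv m) = Query"
  shows "sim (adv (Suc m)) (Suc m) (rsettle g) \<and> capital (adv (Suc m)) \<le> capital (adv m)"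
proof -
  note bet = sim_bet[OF s adv_bet(1)[OF Q]] and cap = sim_capital[OF s]
  define C where "C = bdiff (snd g) (ramount (fst g))"
  have le: "bfrac (ramount (fst g)) \<le> bfrac (snd g)" using adv_bet(3)[OF Q] bet(2) cap(1) by simp
  note corr = quotient_of_bdiff[OF cap(2) bet(3) le, folded C_def] and len = length_bdiff[OF cap(2) bet(3) le, folded C_def]
  \<comment> \<open>A bet on membership meets the empty language, a bet against it the full one;
    either way it is lost.\<close>
  have newcap: "new_capital (if bet_sign (adv m) then {} else UNIV) (adv m) = capital (adv m) - bet_amount (adv m)"
    by (simp add: new_capital_def)
  have quot: "quotient_of (capital (adv m) - bet_amount (adv m)) = (int (bval (fst C)), int (bval (snd C)))"
    using corr(1) bet(2) cap(1) by simp
  have adv': "adv (Suc m) = settle (if bet_sign (adv m) then {} else UNIV) (adv m)"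
    using Q by (simp add: adv_Suc adv_step_def game_step_def)
  have rat: "rat_symbols (capital (adv m) - bet_amount (adv m)) = map Bit (fst C) @ Sep # map Bit (snd C)"
    using rat_symbols_eq[OF quot] corr(2,3) by metis
  have l3: "length (snd (fst g)) = tape_count G" using s by (simp add: sim_def good_def)
  then have "3 \<le> length (snd (fst g))" using tape_count by simp
  then obtain r0 r1 r2 rs where r: "snd (fst g) = r0 # r1 # r2 # rs"
    by (auto simp: numeral_3_eq_3 Suc_le_length_iff)
  have tp: "tapes (adv m) = map abs_tape (r0 # r1 # r2 # rs)" using s r by (simp add: sim_def represents_def)
  define R where "R = rtape_of (map Bit (fst C) @ Sep # map Bit (snd C))"
  have rg: "rsettle g = ((if rsign (fst g) then No else Yes, R # ([], 0) # ([], 0) # rs), C)"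
    by (simp add: rsettle_def Let_def C_def R_def r)
  have cl: "length (fst C) \<le> cap_length (Suc m)" "length (snd C) \<le> cap_length (Suc m)"
    using len bet(4) s cap_length_mono(2)[of m] by (auto simp: sim_def)
  have "good_tape (alphabet G) (length (map Bit (fst C) @ Sep # map Bit (snd C))) R"
    unfolding R_def by (rule good_rtape_of[OF in_alphabet])
  then have gR: "good_tape (alphabet G) (tape_length (Suc m)) R"
    by (rule good_tape_mono) (use cl in \<open>simp add: tape_length_def\<close>)
  have grs: "good_tape (alphabet G) (tape_length (Suc m)) t" if "t \<in> set rs" for t
  proof (rule good_tape_mono)
    show "good_tape (alphabet G) (tape_length m) t" using s that r by (simp add: sim_def good_def)
    show "tape_length m \<le> tape_length (Suc m)" using tape_length_Suc[of m] by simp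
  qed
  have st: "Yes \<in> states G" "No \<in> states G" using wf by (auto simp: wf_machine_def)
  have "good G (tape_length (Suc m)) (fst (rsettle g))"
    using gR grs st l3 r by (auto simp: good_def rg good_blank)
  moreover have "represents (adv (Suc m)) (fst (rsettle g))"
    unfolding represents_def adv' rg
    using bet(1) by (auto simp: settle_def Let_def newcap rat answer_def tp R_def abs_rtape_of abs_blank numeral_2_eq_2)
  moreover have "capital (adv (Suc m)) = capital (adv m) - bet_amount (adv m)"
    by (simp add: adv' settle_def Let_def newcap)
  ultimately show ?thesis
    using quot cl adv_bet(2)[OF Q] by (simp add: sim_def rg good_blank)
qed

lemma sim_step:
  assumes tb: "is_table G tb" and s: "sim (adv m) m g"
  shows "sim (adv (Suc m)) (Suc m) (rgame_step tb g) \<and> capital (adv (Suc m)) \<le> capital (adv m)"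
proof (cases "state (adv m) = Query")
  case True
  then have "fst (fst g) = Query" using s by (simp add: sim_def represents_def)
  then show ?thesis using sim_settle[OF s True] by (simp add: rgame_step_def)
next
  case False
  then have nq: "fst (fst g) \<noteq> Query" using s by (simp add: sim_def represents_def)
  have rep: "represents (adv m) (fst g)" and gd: "good G (tape_length m) (fst g)"
    using s by (auto simp: sim_def)
  note mv = moves_rsuccs[OF wf tb gd rep]
  have cm: "length (fst (snd g)) \<le> cap_length (Suc m)" "length (snd (snd g)) \<le> cap_length (Suc m)"
    using s cap_length_mono(1)[of m] by (auto simp: sim_def)
  show ?thesis
  proof (cases "rsuccs tb (fst g)")
    case Nil
    then have "moves G (adv m) = {}" using mv by simp
    then have "adv (Suc m) = adv m" using False by (simp add: adv_Suc adv_step_def game_step_def)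
    moreover have "rgame_step tb g = g" using nq Nil by (simp add: rgame_step_def)
    moreover have "good G (tape_length (Suc m)) (fst g)"
      by (rule good_mono[OF gd]) (use tape_length_Suc[of m] in simp)
    moreover have "good_tape (alphabet G) (Suc m) (snd (fst g) ! 2)"
      by (rule good_tape_mono[of _ m]) (use s in \<open>simp_all add: sim_def\<close>)
    ultimately show ?thesis using s cm by (simp add: sim_def)
  next
    case (Cons rc l)
    then have "l = []" using deterministic_rsuccs[OF wf det tb gd] by simp
    then have "moves G (adv m) = {(adv m)\<lparr>state := fst rc, tapes := map abs_tape (snd rc)\<rparr>}"
      using mv Cons by simp
    then have a: "adv (Suc m) = (adv m)\<lparr>state := fst rc, tapes := map abs_tape (snd rc), elapsed := elapsed (adv m) + 1\<rparr>"
      using False by (simp add: adv_Suc adv_step_def game_step_def)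
    have rg: "rgame_step tb g = (rc, snd g)" using nq Cons by (simp add: rgame_step_def)
    have rc: "rc \<in> set (rsuccs tb (fst g))" using Cons by simp
    have "good G (tape_length (Suc m)) rc"
      by (rule good_mono[OF good_rsuccs[OF wf tb gd rc] tape_length_Suc])
    moreover have "good_tape (alphabet G) (Suc m) (snd rc ! 2)"
      by (rule good_tape_rsuccs_nth[OF wf tb gd rc]) (use s tape_count in \<open>simp_all add: sim_def\<close>)
    moreover have "represents (adv (Suc m)) rc" by (simp add: a represents_def)
    moreover have "capital (adv (Suc m)) = capital (adv m)" by (simp add: a)
    ultimately show ?thesis using s cm by (simp add: sim_def rg)
  qed
qed

lemma sim_adv: "is_table G tb \<Longrightarrow> sim (adv m) m (radv tb m)"
  by (induction m) (auto simp: radv_def sim_start sim_step)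

text \<open>Every bet is lost, so the capital never rises above its initial value.\<close>

lemma not_succeeds_adv_lang: "\<not> succeeds_on G adv_lang"
proof -
  obtain tb where tb: "is_table G tb" using table_exists[OF wf] by blast
  have "capital (adv m) \<le> capital (adv 0)" for m
    by (induction m) (use sim_step[OF tb sim_adv[OF tb]] order_trans in blast)+
  then show ?thesis unfolding succeeds_on_def play_adv_lang by (auto intro!: bdd_aboveI)
qed

section \<open>Recognising the adversary language\<close>

definition watch :: "(state \<times> symbol list \<Rightarrow> action list) \<Rightarrow> bool list \<Rightarrow>
    bool \<times> rconfig \<times> bool list \<times> bool list \<Rightarrow> bool \<times> rconfig \<times> bool list \<times> bool list" where
  "watch tb x s = (fst s \<or> (fst (fst (snd s)) = Query \<and> rquery (fst (snd s)) = x \<and> \<not> rsign (fst (snd s))),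
     rgame_step tb (snd s))"

lemma watch_iterate:
  "(watch tb x ^^ i) (False, rstart) =
   ((\<exists>m<i. fst (fst (radv tb m)) = Query \<and> rquery (fst (radv tb m)) = x \<and> \<not> rsign (fst (radv tb m))), radv tb i)"
  by (induction i) (auto simp: watch_def radv_def less_Suc_eq)

text \<open>The bound on intermediate values stems from the invariant \<open>sim\<close>, that is,
  from the actual play: on arbitrary arguments nothing prevents iterates of
  \<open>rgame_step\<close> from growing too fast.\<close>

lemma polytime_watch:
  assumes tb: "is_table G tb"
  shows "polytime (\<lambda>p. fst ((watch tb (fst p) ^^ snd p) (False, rstart)))"
proof -
  obtain q where q: "poly_bounded q" "\<And>n rc. good G n rc \<Longrightarrow> sz rc \<le> q n" using good_sz[OF wf] by blast
  obtain k where k: "\<And>m n. m \<le> n \<Longrightarrow> q m \<le> (n + 2) ^ k" using q(1) by (rule poly_boundedE) blast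
  have "polytime (\<lambda>p. (watch tb (fst p) ^^ snd p) (False, rstart))"
  proof (rule polytime_funpow[where f = "\<lambda>p. watch tb (fst p)"])
    show "polytime (\<lambda>p. watch tb (fst (fst p)) (snd p))"
      for p :: "(bool list \<times> nat) \<times> bool \<times> rconfig \<times> bool list \<times> bool list"
      unfolding watch_def by (intro polytime_intros polytime_comp[OF polytime_rgame_step[OF tb]])
    let ?b = "\<lambda>n. Suc (3 + Suc ((tape_length n + 2) ^ k + Suc ((1 + 4 * cap_length n) + (1 + 4 * cap_length n))))"
    show "poly_bounded ?b" unfolding tape_length_def cap_length_def by (intro poly_bounded_intros)
    fix p :: "bool list \<times> nat" and i assume i: "i \<le> snd p"
    have isz: "i \<le> sz p" using i sz_fst_snd[of p] sz_nat[of "snd p"] by linarith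
    have cl: "cap_length i \<le> cap_length (sz p)" using isz by (simp add: cap_length_def mult_le_mono)
    then have tl: "tape_length i \<le> tape_length (sz p)" using isz by (simp add: tape_length_def)
    let ?g = "radv tb i"
    have s: "sim (adv i) i ?g" by (rule sim_adv[OF tb])
    have "sz (fst ?g) \<le> (tape_length (sz p) + 2) ^ k"
      using s q(2) k[OF tl] unfolding sim_def by (meson le_trans)
    moreover have "sz (fst (snd ?g)) \<le> 1 + 4 * cap_length (sz p)" "sz (snd (snd ?g)) \<le> 1 + 4 * cap_length (sz p)"
      using s cl sz_bools[of "fst (snd ?g)"] sz_bools[of "snd (snd ?g)"] unfolding sim_def by linarith+
    ultimately have "sz ?g \<le> Suc ((tape_length (sz p) + 2) ^ k + Suc ((1 + 4 * cap_length (sz p)) + (1 + 4 * cap_length (sz p))))"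
      using sz_fst_snd[of ?g] sz_fst_snd[of "snd ?g"] by linarith
    then show "sz ((watch tb (fst p) ^^ i) (False, rstart)) \<le> ?b (sz p)"
      unfolding watch_iterate sz_prod using sz_bool by (intro Suc_le_mono[THEN iffD2] add_mono)
  qed (intro polytime_intros)+
  then show ?thesis by (rule polytime_fst)
qed

lemma adv_lang_EXP:
  assumes "p2_bounded t" "runs_in_time G t"
  shows "adv_lang \<in> EXP"
proof -
  obtain c :: nat where "\<forall>N\<ge>1. real (t N) \<le> 2 powr (log 2 (real N) ^ c + real c)"
    using assms(1) unfolding p2_bounded_def by blast
  then have c: "real (t (2 ^ n)) \<le> 2 powr (log 2 (real (2 ^ n)) ^ c + real c)" for n
    using one_le_power[of "2::nat" n] by (metis one_le_numeral)
  \<comment> \<open>At \<open>N = 2 ^ n\<close> the logarithm is exactly \<open>n\<close>, so the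
    bound takes the shape of the time bounds in \<open>EXP\<close>.\<close>
  have t: "t (2 ^ n) \<le> 2 ^ (n ^ c + c)" for n
  proof -
    have "log 2 (real (2 ^ n)) = real n" by (simp add: log_nat_power)
    then have "real (t (2 ^ n)) \<le> 2 powr (real (n ^ c + c))" using c[of n] by simp
    also have "\<dots> = real (2 ^ (n ^ c + c))" by (subst powr_realpow) simp_all
    finally show ?thesis by (simp only: of_nat_le_iff)
  qed
  obtain tb where tb: "is_table G tb" using table_exists[OF wf] by blast
  have eq: "state (adv m) = fst (fst (radv tb m)) \<and>
      (state (adv m) = Query \<longrightarrow> query_word (adv m) = rquery (fst (radv tb m)) \<and> bet_sign (adv m) = rsign (fst (radv tb m)))" for m
  proof -
    have s: "sim (adv m) m (radv tb m)" by (rule sim_adv[OF tb])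
    then have rep: "represents (adv m) (fst (radv tb m))" by (simp add: sim_def)
    have "2 \<le> length (snd (fst (radv tb m)))" using s tape_count by (simp add: sim_def good_def)
    then have "query_word (adv m) = rquery (fst (radv tb m))" by (rule represents_query[OF rep])
    moreover have "state (adv m) = fst (fst (radv tb m))" using rep by (simp add: represents_def)
    ultimately show ?thesis using sim_bet(1)[OF s] adv_bet(1)[of m] by simp
  qed
  let ?F = "\<lambda>p. fst ((watch tb (fst p) ^^ snd p) (False, rstart))"
  have "?F (x, P) = (x \<in> adv_lang)" if P: "2 ^ (length x ^ (c + 2) + (c + 2)) \<le> P" for x P
  proof -
    have "?F (x, P) \<longleftrightarrow> (\<exists>m<P. state (adv m) = Query \<and> query_word (adv m) = x \<and> \<not> bet_sign (adv m))"
      using eq by (auto simp: watch_iterate)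
    also have "\<dots> \<longleftrightarrow> x \<in> adv_lang"
    proof -
      \<comment> \<open>A word that is ever queried is queried within the time allowed for its
        length, so a word not seen within \<open>P\<close> rounds is never queried and rightly
        rejected.\<close>
      have "m < P" if m: "state (adv m) = Query" "query_word (adv m) = x" for m
      proof -
        have "m \<le> elapsed (adv m)" using elapsed_ge[of m] m by blast
        also have "\<dots> \<le> t (2 ^ length x)"
          using assms(2) m play_adv_lang unfolding runs_in_time_def by metis
        also have "\<dots> \<le> 2 ^ (length x ^ c + c)" by (rule t)
        also have "\<dots> < 2 ^ (length x ^ (c + 2) + (c + 2))" by (rule pad_exponent)
        finally show ?thesis using P by linarith
      qed
      then show ?thesis unfolding adv_lang_def by blast
    qed
    finally show ?thesis .
  qed
  then show ?thesis
    using polytime_watch[OF tb] unfolding EXP_iff_pad_decidable pad_decidable_def by blast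
qed

end

theorem theorem4p8:
  fixes k :: nat
  assumes "k > 0"
    and "p2_betting_game_measure_zero {A. Sigma_P k A = Pi_P k A}"
  shows "Sigma_P k {} \<noteq> EXP"
proof
  assume collapse: "Sigma_P k {} = EXP"
  obtain G t where G: "is_betting_game G" "p2_bounded t" "runs_in_time G t"
    and succ: "\<And>A. Sigma_P k A = Pi_P k A \<Longrightarrow> succeeds_on G A"
    using assms(2) unfolding p2_betting_game_measure_zero_def p2_betting_game_def by blast
  interpret betting G by unfold_locales (rule G(1))
  have "adv_lang \<in> EXP" by (rule adv_lang_EXP[OF G(2,3)])
  then have "Sigma_P k adv_lang = EXP"
    using Sigma_P_subset_EXP Sigma_P_empty_subset collapse by blast
  moreover have "Pi_P k adv_lang = EXP"
    \<comment> \<open>Every language in \<open>EXP\<close> is the complement of its own complement,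
      which lies in \<open>EXP\<close> again.\<close>
    unfolding Pi_P_def \<open>Sigma_P k adv_lang = EXP\<close> using EXP_complement by (auto intro: exI[of _ "- _"])
  ultimately show False using succ not_succeeds_adv_lang by simp
qed

end
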